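(* Let $r\in(1,\infty]$, let $\varphi:\mathbb{R}^n\times[0,\infty)\to[0,\infty)$ be a Musielak-Orlicz function of uniformly lower type $p_\varphi^-$ and of uniformly upper type $p_\varphi^+$, let $q\in(1,\infty)$ and $\varphi\in\mathbb{A}_q(\mathbb{R}^n)$. If $q(\varphi)<p_\varphi^-\le p_\varphi^+<\infty$, then there exists a positive constant $C$ such that, for all $\{f_j\}_{j\in\mathbb{Z}}\in L^\varphi(\ell^r,\mathbb{R}^n)$, $$\int_{\mathbb{R}^n}\varphi\left(x,\Big\{\sum_{j\in\mathbb{Z}}[M(f_j)(x)]^r\Big\}^{1/r}\right)dx\le C\int_{\mathbb{R}^n}\varphi\left(x,\Big[\sum_{j\in\mathbb{Z}}|f_j(x)|^r\Big]^{1/r}\right)dx.$$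
   Context: An Orlicz function is a nondecreasing function $\Phi:[0,\infty)\to[0,\infty)$ with $\Phi(0)=0$, $\Phi(t)>0$ for $t\in(0,\infty)$ and $\lim_{t\to\infty}\Phi(t)=\infty$. A function $\varphi:\mathbb{R}^n\times[0,\infty)\to[0,\infty)$ is a Musielak-Orlicz function if $\varphi(x,\cdot)$ is an Orlicz function for every $x\in\mathbb{R}^n$ and $\varphi(\cdot,t)$ is measurable for every $t\in[0,\infty)$. It is of uniformly upper type $p$ (resp. uniformly lower type $p$), $p\in[0,\infty)$, if there is a positive constant $C$ such that $\varphi(x,st)\le Cs^p\varphi(x,t)$ for all $x\in\mathbb{R}^n$, $t\in[0,\infty)$ and $s\in[1,\infty)$ (resp. $s\in[0,1]$). $\varphi\in\mathbb{A}_q(\mathbb{R}^n)$, $q\in[1,\infty)$, means: $\varphi$ is uniformly locally integrable, i.e. $\int_K\sup_{t\in(0,\infty)}\{\varphi(x,t)[\int_K\varphi(y,t)\,dy]^{-1}\}\,dx<\infty$ for all compact $K\subset\mathbb{R}^n$, and, when $q\in(1,\infty)$, $$\sup_{t\in(0,\infty)}\sup_{B\subset\mathbb{R}^n}\frac1{|B|^q}\int_B\varphi(x,t)\,dx\left\{\int_B[\varphi(y,t)]^{-q'/q}\,dy\right\}^{q/q'}<\infty,\quad \frac1q+\frac1{q'}=1,$$ or, when $q=1$, $$\sup_{t\in(0,\infty)}\sup_{B\subset\mathbb{R}^n}\frac1{|B|}\int_B\varphi(x,t)\,dx\ \operatorname{ess\,sup}_{y\in B}[\varphi(y,t)]^{-1}<\infty,$$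 $B$ ranging over all balls. The critical index is $q(\varphi):=\inf\{q\in[1,\infty):\varphi\in\mathbb{A}_q(\mathbb{R}^n)\}$. $Mf(x):=\sup_{B\ni x}\frac1{|B|}\int_B|f(y)|\,dy$ (supremum over all balls $B$ containing $x$) is the Hardy-Littlewood maximal function. $L^\varphi(\mathbb{R}^n)$ is the space of measurable $f$ with $\int_{\mathbb{R}^n}\varphi(x,|f(x)|)\,dx<\infty$, and $L^\varphi(\ell^r,\mathbb{R}^n)$ is the set of sequences $\{f_j\}_{j\in\mathbb{Z}}$ of measurable functions with $[\sum_j|f_j|^r]^{1/r}\in L^\varphi(\mathbb{R}^n)$. When $r=\infty$, $[\sum_j|a_j|^r]^{1/r}$ means $\sup_j|a_j|$. *)

theory Defs
  imports "HOL-Analysis.Analysis" "HOL-Probability.Essential_Supremum"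
begin

(* Functions on [0,\<infinity>) are represented by functions on the reals of which only the
   values at t \<ge> 0 matter. Nonnegativity of the values follows from monotonicity and
   the value 0 at 0. *)
definition Orlicz_function :: "(real \<Rightarrow> real) \<Rightarrow> bool" where
  "Orlicz_function \<Phi> \<longleftrightarrow>
     mono_on {0..} \<Phi> \<and> \<Phi> 0 = 0 \<and> (\<forall>t>0. \<Phi> t > 0) \<and> filterlim \<Phi> at_top at_top"

definition Musielak_Orlicz_function :: "(real ^ 'n \<Rightarrow> real \<Rightarrow> real) \<Rightarrow> bool" where
  "Musielak_Orlicz_function \<phi> \<longleftrightarrow>
     (\<forall>x. Orlicz_function (\<phi> x)) \<and> (\<forall>t\<ge>0. (\<lambda>x. \<phi> x t) \<in> borel_measurable lebesgue)"

definition uniformly_upper_type :: "(real ^ 'n \<Rightarrow> real \<Rightarrow> real) \<Rightarrow> real \<Rightarrow> bool" where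
  "uniformly_upper_type \<phi> p \<longleftrightarrow>
     0 \<le> p \<and> (\<exists>C>0. \<forall>x. \<forall>t\<ge>0. \<forall>s\<ge>1. \<phi> x (s * t) \<le> C * s powr p * \<phi> x t)"

(* At s = 0 both sides of the inequality vanish for the functions considered, so the
   convention 0 powr 0 = 0 is harmless. *)
definition uniformly_lower_type :: "(real ^ 'n \<Rightarrow> real \<Rightarrow> real) \<Rightarrow> real \<Rightarrow> bool" where
  "uniformly_lower_type \<phi> p \<longleftrightarrow>
     0 \<le> p \<and> (\<exists>C>0. \<forall>x. \<forall>t\<ge>0. \<forall>s\<in>{0..1}. \<phi> x (s * t) \<le> C * s powr p * \<phi> x t)"

(* Real powers of elements of [0,\<infinity>], used for exponents a > 0 only. *)
definition ennpowr :: "ennreal \<Rightarrow> real \<Rightarrow> ennreal" where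
  "ennpowr x a = (if x = \<infinity> then \<infinity> else ennreal (enn2real x powr a))"

definition balls :: "(real ^ 'n) set set" where
  "balls = {ball c \<rho> | c \<rho>. 0 < \<rho>}"

(* For K of positive measure the inner integral is positive, and for K of measure zero the
   outer integral is 0, so the value of 1/0 is irrelevant. The inner integral is finite
   whenever the supremum over balls in Muckenhoupt_class is finite. *)
definition uniformly_locally_integrable :: "(real ^ 'n \<Rightarrow> real \<Rightarrow> real) \<Rightarrow> bool" where
  "uniformly_locally_integrable \<phi> \<longleftrightarrow>
     (\<forall>K. compact K \<longrightarrow>
        (\<integral>\<^sup>+x\<in>K. (SUP t\<in>{0<..}. ennreal (\<phi> x t) / (\<integral>\<^sup>+y\<in>K. ennreal (\<phi> y t) \<partial>lebesgue)) \<partial>lebesgue) < \<infinity>)"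

definition Muckenhoupt_class :: "real \<Rightarrow> (real ^ 'n \<Rightarrow> real \<Rightarrow> real) set" where
  "Muckenhoupt_class q =
     {\<phi>. 1 \<le> q \<and> uniformly_locally_integrable \<phi> \<and>
        (if q = 1 then
           (SUP t\<in>{0<..}. SUP B\<in>balls.
              1 / emeasure lebesgue B * (\<integral>\<^sup>+x\<in>B. ennreal (\<phi> x t) \<partial>lebesgue) *
              esssup (restrict_space lebesgue B) (\<lambda>y. ennreal (1 / \<phi> y t))) < \<infinity>
         else
           (let q' = q / (q - 1) in
            (SUP t\<in>{0<..}. SUP B\<in>balls.
               1 / ennpowr (emeasure lebesgue B) q * (\<integral>\<^sup>+x\<in>B. ennreal (\<phi> x t) \<partial>lebesgue) *
               ennpowr (\<integral>\<^sup>+y\<in>B. ennreal (\<phi> y t powr (- (q' / q))) \<partial>lebesgue) (q / q')) < \<infinity>))}"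

definition critical_index :: "(real ^ 'n \<Rightarrow> real \<Rightarrow> real) \<Rightarrow> ereal" where
  "critical_index \<phi> = (INF q\<in>{q. \<phi> \<in> Muckenhoupt_class q}. ereal q)"

definition Hardy_Littlewood_maximal :: "(real ^ 'n \<Rightarrow> complex) \<Rightarrow> real ^ 'n \<Rightarrow> ennreal" where
  "Hardy_Littlewood_maximal f x =
     (SUP B\<in>{B \<in> balls. x \<in> B}.
        1 / emeasure lebesgue B * (\<integral>\<^sup>+y\<in>B. ennreal (norm (f y)) \<partial>lebesgue))"

(* [\<Sum>\<^sub>j a\<^sub>j\<^sup>r]\<^sup>1\<^sup>/\<^sup>r for a [0,\<infinity>]-valued sequence, read as the supremum when r = \<infinity> *)
definition lr_aggregate :: "ennreal \<Rightarrow> (int \<Rightarrow> ennreal) \<Rightarrow> ennreal" where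
  "lr_aggregate r a =
     (if r = \<infinity> then (SUP j. a j)
      else ennpowr (\<Sum>\<^sub>\<infinity>j\<in>UNIV. ennpowr (a j) (enn2real r)) (1 / enn2real r))"

(* Extension of the function to t = \<infinity> by its limit there. *)
definition MO_extend :: "(real ^ 'n \<Rightarrow> real \<Rightarrow> real) \<Rightarrow> real ^ 'n \<Rightarrow> ennreal \<Rightarrow> ennreal" where
  "MO_extend \<phi> x t = (if t = \<infinity> then \<infinity> else ennreal (\<phi> x (enn2real t)))"

(* The lower integral is used, since x \<mapsto> \<phi>(x, g(x)) need not be measurable when \<phi>(x,\<cdot>)
   has jumps. For \<phi> of positive uniformly lower type and finite uniformly upper type it is
   bounded above and below by constant multiples of \<psi>(x, g(x)) with
   \<psi>(x,t) = \<integral>\<^sub>0\<^sup>t \<phi>(x,s)/s ds, which is measurable. *)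
definition MO_modular :: "(real ^ 'n \<Rightarrow> real \<Rightarrow> real) \<Rightarrow> (real ^ 'n \<Rightarrow> ennreal) \<Rightarrow> ennreal" where
  "MO_modular \<phi> g = (\<integral>\<^sup>+x. MO_extend \<phi> x (g x) \<partial>lebesgue)"

(* Only the nonnegative (possibly infinite) elements of the space are needed; they are
   finite almost everywhere. *)
definition MO_space_nonneg :: "(real ^ 'n \<Rightarrow> real \<Rightarrow> real) \<Rightarrow> (real ^ 'n \<Rightarrow> ennreal) set" where
  "MO_space_nonneg \<phi> = {g \<in> borel_measurable lebesgue. MO_modular \<phi> g < \<infinity>}"

definition MO_sequence_space ::
    "(real ^ 'n \<Rightarrow> real \<Rightarrow> real) \<Rightarrow> ennreal \<Rightarrow> (int \<Rightarrow> real ^ 'n \<Rightarrow> complex) set" where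
  "MO_sequence_space \<phi> r =
     {f. (\<forall>j. f j \<in> borel_measurable lebesgue) \<and>
         (\<lambda>x. lr_aggregate r (\<lambda>j. ennreal (norm (f j x)))) \<in> MO_space_nonneg \<phi>}"

end

theory Submission
  imports Defs
begin

text \<open>Write \<open>g\<close> for the \<open>\<ell>\<^sup>r\<close>-norm of the sequence \<open>f\<^sub>j\<close> and \<open>T\<close> for the \<open>\<ell>\<^sup>r\<close>-norm of the sequence
\<open>M f\<^sub>j\<close>. The two growth conditions make \<open>\<phi>(x,T)\<close> comparable to the sum of \<open>\<phi>(x,2\<^sup>k)\<close> over the integers
\<open>k\<close> with \<open>2\<^sup>k < T\<close>. The modular of \<open>T\<close> is therefore controlled by the masses of the sets
\<open>T > K 2\<^sup>k\<close> with respect to the weights \<open>w\<^sub>k = \<phi>(\<cdot>,2\<^sup>k)\<close>. These weights satisfy a Muckenhoupt condition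
\<open>A\<^sub>q\<close> with one common constant, and since the critical index lies below the lower type \<open>p\<^sup>-\<close>, the exponent
can be chosen with \<open>1 < q < p\<^sup>-\<close>. The heart of the matter is an inequality for a single level \<open>l\<close> and a
single weight \<open>w\<close> (\<open>level_inequality\<close>): the \<open>w\<close>-mass of \<open>T > 5\<^sup>n l\<close> is at most a constant times
\<open>l\<^sup>-\<^sup>q \<integral> g\<^sup>q w\<close> over the set \<open>g > l/2\<close> plus \<open>l\<^sup>-\<^sup>e \<integral> g\<^sup>e w\<close> over the set \<open>g \<le> l\<close>, where
\<open>e\<close> exceeds the upper type \<open>p\<^sup>+\<close>. For \<open>l = 2\<^sup>k\<close> and \<open>w = w\<^sub>k\<close> the sum over \<open>k\<close> is at each point dominated by
two geometric series, the first convergent because \<open>q < p\<^sup>-\<close> and the second because \<open>p\<^sup>+ < e\<close>,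
and both are bounded by a multiple of \<open>\<phi>(x,g)\<close>.

The level inequality comes from a Calderon-Zygmund decomposition of \<open>g\<close> into balls
(\<open>Calderon_Zygmund_balls\<close>). The average of \<open>g\<close> over each selected ball is at least \<open>l\<close>, so the \<open>A\<^sub>q\<close> condition bounds
the total weight of the balls by the first integral, and by doubling this also
bounds the weight of the union of tenfold enlargements. Outside that union, replacing each \<open>f\<^sub>j\<close> by the function
\<open>F\<^sub>j\<close> in which the mass on an enlarged ball is spread evenly over the ball costs only a factor \<open>5\<^sup>n\<close> in the
maximal function. By Minkowski's inequality the \<open>\<ell>\<^sup>r\<close>-norm of the \<open>F\<^sub>j\<close> is at most \<open>5\<^sup>n l\<close> on the balls, and away
from the enlarged balls it equals \<open>g \<le> l\<close> almost everywhere. The weak-type inequality with a large exponent \<open>e = r s\<close> applied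
to the \<open>F\<^sub>j\<close> therefore yields the second integral and a further multiple of the first.

The large exponent is obtained by duality (\<open>vector_maximal_large_exponent\<close>). On the superlevel set \<open>E\<close> the weight
\<open>v = 1\<^sub>E w\<close> is moved from \<open>M F\<^sub>j\<close> to \<open>F\<^sub>j\<close> by the Fefferman-Stein inequality
\<open>\<integral> (M F)\<^sup>r v \<le> C \<integral> F\<^sup>r M v\<close>, after which the sum over \<open>j\<close> can be carried out inside the integral. Hoelder's
inequality and Muckenhoupt's theorem for the dual weight of \<open>w\<close> finish the estimate. Muckenhoupt's theorem
itself follows by Lerner's argument from the boundedness of the maximal operators with respect to the doubling measures
\<open>w dx\<close> and \<open>\<sigma> dx\<close>. These bounds and the Fefferman-Stein inequality are three instances of
one Vitali covering argument (\<open>maximal_weak_type\<close>, \<open>maximal_strong_type\<close>).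

For \<open>r = \<infinity>\<close> the supremum over \<open>j\<close> moves inside the maximal operator, which leaves the case of a single function.\<close>

section \<open>Powers of extended nonnegative reals and Hoelder's inequality\<close>

lemma ennpowr_ennreal: "0 \<le> x \<Longrightarrow> ennpowr (ennreal x) a = ennreal (x powr a)"
  by (simp add: ennpowr_def)

lemma ennpowr_0 [simp]: "ennpowr 0 a = 0"
  by (simp add: ennpowr_def)

lemma ennpowr_top [simp]: "ennpowr top a = top"
  by (simp add: ennpowr_def)

lemma ennpowr_1 [simp]: "ennpowr 1 a = 1"
  by (simp add: ennpowr_def)

lemma ennpowr_one [simp]: "ennpowr x 1 = x"
  by (cases x) (auto simp: ennpowr_ennreal)

lemma ennpowr_eq_0_iff [simp]: "ennpowr x a = 0 \<longleftrightarrow> x = 0"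
  by (cases x) (auto simp: ennpowr_ennreal)

lemma ennpowr_eq_top_iff [simp]: "ennpowr x a = top \<longleftrightarrow> x = top"
  by (cases x) (auto simp: ennpowr_ennreal)

lemma ennpowr_less_top_iff [simp]: "ennpowr x a < top \<longleftrightarrow> x < top"
  by (simp add: less_top [symmetric])

lemma ennpowr_mono: "0 \<le> a \<Longrightarrow> x \<le> y \<Longrightarrow> ennpowr x a \<le> ennpowr y a"
  by (cases x; cases y) (auto simp: ennpowr_ennreal top_unique intro!: ennreal_leI powr_mono2)

lemma ennpowr_ennpowr [simp]: "ennpowr (ennpowr x a) b = ennpowr x (a * b)"
  by (cases x) (auto simp: ennpowr_ennreal powr_powr)

lemma ennpowr_le_iff [simp]:
  assumes "0 < a" shows "ennpowr x a \<le> ennpowr y a \<longleftrightarrow> x \<le> y"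
proof
  assume "ennpowr x a \<le> ennpowr y a"
  then have "ennpowr (ennpowr x a) (1/a) \<le> ennpowr (ennpowr y a) (1/a)"
    using assms by (simp only: ennpowr_mono divide_nonneg_pos zero_le_one)
  then show "x \<le> y" using assms by simp
qed (use assms ennpowr_mono in auto)

lemma ennpowr_le_cancel:
  assumes "0 < a" "ennpowr x a \<le> y" shows "x \<le> ennpowr y (1 / a)"
proof -
  have "y = ennpowr (ennpowr y (1 / a)) a" using assms by simp
  then show ?thesis using assms by (metis ennpowr_le_iff)
qed

lemma ennpowr_mult: "ennpowr (x * y) a = ennpowr x a * ennpowr y a"
proof (cases "x = top \<or> y = top")
  case True
  then show ?thesis
    by (auto simp: ennreal_mult_top ennreal_top_mult)
next
  case False
  then show ?thesis
    by (cases x; cases y) (auto simp: ennpowr_ennreal powr_mult simp flip: ennreal_mult)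
qed

lemma ennpowr_add: "ennpowr x (a + b) = ennpowr x a * ennpowr x b"
  by (cases x) (auto simp: ennpowr_ennreal powr_add ennreal_mult_top simp flip: ennreal_mult)

lemma ennpowr_measurable [measurable]:
  "f \<in> borel_measurable M \<Longrightarrow> (\<lambda>x. ennpowr (f x) a) \<in> borel_measurable M"
proof -
  assume f [measurable]: "f \<in> borel_measurable M"
  have "f -` {\<infinity>} \<inter> space M \<in> sets M"
    by (rule measurable_sets[OF f]) simp
  then have [measurable]: "{x \<in> space M. f x = \<infinity>} \<in> sets M"
    by (simp add: vimage_def Int_def conj_commute)
  show ?thesis
    unfolding ennpowr_def by (rule measurable_If) measurable
qed

lemma ennpowr_SUP:
  assumes "0 < a"
  shows "ennpowr (SUP i\<in>I. f i) a = (SUP i\<in>I. ennpowr (f i) a)"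
proof (rule antisym)
  show "(SUP i\<in>I. ennpowr (f i) a) \<le> ennpowr (SUP i\<in>I. f i) a"
    using assms by (auto intro!: SUP_least SUP_upper)
  have "(SUP i\<in>I. f i) \<le> ennpowr (SUP i\<in>I. ennpowr (f i) a) (1 / a)"
    using assms by (intro SUP_least ennpowr_le_cancel) (auto intro: SUP_upper)
  then have "ennpowr (SUP i\<in>I. f i) a \<le> ennpowr (ennpowr (SUP i\<in>I. ennpowr (f i) a) (1 / a)) a"
    using assms by (simp only: ennpowr_le_iff)
  then show "ennpowr (SUP i\<in>I. f i) a \<le> (SUP i\<in>I. ennpowr (f i) a)"
    using assms by simp
qed

text \<open>Young's inequality after dividing \<open>a\<close> and \<open>b\<close> by \<open>x\<^sup>1\<^sup>/\<^sup>s\<close> and \<open>y\<^sup>1\<^sup>-\<^sup>1\<^sup>/\<^sup>s\<close>. In Hoelder's inequality \<open>x\<close> and \<open>y\<close> are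
the integrals of \<open>a\<^sup>s\<close> and \<open>b\<^sup>s\<^sup>/\<^sup>(\<^sup>s\<^sup>-\<^sup>1\<^sup>)\<close>, so that the two terms integrate to the convex coefficients
\<open>1/s\<close> and \<open>1 - 1/s\<close>.\<close>
lemma Youngs_inequality_ennreal:
  assumes s: "1 < s" and x: "0 < x" and y: "0 < y"
  shows "a * b \<le> ennreal (x powr (1/s) * y powr (1 - 1/s)) *
           (ennpowr a s * ennreal (1 / (s * x)) + ennpowr b (s/(s-1)) * ennreal ((1 - 1/s) / y))"
proof (cases "a = top \<or> b = top")
  case True
  have "0 < ennreal (x powr (1/s) * y powr (1 - 1/s))" "0 < ennreal (1 / (s * x))"
       "0 < ennreal ((1 - 1/s) / y)"
    using assms by (auto simp: divide_simps)
  then show ?thesis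
    using True by (auto simp: ennreal_mult_top ennreal_top_mult)
next
  case False
  then obtain \<alpha> \<beta> where ab: "a = ennreal \<alpha>" "b = ennreal \<beta>" "0 \<le> \<alpha>" "0 \<le> \<beta>"
    by (cases a; cases b) auto
  define u where "u = \<alpha> / x powr (1/s)"
  define v where "v = \<beta> / y powr (1 - 1/s)"
  let ?R = "\<alpha> powr s * (1 / (s * x)) + \<beta> powr (s/(s-1)) * ((1 - 1/s) / y)"
  have "u * v \<le> u powr s / s + v powr (s/(s-1)) / (s/(s-1))"
    using Youngs_inequality[of s "s/(s-1)" u v] s x y ab by (simp add: u_def v_def divide_simps)
  also have "u powr s = \<alpha> powr s / x"
    using ab x s by (simp add: u_def powr_divide powr_powr)
  also have "v powr (s/(s-1)) = \<beta> powr (s/(s-1)) / y powr ((1 - 1/s) * (s/(s-1)))"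
    using ab y s by (simp add: v_def powr_divide powr_powr)
  also have "(1 - 1/s) * (s/(s-1)) = 1"
    using s by (simp add: divide_simps)
  finally have *: "u * v \<le> ?R"
    using s x y by (simp add: field_simps)
  have "\<alpha> * \<beta> = (x powr (1/s) * y powr (1 - 1/s)) * (u * v)"
    using x y by (simp add: u_def v_def)
  also have "\<dots> \<le> (x powr (1/s) * y powr (1 - 1/s)) *
       ?R"
    by (intro mult_left_mono *) auto
  finally have le: "\<alpha> * \<beta> \<le> (x powr (1/s) * y powr (1 - 1/s)) *
       ?R" .
  have nn: "0 \<le> 1 / (s * x)" "0 \<le> (1 - 1/s) / y" using s x y by (auto simp: divide_simps)
  have eq: "ennpowr a s * ennreal (1 / (s * x)) + ennpowr b (s/(s-1)) * ennreal ((1 - 1/s) / y)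
     = ennreal ?R"
    using ab mult_nonneg_nonneg[OF powr_ge_zero nn(1)] mult_nonneg_nonneg[OF powr_ge_zero nn(2)] nn
    by (simp only: ennpowr_ennreal ennreal_plus ennreal_mult powr_ge_zero)
  show ?thesis
    unfolding eq using ab by (subst ennreal_mult'[symmetric]) (auto simp: ennreal_mult'[symmetric] intro!: ennreal_leI order.trans[OF le])
qed

text \<open>Both sides are raised to the power \<open>s\<close>; this avoids roots and is the form in which the Muckenhoupt condition is written.\<close>
lemma Hoelder_inequality_ennreal:
  assumes s: "1 < s" and [measurable]: "a \<in> borel_measurable M" "b \<in> borel_measurable M"
  shows "ennpowr (\<integral>\<^sup>+x. a x * b x \<partial>M) s \<le>
     (\<integral>\<^sup>+x. ennpowr (a x) s \<partial>M) * ennpowr (\<integral>\<^sup>+x. ennpowr (b x) (s / (s - 1)) \<partial>M) (s - 1)"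
proof -
  define X where "X = (\<integral>\<^sup>+x. ennpowr (a x) s \<partial>M)"
  define Y where "Y = (\<integral>\<^sup>+x. ennpowr (b x) (s / (s - 1)) \<partial>M)"
  let ?Z = "\<integral>\<^sup>+x. a x * b x \<partial>M"
  have "ennpowr ?Z s \<le> X * ennpowr Y (s - 1)"
  proof (cases "X = 0 \<or> Y = 0")
    case True
    then have "(AE x in M. a x = 0) \<or> (AE x in M. b x = 0)"
      unfolding X_def Y_def by (simp add: nn_integral_0_iff_AE)
    then have "AE x in M. a x * b x = 0" by auto
    then have "?Z = 0" by (simp add: nn_integral_0_iff_AE)
    then show ?thesis by simp
  next
    case ne: False
    show ?thesis
    proof (cases "X = top \<or> Y = top")
      case True
      then show ?thesis using ne by (auto simp: ennreal_mult_top ennreal_top_mult)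
    next
      case False
      then obtain x y where xy: "X = ennreal x" "Y = ennreal y" "0 < x" "0 < y"
        using ne by (cases X; cases Y) (auto simp: less_le)
      let ?k = "x powr (1/s) * y powr (1 - 1/s)"
      have "?Z \<le> (\<integral>\<^sup>+z. ennreal ?k *
           (ennpowr (a z) s * ennreal (1 / (s * x)) + ennpowr (b z) (s/(s-1)) * ennreal ((1 - 1/s) / y)) \<partial>M)"
        by (intro nn_integral_mono Youngs_inequality_ennreal s xy)
      also have "\<dots> = ennreal ?k * (X * ennreal (1 / (s * x)) + Y * ennreal ((1 - 1/s) / y))"
        by (simp add: nn_integral_cmult nn_integral_add nn_integral_multc X_def Y_def)
      also have "X * ennreal (1 / (s * x)) = ennreal (1/s)"
        using xy s by (simp add: ennreal_mult[symmetric])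
      also have "Y * ennreal ((1 - 1/s) / y) = ennreal (1 - 1/s)"
        using xy s by (simp add: ennreal_mult[symmetric])
      also have "ennreal (1/s) + ennreal (1 - 1/s) = 1"
        using s by (simp add: ennreal_plus[symmetric] del: ennreal_plus)
      finally have "?Z \<le> ennreal ?k" by simp
      then have "ennpowr ?Z s \<le> ennpowr (ennreal ?k) s"
        using s by simp
      also have "\<dots> = ennreal (x * y powr (s - 1))"
        using s xy by (simp add: ennpowr_ennreal powr_mult powr_powr algebra_simps)
      also have "\<dots> = X * ennpowr Y (s - 1)"
        using xy by (simp add: ennpowr_ennreal ennreal_mult)
      finally show ?thesis .
    qed
  qed
  then show ?thesis by (simp add: X_def Y_def)
qed

text \<open>The factors \<open>w\<^sup>1\<^sup>/\<^sup>s\<close> and \<open>w\<^sup>-\<^sup>1\<^sup>/\<^sup>s\<close> are distributed over \<open>a\<close> and \<open>b\<close>; raised to the dual exponent, the second one becomes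
the dual weight \<open>w\<^sup>-\<^sup>1\<^sup>/\<^sup>(\<^sup>s\<^sup>-\<^sup>1\<^sup>)\<close>.\<close>
lemma weighted_Hoelder_inequality:
  fixes w :: "'a \<Rightarrow> real"
  assumes s: "1 < s" and [measurable]: "a \<in> borel_measurable M" "b \<in> borel_measurable M" "w \<in> borel_measurable M"
    and w: "\<And>x. 0 < w x"
  shows "ennpowr (\<integral>\<^sup>+x. a x * b x \<partial>M) s \<le>
     (\<integral>\<^sup>+x. ennpowr (a x) s * w x \<partial>M) *
     ennpowr (\<integral>\<^sup>+x. ennpowr (b x) (s / (s - 1)) * ennreal (w x powr (- 1 / (s - 1))) \<partial>M) (s - 1)"
proof -
  have 1: "a x * b x = (a x * ennreal (w x powr (1/s))) * (b x * ennreal (w x powr (- 1/s)))" for x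
  proof -
    have "(a x * ennreal (w x powr (1/s))) * (b x * ennreal (w x powr (- 1/s)))
      = a x * b x * (ennreal (w x powr (1/s)) * ennreal (w x powr (- 1/s)))"
      by (simp add: mult_ac)
    also have "ennreal (w x powr (1/s)) * ennreal (w x powr (- 1/s)) = 1"
      using w[of x] by (simp add: ennreal_mult[symmetric] powr_add[symmetric])
    finally show ?thesis by simp
  qed
  have 2: "ennpowr (a x * ennreal (w x powr (1/s))) s = ennpowr (a x) s * w x" for x
    using w[of x] s by (simp add: ennpowr_mult ennpowr_ennreal powr_powr)
  have 3: "ennpowr (b x * ennreal (w x powr (- 1/s))) (s/(s-1))
      = ennpowr (b x) (s / (s - 1)) * ennreal (w x powr (- 1 / (s - 1)))" for x
    using w[of x] s by (simp add: ennpowr_mult ennpowr_ennreal powr_powr)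
  show ?thesis
    unfolding 1 2[symmetric] 3[symmetric] by (intro Hoelder_inequality_ennreal s; measurable)
qed

section \<open>Dyadic levels\<close>

abbreviation dyadic :: "int \<Rightarrow> real" where
  "dyadic k \<equiv> 2 powr real_of_int k"

text \<open>Counting \<open>k\<close> downwards from the largest integer with \<open>2\<^sup>k \<le> y\<close>, the terms are dominated by those of the geometric
series with ratio \<open>2\<^sup>-\<^sup>\<delta>\<close>. The bound is the same for all \<open>y\<close>.\<close>
lemma sum_dyadic_powers_below:
  assumes \<delta>: "0 < \<delta>"
  shows "(\<integral>\<^sup>+k. ennreal ((dyadic k / y) powr \<delta>) * indicator {k. dyadic k \<le> y} k \<partial>count_space UNIV)
     \<le> ennreal (1 / (1 - 2 powr (- \<delta>)))"
proof (cases "0 < y")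
  case False
  then have "{k. dyadic k \<le> y} = {}"
    by (auto simp: not_less) (metis less_le_trans not_le powr_gt_zero zero_neq_numeral order.trans)
  then show ?thesis by simp
next
  case y: True
  define k0 where "k0 = \<lfloor>log 2 y\<rfloor>"
  have in_iff: "dyadic k \<le> y \<longleftrightarrow> k \<le> k0" for k
    using y by (simp add: k0_def le_floor_iff le_log_iff)
  have set: "{k. dyadic k \<le> y} = (\<lambda>m. k0 - int m) ` UNIV"
    unfolding in_iff by (auto intro!: image_eqI[where x="nat (k0 - _)"])
  have inj: "inj (\<lambda>m. k0 - int m)" by (auto simp: inj_on_def)
  have k0: "dyadic k0 \<le> y" using in_iff[of k0] by simp
  have r: "norm (2 powr (- \<delta>) :: real) < 1" using \<delta> by (simp add: powr_less_one)
  have "(\<integral>\<^sup>+k. ennreal ((dyadic k / y) powr \<delta>) * indicator {k. dyadic k \<le> y} k \<partial>count_space UNIV)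
    = (\<integral>\<^sup>+k. ennreal ((dyadic k / y) powr \<delta>) \<partial>count_space ((\<lambda>m. k0 - int m) ` UNIV))"
    unfolding set by (simp add: nn_integral_count_space_indicator)
  also have "\<dots> = (\<integral>\<^sup>+m. ennreal ((dyadic (k0 - int m) / y) powr \<delta>) \<partial>count_space UNIV)"
    by (rule nn_integral_bij_count_space[symmetric]) (use inj in \<open>simp add: bij_betw_def\<close>)
  also have "\<dots> \<le> (\<integral>\<^sup>+m. ennreal ((2 powr (- \<delta>)) ^ m) \<partial>count_space UNIV)"
  proof (intro nn_integral_mono ennreal_leI)
    fix m
    have "dyadic (k0 - int m) / y = (dyadic k0 / y) * 2 powr (- real m)"
      by (simp add: powr_diff powr_minus_divide)
    also have "\<dots> \<le> 1 * 2 powr (- real m)"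
      using k0 y by (intro mult_right_mono) (auto simp: divide_simps)
    finally have "(dyadic (k0 - int m) / y) powr \<delta> \<le> (2 powr (- real m)) powr \<delta>"
      using \<delta> y by (intro powr_mono2) auto
    also have "\<dots> = (2 powr (- \<delta>)) ^ m"
      by (simp add: powr_powr powr_realpow[symmetric] mult.commute)
    finally show "(dyadic (k0 - int m) / y) powr \<delta> \<le> (2 powr (- \<delta>)) ^ m" .
  qed
  also have "\<dots> = ennreal (1 / (1 - 2 powr (- \<delta>)))"
    unfolding nn_integral_count_space_nat
    using geometric_sums[OF r] by (intro suminf_ennreal_eq) auto
  finally show ?thesis .
qed

lemma sum_dyadic_powers_above:
  assumes \<delta>: "0 < \<delta>" and y: "0 \<le> y"
  shows "(\<integral>\<^sup>+k. ennreal ((y / dyadic k) powr \<delta>) * indicator {k. y \<le> dyadic k} k \<partial>count_space UNIV)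
     \<le> ennreal (1 / (1 - 2 powr (- \<delta>)))"
proof (cases "y = 0")
  case False
  with y have y: "0 < y" by simp
  have "(\<integral>\<^sup>+k. ennreal ((y / dyadic k) powr \<delta>) * indicator {k. y \<le> dyadic k} k \<partial>count_space UNIV)
    = (\<integral>\<^sup>+k. ennreal ((y / 2 powr real_of_int (- k)) powr \<delta>) * indicator {k. y \<le> dyadic k} (- k) \<partial>count_space UNIV)"
    by (rule nn_integral_bij_count_space[symmetric]) (rule bij_uminus)
  also have "\<dots> = (\<integral>\<^sup>+k. ennreal ((dyadic k / (1/y)) powr \<delta>) * indicator {k. dyadic k \<le> 1/y} k \<partial>count_space UNIV)"
    using y by (intro nn_integral_cong arg_cong2[where f="(*)"])
      (auto simp: indicator_def powr_minus field_simps)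
  also have "\<dots> \<le> ennreal (1 / (1 - 2 powr (- \<delta>)))"
    by (rule sum_dyadic_powers_below[OF \<delta>])
  finally show ?thesis .
qed (use \<delta> in \<open>simp\<close>)

lemma dyadic_level:
  fixes t :: real
  assumes "0 < t" "0 < K"
  obtains k :: int where "K * dyadic k < t" "t \<le> K * dyadic (k + 1)"
proof
  let ?k = "\<lceil>log 2 (t / K)\<rceil> - 1"
  have "real_of_int ?k < log 2 (t / K)" by linarith
  then show "K * 2 powr real_of_int ?k < t"
    using assms by (subst (asm) less_log_iff) (auto simp: field_simps)
  have "log 2 (t / K) \<le> real_of_int (?k + 1)" by linarith
  then show "t \<le> K * 2 powr real_of_int (?k + 1)"
    using assms by (subst (asm) log_le_iff) (auto simp: field_simps)
qed

lemma Orlicz_functionD: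
  assumes "Orlicz_function \<Phi>"
  shows "0 \<le> a \<Longrightarrow> a \<le> b \<Longrightarrow> \<Phi> a \<le> \<Phi> b" "\<Phi> 0 = 0" "0 < t \<Longrightarrow> 0 < \<Phi> t" "0 \<le> t \<Longrightarrow> 0 \<le> \<Phi> t"
    "filterlim \<Phi> at_top at_top"
proof -
  have mono: "mono_on {0..} \<Phi>" and zero: "\<Phi> 0 = 0" and pos: "\<forall>t>0. 0 < \<Phi> t" and lim: "filterlim \<Phi> at_top at_top"
    using assms by (auto simp only: Orlicz_function_def)
  show "\<Phi> a \<le> \<Phi> b" if "0 \<le> a" "a \<le> b" using mono_onD[OF mono] that by simp
  then show "0 \<le> \<Phi> t" if "0 \<le> t" using mono_onD[OF mono, of 0 t] zero that by simp
  show "\<Phi> 0 = 0" "0 < t \<Longrightarrow> 0 < \<Phi> t" "filterlim \<Phi> at_top at_top" using zero pos lim by auto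
qed

text \<open>For finite \<open>T > 0\<close> a single term suffices, the one with \<open>K 2\<^sup>k < T \<le> K 2\<^sup>k\<^sup>+\<^sup>1\<close>. For infinite \<open>T\<close> the sum diverges because
\<open>\<Phi>\<close> is unbounded.\<close>
lemma Orlicz_dyadic_upper:
  fixes \<Phi> :: "real \<Rightarrow> real"
  assumes \<Phi>: "Orlicz_function \<Phi>" and C: "0 < C" and K: "1 \<le> K"
    and upper: "\<And>t s. 0 \<le> t \<Longrightarrow> 1 \<le> s \<Longrightarrow> \<Phi> (s * t) \<le> C * s powr p * \<Phi> t"
  shows "(if T = \<infinity> then \<infinity> else ennreal (\<Phi> (enn2real T))) \<le> ennreal (C * (2 * K) powr p) *
     (\<integral>\<^sup>+k. ennreal (\<Phi> (dyadic k)) * indicator {ennreal (K * dyadic k)<..} T \<partial>count_space UNIV)"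
    (is "_ \<le> ennreal ?c * ?S")
proof (cases T)
  case top
  have c: "0 < ?c" using C K by simp
  have "ennreal n \<le> ?S" for n
  proof -
    have "\<forall>\<^sub>F t in at_top. n \<le> \<Phi> t"
      using Orlicz_functionD(5)[OF \<Phi>] by (simp add: filterlim_at_top)
    then obtain t0 where t0: "\<And>t. t0 \<le> t \<Longrightarrow> n \<le> \<Phi> t" by (auto simp: eventually_at_top_linorder)
    obtain m :: nat where "t0 < real m" using reals_Archimedean2 by blast
    also have "real m \<le> dyadic (int m)"
      using of_nat_less_two_power[of m, where 'a=real] by (simp add: powr_realpow)
    finally have "ennreal n \<le> ennreal (\<Phi> (dyadic (int m))) * indicator {ennreal (K * dyadic (int m))<..} T"
      using t0 top by (auto intro!: ennreal_leI)
    also have "\<dots> \<le> ?S" by (rule nn_integral_ge_point) simp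
    finally show ?thesis .
  qed
  then have "?S = top"
    by (cases ?S) (metis add.commute ennreal_le_iff less_add_one not_le, simp)
  moreover have "ennreal ?c \<noteq> 0" using c by (simp only: ennreal_eq_0_iff not_le)
  ultimately show ?thesis by (simp only: infinity_ennreal_def ennreal_mult_top if_False top_greatest)
next
  case (real t)
  show ?thesis
  proof (cases "t = 0")
    case True
    then show ?thesis using real Orlicz_functionD(2)[OF \<Phi>] by simp
  next
    case False
    with real have t: "0 < t" by simp
    obtain k where k: "K * dyadic k < t" "t \<le> K * dyadic (k + 1)"
      by (rule dyadic_level[OF t, of K]) (use K in simp)
    have "\<Phi> t \<le> \<Phi> ((2 * K) * dyadic k)"
      using t k by (intro Orlicz_functionD(1)[OF \<Phi>]) (auto simp: powr_add)
    also have "\<dots> \<le> ?c * \<Phi> (dyadic k)" using K by (intro upper) auto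
    finally have "ennreal (\<Phi> t) \<le> ennreal (?c * \<Phi> (dyadic k))" by (rule ennreal_leI)
    also have "\<dots> = ennreal ?c * (ennreal (\<Phi> (dyadic k)) * indicator {ennreal (K * dyadic k)<..} T)"
    proof -
      have "indicator {ennreal (K * dyadic k)<..} T = (1 :: ennreal)"
        using k real K by (simp add: ennreal_less_iff del: ennreal_mult' ennreal_mult'')
      moreover have "ennreal (?c * \<Phi> (dyadic k)) = ennreal ?c * ennreal (\<Phi> (dyadic k))"
        using C by (intro ennreal_mult') simp
      ultimately show ?thesis by (simp only: mult_1_right)
    qed
    also have "\<dots> \<le> ennreal ?c * ?S"
      by (intro mult_left_mono nn_integral_ge_point) auto
    finally show ?thesis using real by simp
  qed
qed

section \<open>Maximal operators with respect to a measure\<close>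

text \<open>The operator is uncentred, like the Hardy-Littlewood operator, which is the case of Lebesgue measure. Weighted
measures are needed for the proof of Muckenhoupt's theorem.\<close>
definition maximal :: "'a::euclidean_space measure \<Rightarrow> ('a \<Rightarrow> ennreal) \<Rightarrow> 'a \<Rightarrow> ennreal" where
  "maximal \<mu> h x = (SUP (c, \<rho>)\<in>{(c, \<rho>). 0 < \<rho> \<and> x \<in> ball c \<rho>}.
      (\<integral>\<^sup>+y\<in>ball c \<rho>. h y \<partial>\<mu>) / emeasure \<mu> (ball c \<rho>))"

lemma maximal_upper:
  "0 < \<rho> \<Longrightarrow> x \<in> ball c \<rho> \<Longrightarrow> (\<integral>\<^sup>+y\<in>ball c \<rho>. h y \<partial>\<mu>) / emeasure \<mu> (ball c \<rho>) \<le> maximal \<mu> h x"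
  unfolding maximal_def by (intro SUP_upper2[where i="(c, \<rho>)"]) auto

lemma maximal_least:
  "(\<And>c \<rho>. 0 < \<rho> \<Longrightarrow> x \<in> ball c \<rho> \<Longrightarrow> (\<integral>\<^sup>+y\<in>ball c \<rho>. h y \<partial>\<mu>) / emeasure \<mu> (ball c \<rho>) \<le> m)
   \<Longrightarrow> maximal \<mu> h x \<le> m"
  unfolding maximal_def by (intro SUP_least) auto

lemma maximal_mono: "(\<And>y. f y \<le> h y) \<Longrightarrow> maximal \<mu> f x \<le> maximal \<mu> h x"
  unfolding maximal_def
  by (intro SUP_mono') (auto intro!: divide_right_mono_ennreal nn_integral_mono mult_right_mono)

lemma less_maximal_iff:
  "m < maximal \<mu> h x \<longleftrightarrow> (\<exists>c \<rho>. 0 < \<rho> \<and> x \<in> ball c \<rho> \<and>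
     m < (\<integral>\<^sup>+y\<in>ball c \<rho>. h y \<partial>\<mu>) / emeasure \<mu> (ball c \<rho>))"
  unfolding maximal_def less_SUP_iff by auto

lemma maximal_measurable [measurable]: "maximal \<mu> h \<in> borel_measurable lebesgue"
proof -
  have "open {x. m < maximal \<mu> h x}" for m
  proof -
    have "{x. m < maximal \<mu> h x} =
      (\<Union>(c, \<rho>)\<in>{(c, \<rho>). 0 < \<rho> \<and> m < (\<integral>\<^sup>+y\<in>ball c \<rho>. h y \<partial>\<mu>) / emeasure \<mu> (ball c \<rho>)}. ball c \<rho>)"
      by (auto simp: less_maximal_iff simp del: mem_ball)
    also have "open \<dots>" by (intro open_UN) auto
    finally show ?thesis .
  qed
  then have "maximal \<mu> h \<in> borel_measurable lborel"
    by (intro borel_measurableI_greater) (simp add: borel_open)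
  then show ?thesis by (rule measurable_completion)
qed

lemma ennreal_mult_divide_cancel:
  fixes a b :: ennreal
  assumes "0 < b" "b < top" shows "b * (a / b) = a"
proof -
  have "b * (a / b) = a * (b / b)" by (simp add: ennreal_times_divide mult.commute)
  then show ?thesis using assms by simp
qed

lemma ennreal_less_divideD:
  fixes l a b :: ennreal
  assumes "l < a / b" shows "l * b \<le> a"
proof (cases "b = 0 \<or> a = top")
  case False
  with assms have "b \<noteq> top" by auto
  have "l * b \<le> (a / b) * b" using assms by (intro mult_right_mono) auto
  also have "\<dots> = a * (b / b)" by (simp add: ennreal_divide_times)
  also have "\<dots> = a" using False \<open>b \<noteq> top\<close> by (simp add: less_top[symmetric])
  finally show ?thesis .
qed auto

lemma nn_integral_UN_le:
  assumes "countable C" and [measurable]: "f \<in> borel_measurable M" "\<And>i. i \<in> C \<Longrightarrow> B i \<in> sets M"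
  shows "(\<integral>\<^sup>+x\<in>(\<Union>i\<in>C. B i). f x \<partial>M) \<le> (\<integral>\<^sup>+i. (\<integral>\<^sup>+x\<in>B i. f x \<partial>M) \<partial>count_space C)"
proof -
  let ?g = "\<lambda>x. \<integral>\<^sup>+i. f x * indicator (B i) x \<partial>count_space C"
  have "(\<integral>\<^sup>+x\<in>(\<Union>i\<in>C. B i). f x \<partial>M) \<le> (\<integral>\<^sup>+x. ?g x \<partial>M)"
  proof (intro nn_integral_mono)
    fix x
    show "f x * indicator (\<Union>i\<in>C. B i) x \<le> ?g x"
    proof (cases "x \<in> (\<Union>i\<in>C. B i)")
      case True
      then obtain i where i: "i \<in> C" "x \<in> B i" by auto
      then show ?thesis
        using nn_integral_ge_point[OF i(1), of "\<lambda>i. f x * indicator (B i) x"] by (simp add: indicator_def)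
    qed simp
  qed
  also have "\<dots> = (\<integral>\<^sup>+i. (\<integral>\<^sup>+x\<in>B i. f x \<partial>M) \<partial>count_space C)"
    by (rule nn_integral_count_space_nn_integral[OF assms(1)]) measurable
  finally show ?thesis .
qed

lemma nn_integral_UN_disjoint_le:
  assumes "countable C" and [measurable]: "f \<in> borel_measurable M" "\<And>i. i \<in> C \<Longrightarrow> B i \<in> sets M"
    and disj: "pairwise (\<lambda>i j. disjnt (B i) (B j)) C"
  shows "(\<integral>\<^sup>+i. (\<integral>\<^sup>+x\<in>B i. f x \<partial>M) \<partial>count_space C) \<le> (\<integral>\<^sup>+x\<in>(\<Union>i\<in>C. B i). f x \<partial>M)"
proof -
  let ?g = "\<lambda>x. \<integral>\<^sup>+i. f x * indicator (B i) x \<partial>count_space C"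
  have "(\<integral>\<^sup>+i. (\<integral>\<^sup>+x\<in>B i. f x \<partial>M) \<partial>count_space C) = (\<integral>\<^sup>+x. ?g x \<partial>M)"
    by (rule nn_integral_count_space_nn_integral[OF assms(1), symmetric]) measurable
  also have "\<dots> \<le> (\<integral>\<^sup>+x\<in>(\<Union>i\<in>C. B i). f x \<partial>M)"
  proof (intro nn_integral_mono)
    fix x
    show "?g x \<le> f x * indicator (\<Union>i\<in>C. B i) x"
    proof (cases "x \<in> (\<Union>i\<in>C. B i)")
      case True
      then obtain i where i: "i \<in> C" "x \<in> B i" by auto
      have "(\<integral>\<^sup>+j. f x * indicator (B j) x \<partial>count_space C) = (\<integral>\<^sup>+j. f x * indicator {i} j \<partial>count_space C)"
        using i disj by (intro nn_integral_cong) (auto simp: indicator_def pairwise_def disjnt_iff)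
      also have "\<dots> = f x" using i by (simp add: nn_integral_cmult)
      finally show ?thesis using i by (auto simp: indicator_def)
    next
      case False
      then have "?g x = (\<integral>\<^sup>+i. 0 \<partial>count_space C)"
        by (intro nn_integral_cong) (auto simp: indicator_def)
      then show ?thesis by simp
    qed
  qed
  finally show ?thesis .
qed

lemma emeasure_UN_le:
  assumes "countable C" and B: "\<And>i. i \<in> C \<Longrightarrow> B i \<in> sets M"
  shows "emeasure M (\<Union>i\<in>C. B i) \<le> (\<integral>\<^sup>+i. emeasure M (B i) \<partial>count_space C)"
proof -
  have "(\<Union>i\<in>C. B i) \<in> sets M" using assms by (intro sets.countable_UN') auto
  moreover have "(\<integral>\<^sup>+i. emeasure M (B i) \<partial>count_space C) = (\<integral>\<^sup>+i. (\<integral>\<^sup>+x\<in>B i. 1 \<partial>M) \<partial>count_space C)"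
    using B by (intro nn_integral_cong) simp
  ultimately show ?thesis
    using nn_integral_UN_le[OF assms(1), of "\<lambda>_. 1" M B] B by simp
qed

definition finite_positive_on_balls :: "'a::euclidean_space measure \<Rightarrow> bool" where
  "finite_positive_on_balls \<mu> \<longleftrightarrow> sets \<mu> = sets lebesgue \<and>
     (\<forall>c \<rho>. 0 < \<rho> \<longrightarrow> 0 < emeasure \<mu> (ball c \<rho>) \<and> emeasure \<mu> (ball c \<rho>) < top)"

text \<open>The values up to half the level contribute at most half of an average that reaches the level. This replaces
the splitting of a function into a large and a small part in Marcinkiewicz interpolation.\<close>
lemma average_truncation:
  fixes l :: real
  assumes [measurable]: "h \<in> borel_measurable M" "B \<in> sets M" and l: "0 < l" and fin: "emeasure M B < top"
    and avg: "ennreal l * emeasure M B \<le> (\<integral>\<^sup>+y\<in>B. h y \<partial>M)"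
  shows "ennreal (l/2) * emeasure M B \<le> (\<integral>\<^sup>+y\<in>B. h y * indicator {x. ennreal (l/2) < h x} y \<partial>M)"
proof -
  define h' where "h' = (\<lambda>x. h x * (if ennreal (l/2) < h x then 1 else 0))"
  have [measurable]: "h' \<in> borel_measurable M" unfolding h'_def by measurable
  have half: "ennreal l = ennreal (l/2) + ennreal (l/2)"
    using l by (simp flip: ennreal_plus)
  note avg
  also have "(\<integral>\<^sup>+y\<in>B. h y \<partial>M) \<le> (\<integral>\<^sup>+y. h' y * indicator B y + ennreal (l/2) * indicator B y \<partial>M)"
    by (intro nn_integral_mono) (auto simp: h'_def indicator_def)
  also have "\<dots> = (\<integral>\<^sup>+y\<in>B. h' y \<partial>M) + ennreal (l/2) * emeasure M B"
    by (subst nn_integral_add) (auto simp: nn_integral_cmult)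
  finally have "ennreal (l/2) * emeasure M B + ennreal (l/2) * emeasure M B \<le>
      ennreal (l/2) * emeasure M B + (\<integral>\<^sup>+y\<in>B. h' y \<partial>M)"
    unfolding half by (simp add: distrib_right add.commute)
  then have "ennreal (l/2) * emeasure M B \<le> (\<integral>\<^sup>+y\<in>B. h' y \<partial>M)"
    using fin by (subst (asm) ennreal_add_left_cancel_le) (auto simp: ennreal_mult_eq_top_iff)
  then show ?thesis by (simp add: h'_def indicator_def of_bool_def)
qed

lemma superlevel_sets_lebesgue:
  fixes f :: "'a::euclidean_space \<Rightarrow> ennreal"
  assumes "f \<in> borel_measurable lebesgue"
  shows "{x. m < f x} \<in> sets lebesgue"
  using measurable_sets[OF assms, of "{m<..}"] by (simp add: vimage_def greaterThan_def)

text \<open>Two measures and a density \<open>u\<close> occur because the covering argument needs nothing but a comparison of the \<open>\<nu>\<close>-mass of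
an enlarged ball with the \<open>\<mu>\<close>-mass of the ball. With \<open>\<mu> = \<nu>\<close> doubling and \<open>u = 1\<close> this is the maximal inequality for
\<open>\<mu>\<close>; with \<open>\<mu>\<close> Lebesgue measure, \<open>\<nu> = v dx\<close> and \<open>u = M v\<close> it is the weak form of the Fefferman-Stein inequality.
Keeping only the part of \<open>h\<close> above \<open>l/2\<close> on the right makes the inequality summable over dyadic levels.\<close>
lemma maximal_weak_type:
  fixes \<mu> \<nu> :: "'a::euclidean_space measure" and l :: real
  assumes \<mu>: "finite_positive_on_balls \<mu>" and sets_\<nu>: "sets \<nu> = sets lebesgue"
    and h: "h \<in> borel_measurable lebesgue" and u: "u \<in> borel_measurable lebesgue"
    and dom: "\<And>c \<rho> x. 0 < \<rho> \<Longrightarrow> x \<in> ball c \<rho> \<Longrightarrow> emeasure \<nu> (ball c (5 * \<rho>)) \<le> C * emeasure \<mu> (ball c \<rho>) * u x"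
    and l: "0 < l"
  shows "ennreal l * emeasure \<nu> {x. ennreal l < maximal \<mu> h x} \<le>
      2 * C * (\<integral>\<^sup>+x. h x * u x * indicator {x. ennreal (l/2) < h x} x \<partial>\<mu>)"
proof -
  have sets_\<mu>: "sets \<mu> = sets lebesgue" using \<mu> by (simp add: finite_positive_on_balls_def)
  note [measurable_cong] = sets_\<mu> sets_\<nu>
  note [measurable] = h u
  have [measurable]: "ball c \<rho> \<in> sets \<mu>" "ball c \<rho> \<in> sets \<nu>" for c \<rho>
    unfolding sets_\<mu> sets_\<nu> by auto
  define h' where "h' = (\<lambda>x. h x * indicator {x. ennreal (l/2) < h x} x)"
  have [measurable]: "h' \<in> borel_measurable lebesgue" unfolding h'_def by measurable
  define bad where "bad = (\<lambda>c \<rho>. 0 < \<rho> \<and> ennreal l < (\<integral>\<^sup>+y\<in>ball c \<rho>. h y \<partial>\<mu>) / emeasure \<mu> (ball c \<rho>))"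
  \<comment> \<open>Charging a selected ball to the integral of \<open>h' u\<close> over it: the enlarged ball is compared with \<open>u\<close> at each of its
     points, and \<open>\<mu> B\<close>, being positive and finite, cancels.\<close>
  have one: "ennreal l * emeasure \<nu> (ball c (5 * \<rho>)) \<le> 2 * C * (\<integral>\<^sup>+x\<in>ball c \<rho>. h' x * u x \<partial>\<mu>)"
    if "bad c \<rho>" for c \<rho>
  proof -
    let ?B = "ball c \<rho>"
    have \<rho>: "0 < \<rho>" and less: "ennreal l < (\<integral>\<^sup>+y\<in>?B. h y \<partial>\<mu>) / emeasure \<mu> ?B"
      using that by (auto simp: bad_def)
    have fin: "emeasure \<mu> ?B < top" and pos: "0 < emeasure \<mu> ?B"
      using \<mu> \<rho> by (auto simp: finite_positive_on_balls_def)
    have half: "ennreal l = ennreal (l/2) + ennreal (l/2)"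
      using l by (simp flip: ennreal_plus)
    let ?u = "\<integral>\<^sup>+y\<in>?B. h' y * u y \<partial>\<mu>" and ?h = "\<integral>\<^sup>+y\<in>?B. h' y \<partial>\<mu>" and ?\<nu> = "emeasure \<nu> (ball c (5 * \<rho>))"
    have *: "ennreal (l/2) * emeasure \<mu> ?B \<le> ?h"
      unfolding h'_def using l fin less by (intro average_truncation ennreal_less_divideD) auto
    have "emeasure \<mu> ?B * (ennreal (l/2) * ?\<nu>) =
        ennreal (l/2) * emeasure \<mu> ?B * ?\<nu>" by (simp add: mult_ac)
    also have "\<dots> \<le> ?h * ?\<nu>"
      by (intro mult_right_mono *) auto
    also have "\<dots> = (\<integral>\<^sup>+y. h' y * indicator ?B y * ?\<nu> \<partial>\<mu>)"
      by (simp add: nn_integral_multc)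
    also have "\<dots> \<le> (\<integral>\<^sup>+y. emeasure \<mu> ?B * C * (h' y * u y * indicator ?B y) \<partial>\<mu>)"
    proof (intro nn_integral_mono)
      fix y
      show "h' y * indicator ?B y * ?\<nu> \<le> emeasure \<mu> ?B * C * (h' y * u y * indicator ?B y)"
      proof (cases "y \<in> ?B")
        case True
        have "h' y * ?\<nu> \<le> h' y * (C * emeasure \<mu> ?B * u y)"
          by (intro mult_left_mono dom \<rho> True) auto
        then show ?thesis using True by (simp add: mult_ac)
      qed simp
    qed
    also have "\<dots> = emeasure \<mu> ?B * (C * ?u)"
      by (simp add: nn_integral_cmult mult.assoc)
    finally have "ennreal (l/2) * ?\<nu> \<le> C * ?u"
      using fin pos by (subst (asm) ennreal_mult_le_mult_iff) auto
    then have "2 * (ennreal (l/2) * ?\<nu>) \<le> 2 * (C * ?u)"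
      by (intro mult_left_mono) auto
    moreover have "2 * ennreal (l/2) = ennreal l" using l half by (simp add: mult_2)
    ultimately show ?thesis by (simp add: mult.assoc[symmetric])
  qed
  \<comment> \<open>Vitali's lemma requires bounded radii; the bound \<open>R\<close> is removed by monotone convergence of the sets \<open>E R\<close>.\<close>
  let ?B = "\<lambda>i. ball (fst i) (snd i)"
  define K where "K = (\<lambda>R::nat. {(c, \<rho>). bad c \<rho> \<and> \<rho> \<le> real R})"
  define E where "E = (\<lambda>R. \<Union>(c, \<rho>)\<in>K R. ball c \<rho>)"
  let ?I = "\<integral>\<^sup>+x. h' x * u x \<partial>\<mu>"
  have bound: "ennreal l * emeasure \<nu> (E R) \<le> 2 * C * ?I" for R
  proof -
    have cov: "E R \<subseteq> (\<Union>i\<in>K R. ?B i)" by (auto simp: E_def)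
    have rad: "0 < snd i \<and> snd i \<le> real R" if "i \<in> K R" for i
      using that by (auto simp: K_def bad_def)
    obtain Cs where Cs: "countable Cs" "Cs \<subseteq> K R"
      "pairwise (\<lambda>i j. disjnt (?B i) (?B j)) Cs"
      "E R \<subseteq> (\<Union>i\<in>Cs. ball (fst i) (5 * snd i))"
      by (rule Vitali_covering_lemma_balls[OF cov rad])
    have "emeasure \<nu> (E R) \<le> emeasure \<nu> (\<Union>i\<in>Cs. ball (fst i) (5 * snd i))"
      using Cs by (intro emeasure_mono sets.countable_UN') auto
    also have "\<dots> \<le> (\<integral>\<^sup>+i. emeasure \<nu> (ball (fst i) (5 * snd i)) \<partial>count_space Cs)"
      by (intro emeasure_UN_le Cs) simp
    finally have "ennreal l * emeasure \<nu> (E R) \<le>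
        ennreal l * (\<integral>\<^sup>+i. emeasure \<nu> (ball (fst i) (5 * snd i)) \<partial>count_space Cs)"
      by (intro mult_left_mono) auto
    also have "\<dots> = (\<integral>\<^sup>+i. ennreal l * emeasure \<nu> (ball (fst i) (5 * snd i)) \<partial>count_space Cs)"
      by (simp add: nn_integral_cmult)
    also have "\<dots> \<le> (\<integral>\<^sup>+i. 2 * C * (\<integral>\<^sup>+x\<in>?B i. h' x * u x \<partial>\<mu>) \<partial>count_space Cs)"
      using Cs(2) by (intro nn_integral_mono one) (auto simp: K_def)
    also have "\<dots> = 2 * C * (\<integral>\<^sup>+i. (\<integral>\<^sup>+x\<in>?B i. h' x * u x \<partial>\<mu>) \<partial>count_space Cs)"
      by (simp add: nn_integral_cmult)
    also have "\<dots> \<le> 2 * C * (\<integral>\<^sup>+x\<in>(\<Union>i\<in>Cs. ?B i). h' x * u x \<partial>\<mu>)"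
      by (intro mult_left_mono nn_integral_UN_disjoint_le Cs) auto
    also have "\<dots> \<le> 2 * C * ?I"
      by (intro mult_left_mono nn_integral_mono) (auto simp: indicator_def)
    finally show ?thesis .
  qed
  have "open (E R)" for R unfolding E_def by (intro open_UN) auto
  then have E_sets: "E R \<in> sets \<nu>" for R unfolding sets_\<nu> by auto
  have inc: "incseq E"
    unfolding E_def K_def incseq_def by (intro allI impI UN_mono) auto
  have "{x. ennreal l < maximal \<mu> h x} = (\<Union>R. E R)"
  proof (intro set_eqI iffI)
    fix x assume "x \<in> {x. ennreal l < maximal \<mu> h x}"
    then obtain c \<rho> where "bad c \<rho>" "x \<in> ball c \<rho>"
      by (auto simp: less_maximal_iff bad_def simp del: mem_ball)
    moreover obtain R where "\<rho> \<le> real R" using real_arch_simple by blast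
    ultimately have "x \<in> E R" unfolding E_def K_def by blast
    then show "x \<in> (\<Union>R. E R)" by blast
  qed (auto simp: less_maximal_iff bad_def E_def K_def simp del: mem_ball)
  then have "emeasure \<nu> {x. ennreal l < maximal \<mu> h x} = (SUP R. emeasure \<nu> (E R))"
    using E_sets inc by (simp add: SUP_emeasure_incseq image_subset_iff)
  then have "ennreal l * emeasure \<nu> {x. ennreal l < maximal \<mu> h x} = (SUP R. ennreal l * emeasure \<nu> (E R))"
    by (simp add: SUP_mult_left_ennreal)
  also have "\<dots> \<le> 2 * C * ?I" by (intro SUP_least bound)
  also have "?I = (\<integral>\<^sup>+x. h x * u x * indicator {x. ennreal (l/2) < h x} x \<partial>\<mu>)"
    by (simp add: h'_def mult_ac)
  finally show ?thesis .
qed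

text \<open>Marcinkiewicz interpolation between the weak-type inequality and the trivial bound at infinity: the weak-type
inequality is summed over the levels \<open>2\<^sup>k\<close> with weights \<open>2\<^sup>k\<^sup>p\<close>, and on the right a geometric series with ratio
\<open>2\<^sup>1\<^sup>-\<^sup>p\<close> appears at each point.\<close>
lemma maximal_strong_type:
  fixes \<mu> \<nu> :: "'a::euclidean_space measure" and p :: real and C :: ennreal
  assumes \<mu>: "finite_positive_on_balls \<mu>" and sets_\<nu>: "sets \<nu> = sets lebesgue"
    and h: "h \<in> borel_measurable lebesgue" and u: "u \<in> borel_measurable lebesgue"
    and dom: "\<And>c \<rho> x. 0 < \<rho> \<Longrightarrow> x \<in> ball c \<rho> \<Longrightarrow> emeasure \<nu> (ball c (5 * \<rho>)) \<le> C * emeasure \<mu> (ball c \<rho>) * u x"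
    and p: "1 < p"
  shows "(\<integral>\<^sup>+x. ennpowr (maximal \<mu> h x) p \<partial>\<nu>) \<le>
      C * ennreal (4 powr p / (1 - 2 powr (1 - p))) * (\<integral>\<^sup>+x. ennpowr (h x) p * u x \<partial>\<mu>)"
proof -
  have sets_\<mu>: "sets \<mu> = sets lebesgue" using \<mu> by (simp add: finite_positive_on_balls_def)
  note [measurable_cong] = sets_\<mu> sets_\<nu>
  note [measurable] = h u
  have [measurable]: "maximal \<mu> h \<in> borel_measurable \<nu>"
    using maximal_measurable[of \<mu> h] by (simp cong: measurable_cong_sets add: measurable_cong_sets[OF sets_\<nu> refl])
  let ?L = "\<lambda>k x. indicator {x. ennreal (dyadic k) < maximal \<mu> h x} x :: ennreal"
  let ?H = "\<lambda>k x. indicator {x. ennreal (dyadic k / 2) < h x} x :: ennreal"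
  let ?T = "2 powr p :: real"
  let ?a = "\<lambda>k. ennreal (?T * 2 powr (real_of_int k * (p - 1)))"
  let ?e = "\<lambda>k x. ?a k * (h x * u x * ?H k x)"
  have [measurable]: "{x. m < maximal \<mu> h x} \<in> sets \<nu>" "{x. m < h x} \<in> sets \<mu>" for m
    using maximal_measurable[of \<mu> h] h
    by (auto simp: superlevel_sets_lebesgue sets_\<mu> sets_\<nu>)
  have "filterlim (\<lambda>t::real. t powr p) at_top at_top"
  proof (rule filterlim_at_top_mono[OF filterlim_ident])
    show "\<forall>\<^sub>F t in at_top. t \<le> (t::real) powr p"
      using eventually_ge_at_top[of "1::real"] by eventually_elim (use p powr_mono[of 1 p] in force)
  qed
  then have O: "Orlicz_function (\<lambda>t. t powr p)"
    using p by (auto simp: Orlicz_function_def mono_on_def powr_mono2)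
  have layer: "ennpowr (maximal \<mu> h x) p \<le>
      (\<integral>\<^sup>+k. ennreal (?T * 2 powr (real_of_int k * p)) * ?L k x \<partial>count_space UNIV)" for x
  proof -
    have "ennpowr (maximal \<mu> h x) p \<le> ennreal ?T *
        (\<integral>\<^sup>+k. ennreal (dyadic k powr p) * indicator {ennreal (dyadic k)<..} (maximal \<mu> h x) \<partial>count_space UNIV)"
      using Orlicz_dyadic_upper[OF O, of 1 1 p "maximal \<mu> h x"] by (simp add: powr_mult ennpowr_def)
    also have "\<dots> = (\<integral>\<^sup>+k. ennreal (?T * 2 powr (real_of_int k * p)) * ?L k x \<partial>count_space UNIV)"
      by (simp add: nn_integral_cmult[symmetric] ennreal_mult powr_powr mult.assoc indicator_def)
    finally show ?thesis .
  qed
  have level: "ennreal (?T * 2 powr (real_of_int k * p)) * emeasure \<nu> {x. ennreal (dyadic k) < maximal \<mu> h x}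
      \<le> 2 * C * (\<integral>\<^sup>+x. ?e k x \<partial>\<mu>)" for k :: int
  proof -
    let ?l = "dyadic k :: real"
    have "ennreal (?T * 2 powr (real_of_int k * p)) = ?a k * ennreal ?l"
      by (simp add: ennreal_mult[symmetric] powr_add[symmetric] algebra_simps)
    then have "ennreal (?T * 2 powr (real_of_int k * p)) * emeasure \<nu> {x. ennreal ?l < maximal \<mu> h x}
      = ?a k * (ennreal ?l * emeasure \<nu> {x. ennreal ?l < maximal \<mu> h x})"
      by (simp only: mult.assoc)
    also have "\<dots> \<le> ?a k *
        (2 * C * (\<integral>\<^sup>+x. h x * u x * ?H k x \<partial>\<mu>))"
      by (intro mult_left_mono maximal_weak_type \<mu> sets_\<nu> h u dom) auto
    also have "\<dots> = 2 * C * (\<integral>\<^sup>+x. ?e k x \<partial>\<mu>)"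
      by (subst nn_integral_cmult) (auto simp: mult_ac)
    finally show ?thesis .
  qed
  let ?c = "ennreal (1 / (1 - 2 powr (1 - p)))"
  have c_pos: "?c \<noteq> 0" using p powr_less_mono[of "1 - p" 0 2] by (auto simp: ennreal_eq_0_iff)
  let ?P = "\<integral>\<^sup>+x. ennpowr (h x) p * u x \<partial>\<mu>"
  have collect: "(\<integral>\<^sup>+k. ?e k x \<partial>count_space UNIV)
       \<le> ennreal (?T * 2 powr (p - 1)) * ?c * (ennpowr (h x) p * u x)" for x
  proof (cases "h x")
    case top
    then show ?thesis using c_pos
      by (cases "u x = 0") (auto simp: ennreal_mult_top ennreal_top_mult ennreal_mult_eq_top_iff)
  next
    case (real t)
    let ?b = "ennreal (?T * 2 powr (p - 1)) * (ennpowr (h x) p * u x)"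
    let ?y = "\<lambda>k. ennreal ((dyadic k / (2 * t)) powr (p - 1)) * indicator {k. dyadic k \<le> 2 * t} k"
    have pt: "?e k x \<le>
       ?b *
       ?y k" for k
    proof (cases "dyadic k < 2 * t")
      case True
      then have t: "0 < t" by (smt (verit) powr_gt_zero)
      have "2 powr (real_of_int k * (p - 1)) * t = 2 powr (p - 1) * t powr p * (dyadic k / (2 * t)) powr (p - 1)"
    proof -
      have "(dyadic k / (2 * t)) powr (p - 1) = 2 powr (real_of_int k * (p - 1)) / (2 powr (p - 1) * t powr (p - 1))"
        using t by (simp only: powr_divide powr_mult powr_powr)
      moreover have "t powr p = t * t powr (p - 1)" using t by (simp add: powr_mult_base)
      ultimately show ?thesis using t by simp
    qed
      then have "ennreal (?T * (2 powr (real_of_int k * (p - 1)) * t)) =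
         ennreal (?T * (2 powr (p - 1) * t powr p * (dyadic k / (2 * t)) powr (p - 1)))" by simp
      then have e: "?a k * ennreal t =
         ennreal (?T * 2 powr (p - 1)) * ennreal (t powr p) * ennreal ((dyadic k / (2 * t)) powr (p - 1))"
        using t by (simp add: ennreal_mult mult.assoc)
      have "?e k x \<le>
          (?a k * ennreal t) * u x"
        using real by (simp add: indicator_def mult_ac)
      also have "\<dots> = ?b *
       ?y k"
        using True real unfolding e by (simp add: ennpowr_ennreal mult_ac)
      finally show ?thesis .
    next
      case False
      then show ?thesis using real by (auto simp: indicator_def ennreal_less_iff)
    qed
    have "(\<integral>\<^sup>+k. ?e k x \<partial>count_space UNIV) \<le>
      (\<integral>\<^sup>+k. ?b *
       ?y k \<partial>count_space UNIV)"
      by (intro nn_integral_mono pt)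
    also have "\<dots> = ?b *
       (\<integral>\<^sup>+k. ennreal ((dyadic k / (2 * t)) powr (p - 1)) * indicator {k. dyadic k \<le> 2 * t} k \<partial>count_space UNIV)"
      by (rule nn_integral_cmult) simp
    also have "\<dots> \<le> ?b * ?c"
      using sum_dyadic_powers_below[of "p - 1" "2 * t"] p by (intro mult_left_mono) auto
    finally show ?thesis by (simp add: mult_ac)
  qed
  have "(\<integral>\<^sup>+x. ennpowr (maximal \<mu> h x) p \<partial>\<nu>) \<le>
     (\<integral>\<^sup>+x. (\<integral>\<^sup>+k. ennreal (?T * 2 powr (real_of_int k * p)) * ?L k x \<partial>count_space UNIV) \<partial>\<nu>)"
    by (intro nn_integral_mono layer)
  also have "\<dots> = (\<integral>\<^sup>+k. (\<integral>\<^sup>+x. ennreal (?T * 2 powr (real_of_int k * p)) * ?L k x \<partial>\<nu>) \<partial>count_space UNIV)"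
    by (rule nn_integral_count_space_nn_integral) auto
  also have "\<dots> = (\<integral>\<^sup>+k. ennreal (?T * 2 powr (real_of_int k * p)) * emeasure \<nu> {x. ennreal (dyadic k) < maximal \<mu> h x} \<partial>count_space UNIV)"
    by (simp add: nn_integral_cmult)
  also have "\<dots> \<le> (\<integral>\<^sup>+k. 2 * C * (\<integral>\<^sup>+x. ?e k x \<partial>\<mu>) \<partial>count_space UNIV)"
    by (intro nn_integral_mono level)
  also have "\<dots> = 2 * C * (\<integral>\<^sup>+k. (\<integral>\<^sup>+x. ?e k x \<partial>\<mu>) \<partial>count_space UNIV)"
    by (rule nn_integral_cmult) simp
  also have "\<dots> = 2 * C * (\<integral>\<^sup>+x. (\<integral>\<^sup>+k. ?e k x \<partial>count_space UNIV) \<partial>\<mu>)"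
    by (subst nn_integral_count_space_nn_integral) auto
  also have "\<dots> \<le> 2 * C * (\<integral>\<^sup>+x. ennreal (?T * 2 powr (p - 1)) * ?c * (ennpowr (h x) p * u x) \<partial>\<mu>)"
    by (intro mult_left_mono nn_integral_mono collect) auto
  also have "\<dots> = 2 * C * (ennreal (?T * 2 powr (p - 1)) * ?c * ?P)"
    by (subst nn_integral_cmult) auto
  also have "\<dots> = C * (ennreal 2 * ennreal (?T * 2 powr (p - 1)) * ?c) * ?P"
    by (simp add: mult_ac)
  also have "ennreal 2 * ennreal (?T * 2 powr (p - 1)) * ?c = ennreal (2 * (?T * 2 powr (p - 1)) * (1 / (1 - 2 powr (1 - p))))"
    by (simp only: ennreal_mult'[symmetric] ennreal_mult''[symmetric] zero_le_mult_iff powr_ge_zero zero_le_numeral simp_thms)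
  also have "2 * (?T * 2 powr (p - 1)) * (1 / (1 - 2 powr (1 - p))) = 4 powr p / (1 - 2 powr (1 - p))"
    using powr_mult[of 2 2 p] by (simp add: powr_diff)
  finally show ?thesis .
qed

abbreviation weighted :: "('a::euclidean_space \<Rightarrow> real) \<Rightarrow> 'a measure" where
  "weighted w \<equiv> density lebesgue (\<lambda>x. ennreal (w x))"

section \<open>Muckenhoupt weights\<close>

lemma emeasure_ball_scale:
  fixes c :: "'a::euclidean_space"
  assumes "0 < \<rho>" "0 < k"
  shows "emeasure lebesgue (ball c (k * \<rho>)) = ennreal (k ^ DIM('a)) * emeasure lebesgue (ball c \<rho>)"
  using assms by (simp add: emeasure_ball power_mult_distrib ennreal_mult[symmetric] mult_ac)

lemma finite_positive_on_balls_lebesgue: "finite_positive_on_balls lebesgue"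
  by (auto simp: finite_positive_on_balls_def emeasure_ball unit_ball_vol_pos)

lemma ball_sets_lebesgue [measurable]: "ball c \<rho> \<in> sets lebesgue"
  by simp

lemma emeasure_lebesgue_ball:
  fixes c :: "'a::euclidean_space"
  assumes "0 < \<rho>"
  shows "0 < emeasure lebesgue (ball c \<rho>)" "emeasure lebesgue (ball c \<rho>) < top"
  using assms finite_positive_on_balls_lebesgue[where 'a='a] by (auto simp only: finite_positive_on_balls_def)

text \<open>The \<open>A\<^sub>p\<close> condition with its constant exposed, since all later estimates must be uniform over the weights
\<open>\<phi>(\<cdot>,t)\<close>. It is multiplied out to avoid quotients.\<close>
definition Muckenhoupt_weight :: "real \<Rightarrow> real \<Rightarrow> ('a::euclidean_space \<Rightarrow> real) \<Rightarrow> bool" where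
  "Muckenhoupt_weight p A w \<longleftrightarrow>
     w \<in> borel_measurable lebesgue \<and> (\<forall>x. 0 < w x) \<and> 0 < A \<and>
     (\<forall>c \<rho>. 0 < \<rho> \<longrightarrow>
        (\<integral>\<^sup>+x\<in>ball c \<rho>. w x \<partial>lebesgue) *
          ennpowr (\<integral>\<^sup>+x\<in>ball c \<rho>. w x powr (- 1 / (p - 1)) \<partial>lebesgue) (p - 1)
        \<le> ennreal A * ennpowr (emeasure lebesgue (ball c \<rho>)) p)"

lemma Muckenhoupt_weightD:
  assumes "Muckenhoupt_weight p A w"
  shows "w \<in> borel_measurable lebesgue" "0 < w x" "0 < A"
    "0 < \<rho> \<Longrightarrow> (\<integral>\<^sup>+x\<in>ball c \<rho>. w x \<partial>lebesgue) *
          ennpowr (\<integral>\<^sup>+x\<in>ball c \<rho>. w x powr (- 1 / (p - 1)) \<partial>lebesgue) (p - 1)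
        \<le> ennreal A * ennpowr (emeasure lebesgue (ball c \<rho>)) p"
  using assms unfolding Muckenhoupt_weight_def by blast+

lemma nn_integral_ball_pos:
  fixes w :: "'a::euclidean_space \<Rightarrow> real"
  assumes [measurable]: "w \<in> borel_measurable lebesgue" and w: "\<And>x. 0 < w x" and \<rho>: "0 < \<rho>"
  shows "0 < (\<integral>\<^sup>+x\<in>ball c \<rho>. w x \<partial>lebesgue)"
proof (rule ccontr)
  assume "\<not> ?thesis"
  then have "AE x in lebesgue. ennreal (w x) * indicator (ball c \<rho>) x = 0"
    by (subst nn_integral_0_iff_AE[symmetric]) auto
  then have "AE x in lebesgue. x \<notin> ball c \<rho>"
  proof (rule eventually_mono)
    fix x assume "ennreal (w x) * indicator (ball c \<rho>) x = 0"
    then show "x \<notin> ball c \<rho>" using w[of x] by (auto simp: indicator_def ennreal_eq_0_iff)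
  qed
  then have "ball c \<rho> \<in> null_sets lebesgue"
    by (subst (asm) AE_iff_null_sets[symmetric]) auto
  then show False
    using emeasure_lebesgue_ball[OF \<rho>, of c] by (simp only: null_sets_def mem_Collect_eq less_irrefl)
qed

text \<open>Raising the \<open>A\<^sub>p\<close> condition to the power \<open>1/(p-1)\<close> exchanges the roles of the weight and of its dual.\<close>
lemma Muckenhoupt_weight_dual:
  assumes p: "1 < p" and w: "Muckenhoupt_weight p A w"
  shows "Muckenhoupt_weight (p / (p - 1)) (A powr (1 / (p - 1))) (\<lambda>x. w x powr (- 1 / (p - 1)))"
  unfolding Muckenhoupt_weight_def
proof (intro conjI allI impI)
  note [measurable] = Muckenhoupt_weightD(1)[OF w]
  have pos: "0 < w x" for x using w by (rule Muckenhoupt_weightD)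
  have e: "p / (p - 1) - 1 = 1 / (p - 1)" using p by (simp add: field_simps)
  have e2: "(w x powr (- 1 / (p - 1))) powr (- 1 / (p / (p - 1) - 1)) = w x" for x
  proof -
    have "- 1 / (p - 1) * (- 1 / (1 / (p - 1))) = 1" using p by (simp add: divide_simps)
    then show ?thesis unfolding e powr_powr using pos[of x] by simp
  qed
  show "(\<lambda>x. w x powr (- 1 / (p - 1))) \<in> borel_measurable lebesgue" by measurable
  show "0 < w x powr (- 1 / (p - 1))" for x using pos[of x] by simp
  show "0 < A powr (1 / (p - 1))" using w Muckenhoupt_weightD(3) by fastforce
  fix c :: 'a and \<rho> :: real assume \<rho>: "0 < \<rho>"
  let ?S = "\<integral>\<^sup>+x\<in>ball c \<rho>. w x powr (- 1 / (p - 1)) \<partial>lebesgue"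
  let ?W = "\<integral>\<^sup>+x\<in>ball c \<rho>. w x \<partial>lebesgue"
  have "ennpowr (?W * ennpowr ?S (p - 1)) (1 / (p - 1))
     \<le> ennpowr (ennreal A * ennpowr (emeasure lebesgue (ball c \<rho>)) p) (1 / (p - 1))"
    using p by (intro ennpowr_mono Muckenhoupt_weightD(4)[OF w \<rho>]) auto
  then have "?S * ennpowr ?W (1 / (p - 1)) \<le> ennreal (A powr (1 / (p - 1))) * ennpowr (emeasure lebesgue (ball c \<rho>)) (p / (p - 1))"
    using p Muckenhoupt_weightD(3)[OF w] by (simp add: ennpowr_mult ennpowr_ennreal mult.commute)
  then show "?S * ennpowr (\<integral>\<^sup>+x\<in>ball c \<rho>. (w x powr (- 1 / (p - 1))) powr (- 1 / (p / (p - 1) - 1)) \<partial>lebesgue) (p / (p - 1) - 1)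
      \<le> ennreal (A powr (1 / (p - 1))) * ennpowr (emeasure lebesgue (ball c \<rho>)) (p / (p - 1))"
    unfolding e2 unfolding e .
qed

lemma emeasure_weighted_ball:
  assumes "w \<in> borel_measurable lebesgue"
  shows "emeasure (weighted w) (ball c \<rho>) = (\<integral>\<^sup>+x\<in>ball c \<rho>. w x \<partial>lebesgue)"
  using assms by (subst emeasure_density) auto

lemma finite_positive_on_balls_weighted:
  assumes p: "1 < p" and w: "Muckenhoupt_weight p A w"
  shows "finite_positive_on_balls (weighted w)"
  unfolding finite_positive_on_balls_def
proof (intro conjI allI impI)
  note wm [measurable] = Muckenhoupt_weightD(1)[OF w]
  note d = Muckenhoupt_weightD(1,2)[OF w]
  fix c :: 'a and \<rho> :: real assume \<rho>: "0 < \<rho>"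
  show "0 < emeasure (weighted w) (ball c \<rho>)"
    unfolding emeasure_weighted_ball[OF wm] by (intro nn_integral_ball_pos d \<rho>)
  have S: "0 < (\<integral>\<^sup>+x\<in>ball c \<rho>. w x powr (- 1 / (p - 1)) \<partial>lebesgue)"
    using d(2) by (intro nn_integral_ball_pos \<rho>) (auto simp: less_imp_neq[symmetric])
  have "ennreal A * ennpowr (emeasure lebesgue (ball c \<rho>)) p < top"
    using emeasure_lebesgue_ball[OF \<rho>, of c] by (simp only: ennreal_mult_less_top ennpowr_less_top_iff ennreal_less_top simp_thms)
  then have "emeasure (weighted w) (ball c \<rho>) * ennpowr (\<integral>\<^sup>+x\<in>ball c \<rho>. w x powr (- 1 / (p - 1)) \<partial>lebesgue) (p - 1) < top"
    using Muckenhoupt_weightD(4)[OF w \<rho>, of c] unfolding emeasure_weighted_ball[OF wm] by (rule le_less_trans[rotated])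
  then show "emeasure (weighted w) (ball c \<rho>) < top"
    using S by (auto simp: ennreal_mult_less_top)
qed simp

text \<open>This is how the \<open>A\<^sub>p\<close> condition enters the estimates: averages of \<open>h\<close> are controlled by weighted \<open>L\<^sup>p\<close> averages. It is Hoelder's
inequality followed by the \<open>A\<^sub>p\<close> condition.\<close>
lemma Muckenhoupt_weight_average:
  fixes w :: "'a::euclidean_space \<Rightarrow> real"
  assumes p: "1 < p" and w: "Muckenhoupt_weight p A w" and [measurable]: "h \<in> borel_measurable lebesgue"
    and \<rho>: "0 < \<rho>"
  shows "ennpowr (\<integral>\<^sup>+x\<in>ball c \<rho>. h x \<partial>lebesgue) p * emeasure (weighted w) (ball c \<rho>) \<le>
    ennreal A * ennpowr (emeasure lebesgue (ball c \<rho>)) p * (\<integral>\<^sup>+x\<in>ball c \<rho>. ennpowr (h x) p * w x \<partial>lebesgue)"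
proof -
  note wm [measurable] = Muckenhoupt_weightD(1)[OF w]
  let ?B = "ball c \<rho>"
  let ?S = "\<integral>\<^sup>+x\<in>?B. w x powr (- 1 / (p - 1)) \<partial>lebesgue"
  let ?P = "\<integral>\<^sup>+x\<in>?B. ennpowr (h x) p * w x \<partial>lebesgue"
  have ind: "ennpowr (indicator ?B x) q = indicator ?B x" for x q by (simp add: indicator_def)
  have "ennpowr (\<integral>\<^sup>+x\<in>?B. h x \<partial>lebesgue) p = ennpowr (\<integral>\<^sup>+x. h x * indicator ?B x * indicator ?B x \<partial>lebesgue) p"
    by (intro arg_cong2[where f=ennpowr] nn_integral_cong) (auto simp: indicator_def)
  also have "\<dots> \<le> (\<integral>\<^sup>+x. ennpowr (h x * indicator ?B x) p * w x \<partial>lebesgue) *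
     ennpowr (\<integral>\<^sup>+x. ennpowr (indicator ?B x) (p / (p - 1)) * ennreal (w x powr (- 1 / (p - 1))) \<partial>lebesgue) (p - 1)"
    by (intro weighted_Hoelder_inequality p Muckenhoupt_weightD[OF w]) measurable
  also have "\<dots> = ?P * ennpowr ?S (p - 1)"
    by (simp add: ennpowr_mult ind mult_ac)
  finally have "ennpowr (\<integral>\<^sup>+x\<in>?B. h x \<partial>lebesgue) p * emeasure (weighted w) ?B \<le>
      ?P * ennpowr ?S (p - 1) * emeasure (weighted w) ?B"
    by (rule mult_right_mono) simp
  also have "\<dots> = ?P * (emeasure (weighted w) ?B * ennpowr ?S (p - 1))"
    by (simp only: mult_ac)
  also have "\<dots> \<le> ?P * (ennreal A * ennpowr (emeasure lebesgue ?B) p)"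
    unfolding emeasure_weighted_ball[OF wm] by (intro mult_left_mono Muckenhoupt_weightD(4)[OF w \<rho>]) simp
  finally show ?thesis by (simp only: mult_ac)
qed

text \<open>The previous inequality for the larger ball, applied to the indicator function of the smaller one.\<close>
lemma Muckenhoupt_weight_doubling:
  fixes w :: "'a::euclidean_space \<Rightarrow> real"
  assumes p: "1 < p" and w: "Muckenhoupt_weight p A w" and k: "1 \<le> k" and \<rho>: "0 < \<rho>"
  shows "emeasure (weighted w) (ball c (k * \<rho>)) \<le>
    ennreal (A * (k ^ DIM('a)) powr p) * emeasure (weighted w) (ball c \<rho>)"
proof -
  note wm [measurable] = Muckenhoupt_weightD(1)[OF w]
  let ?B = "ball c \<rho>" and ?kB = "ball c (k * \<rho>)"
  have sub: "?B \<subseteq> ?kB" using k \<rho> by (intro subset_ball) (simp add: mult_le_cancel_right1)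
  have ind: "ennpowr (indicator ?B x) p = indicator ?B x" for x by (simp add: indicator_def)
  have i2: "indicator ?B x * indicator ?kB x = (indicator ?B x :: ennreal)" for x
    using sub by (auto simp: indicator_def)
  have i3: "indicator ?B x * ennreal (w x) * indicator ?kB x = ennreal (w x) * indicator ?B x" for x
    using sub by (auto simp: indicator_def)
  have fin: "0 < emeasure lebesgue ?B" "emeasure lebesgue ?B < top"
    using \<rho> by (intro emeasure_lebesgue_ball; simp)+
  have k\<rho>: "0 < k * \<rho>" using k \<rho> by simp
  have "ennpowr (\<integral>\<^sup>+x\<in>?kB. indicator ?B x \<partial>lebesgue) p * emeasure (weighted w) ?kB \<le>
    ennreal A * ennpowr (emeasure lebesgue ?kB) p * (\<integral>\<^sup>+x\<in>?kB. ennpowr (indicator ?B x) p * w x \<partial>lebesgue)"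
    by (intro Muckenhoupt_weight_average[OF p w _ k\<rho>]) measurable
  then have "ennpowr (emeasure lebesgue ?B) p * emeasure (weighted w) ?kB \<le>
     ennreal A * ennpowr (ennreal (k ^ DIM('a)) * emeasure lebesgue ?B) p * emeasure (weighted w) ?B"
    using k emeasure_ball_scale[OF \<rho>, of k c] unfolding emeasure_weighted_ball[OF wm] ind i2 i3 by simp
  also have "\<dots> = ennpowr (emeasure lebesgue ?B) p * (ennreal (A * (k ^ DIM('a)) powr p) * emeasure (weighted w) ?B)"
    using k Muckenhoupt_weightD(3)[OF w] by (simp add: ennpowr_mult ennpowr_ennreal ennreal_mult mult_ac)
  finally show ?thesis
    using fin by (subst (asm) ennreal_mult_le_mult_iff) auto
qed

text \<open>The factor \<open>1 / (1 - 2\<^sup>1\<^sup>-\<^sup>p)\<close> is the sum of the geometric series over the dyadic levels.\<close>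
definition strong_type_constant :: "real \<Rightarrow> real" where
  "strong_type_constant p = 4 powr p / (1 - 2 powr (1 - p))"

lemma strong_type_constant_nonneg: "1 < p \<Longrightarrow> 0 \<le> strong_type_constant p"
  using powr_less_mono[of "1 - p" 0 2] by (auto simp: strong_type_constant_def intro!: divide_nonneg_nonneg)

section \<open>Weighted inequalities for the scalar maximal operator\<close>

text \<open>The value of \<open>M v\<close> at any point of a ball is at least the average of \<open>v\<close> over the fivefold enlargement, which is
the comparison required by the covering argument.\<close>
theorem Fefferman_Stein_weighted:
  fixes f v :: "'a::euclidean_space \<Rightarrow> ennreal"
  assumes f [measurable]: "f \<in> borel_measurable lebesgue" and v [measurable]: "v \<in> borel_measurable lebesgue" and r: "1 < r"
  shows "(\<integral>\<^sup>+x. ennpowr (maximal lebesgue f x) r * v x \<partial>lebesgue) \<le>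
     ennreal (5 ^ DIM('a)) * ennreal (strong_type_constant r) *
       (\<integral>\<^sup>+x. ennpowr (f x) r * maximal lebesgue v x \<partial>lebesgue)"
proof -
  have dom: "emeasure (density lebesgue v) (ball c (5 * \<rho>)) \<le>
      ennreal (5 ^ DIM('a)) * emeasure lebesgue (ball c \<rho>) * maximal lebesgue v x"
    if \<rho>: "0 < \<rho>" and x: "x \<in> ball c \<rho>" for c x :: 'a and \<rho>
  proof -
    let ?B = "ball c (5 * \<rho>)"
    have x5: "x \<in> ?B" using x \<rho> by auto
    have fin: "0 < emeasure lebesgue ?B" "emeasure lebesgue ?B < top"
      using \<rho> by (intro emeasure_lebesgue_ball; simp)+
    have "emeasure (density lebesgue v) ?B = (\<integral>\<^sup>+y\<in>?B. v y \<partial>lebesgue)"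
      by (subst emeasure_density) auto
    also have "\<dots> = emeasure lebesgue ?B *
        ((\<integral>\<^sup>+y\<in>?B. v y \<partial>lebesgue) / emeasure lebesgue ?B)"
      by (rule ennreal_mult_divide_cancel[OF fin, symmetric])
    also have "\<dots> \<le> emeasure lebesgue ?B * maximal lebesgue v x"
      using \<rho> x5 by (intro mult_left_mono maximal_upper) auto
    finally show ?thesis using emeasure_ball_scale[OF \<rho>, of 5 c] by simp
  qed
  have "(\<integral>\<^sup>+x. ennpowr (maximal lebesgue f x) r \<partial>density lebesgue v) \<le>
     ennreal (5 ^ DIM('a)) * ennreal (4 powr r / (1 - 2 powr (1 - r))) *
       (\<integral>\<^sup>+x. ennpowr (f x) r * maximal lebesgue v x \<partial>lebesgue)"
    by (intro maximal_strong_type finite_positive_on_balls_lebesgue f maximal_measurable dom r) auto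
  then show ?thesis
    by (simp add: nn_integral_density strong_type_constant_def mult.commute[of "v _"])
qed

lemma weighted_maximal_bound:
  fixes w :: "'a::euclidean_space \<Rightarrow> real"
  assumes p: "1 < p" and w: "Muckenhoupt_weight p A w" and h [measurable]: "h \<in> borel_measurable lebesgue" and s: "1 < s"
  shows "(\<integral>\<^sup>+x. ennpowr (maximal (weighted w) h x) s * w x \<partial>lebesgue) \<le>
    ennreal (A * (5 ^ DIM('a)) powr p) * ennreal (strong_type_constant s) * (\<integral>\<^sup>+x. ennpowr (h x) s * w x \<partial>lebesgue)"
proof -
  note wm [measurable] = Muckenhoupt_weightD(1)[OF w]
  have "(\<integral>\<^sup>+x. ennpowr (maximal (weighted w) h x) s \<partial>weighted w) \<le>
    ennreal (A * (5 ^ DIM('a)) powr p) * ennreal (4 powr s / (1 - 2 powr (1 - s))) * (\<integral>\<^sup>+x. ennpowr (h x) s * 1 \<partial>weighted w)"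
    using Muckenhoupt_weight_doubling[OF p w, of 5]
    by (intro maximal_strong_type finite_positive_on_balls_weighted[OF p w] h s) auto
  then show ?thesis
    by (simp add: nn_integral_density strong_type_constant_def mult.commute[of "ennreal (w _)"])
qed

text \<open>Lerner's proof. Let \<open>\<sigma> = w\<^sup>-\<^sup>1\<^sup>/\<^sup>(\<^sup>p\<^sup>-\<^sup>1\<^sup>)\<close>. On a ball the average of \<open>f\<close> is \<open>\<sigma>(B)/|B|\<close> times the \<open>\<sigma>\<close>-average of
\<open>f/\<sigma>\<close>, and the latter is a lower bound for \<open>k = M\<^sub>\<sigma>(f/\<sigma>)\<close> on the whole ball. The \<open>A\<^sub>p\<close> condition trades
\<open>(\<sigma>(B)/|B|)\<^sup>p\<^sup>-\<^sup>1\<close> for \<open>|B|/w(B)\<close>, which leads to \<open>(M f)\<^sup>p\<^sup>-\<^sup>1 \<le> A M\<^sub>w(k\<^sup>p\<^sup>-\<^sup>1/w)\<close>. Now \<open>M\<^sub>w\<close> is bounded on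
\<open>L\<^sup>p\<^sup>/\<^sup>(\<^sup>p\<^sup>-\<^sup>1\<^sup>)(w)\<close> and \<open>M\<^sub>\<sigma>\<close> on \<open>L\<^sup>p(\<sigma>)\<close>, since both measures are doubling.\<close>
theorem Muckenhoupt_maximal_theorem:
  fixes w :: "'a::euclidean_space \<Rightarrow> real"
  assumes p: "1 < p" and w: "Muckenhoupt_weight p A w" and f [measurable]: "f \<in> borel_measurable lebesgue"
  defines "D \<equiv> A * (5 ^ DIM('a)) powr p"
    and "D' \<equiv> A powr (1 / (p - 1)) * (5 ^ DIM('a)) powr (p / (p - 1))"
  shows "(\<integral>\<^sup>+x. ennpowr (maximal lebesgue f x) p * w x \<partial>lebesgue) \<le>
     ennreal (A powr (p / (p - 1)) * D * strong_type_constant (p / (p - 1)) * D' * strong_type_constant p) *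
       (\<integral>\<^sup>+x. ennpowr (f x) p * w x \<partial>lebesgue)"
proof -
  note wm [measurable] = Muckenhoupt_weightD(1)[OF w]
  have wpos: "0 < w x" for x using w by (rule Muckenhoupt_weightD)
  have Apos: "0 < A" using w by (rule Muckenhoupt_weightD)
  define p' where "p' = p / (p - 1)"
  have p': "1 < p'" using p by (simp add: p'_def)
  define \<sigma> where "\<sigma> = (\<lambda>x. w x powr (- 1 / (p - 1)))"
  have \<sigma>pos: "0 < \<sigma> x" for x using wpos[of x] by (simp add: \<sigma>_def)
  have \<sigma>: "Muckenhoupt_weight p' (A powr (1 / (p - 1))) \<sigma>"
    unfolding \<sigma>_def p'_def by (rule Muckenhoupt_weight_dual[OF p w])
  note \<sigma>m [measurable] = Muckenhoupt_weightD(1)[OF \<sigma>]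
  define k where "k = maximal (weighted \<sigma>) (\<lambda>x. f x / \<sigma> x)"
  have km [measurable]: "k \<in> borel_measurable lebesgue" unfolding k_def by measurable
  define g where "g = (\<lambda>x. ennpowr (k x) (p - 1) / w x)"
  have gm [measurable]: "g \<in> borel_measurable lebesgue" unfolding g_def by measurable
  let ?W = "emeasure (weighted w)" and ?S = "emeasure (weighted \<sigma>)" and ?L = "emeasure lebesgue"
  have mass: "ennreal (a x) * (b / ennreal (a x)) = b" if "0 < a x" for a :: "'a \<Rightarrow> real" and b x
    using that by (intro ennreal_mult_divide_cancel) auto
  \<comment> \<open>On a ball, the \<open>\<sigma>\<close>-average of \<open>f/\<sigma>\<close> to the power \<open>p-1\<close> is a lower bound for \<open>k\<^sup>p\<^sup>-\<^sup>1\<close>, hence at most the Lebesgue average of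
     \<open>k\<^sup>p\<^sup>-\<^sup>1\<close>, and \<open>k\<^sup>p\<^sup>-\<^sup>1 dx = g w dx\<close>.\<close>
  let ?W' = "\<lambda>x. ennreal A * maximal (weighted w) g x"
  have point: "ennpowr (maximal lebesgue f x) (p - 1) \<le> ?W' x" for x
  proof -
    have "maximal lebesgue f x \<le> ennpowr (?W' x) (1 / (p - 1))"
    proof (rule maximal_least)
      fix c :: 'a and \<rho> :: real assume \<rho>: "0 < \<rho>" and x: "x \<in> ball c \<rho>"
      let ?B = "ball c \<rho>"
      have L: "0 < ?L ?B" "?L ?B < top"
        using \<rho> by (intro emeasure_lebesgue_ball; simp)+
      have W: "0 < ?W ?B" "?W ?B < top"
        using finite_positive_on_balls_weighted[OF p w] \<rho> by (auto simp: finite_positive_on_balls_def)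
      have S: "0 < ?S ?B" "?S ?B < top"
        using finite_positive_on_balls_weighted[OF p' \<sigma>] \<rho> by (auto simp: finite_positive_on_balls_def)
      let ?F = "\<integral>\<^sup>+y\<in>?B. f y \<partial>lebesgue"
      let ?G = "\<integral>\<^sup>+y\<in>?B. g y \<partial>weighted w" and ?k = "ennpowr (?F / ?S ?B) (p - 1)"
      have F: "?F = (\<integral>\<^sup>+y\<in>?B. f y / \<sigma> y \<partial>weighted \<sigma>)"
        using \<sigma>pos by (subst nn_integral_density) (auto simp: mass mult.assoc[symmetric])
      have low: "?F / ?S ?B \<le> k y" if "y \<in> ?B" for y
        unfolding k_def F using \<rho> that by (rule maximal_upper)
      have "?k * ?L ?B = (\<integral>\<^sup>+y\<in>?B. ?k \<partial>lebesgue)"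
        by (simp add: nn_integral_cmult)
      also have "\<dots> \<le> (\<integral>\<^sup>+y\<in>?B. ennpowr (k y) (p - 1) \<partial>lebesgue)"
        using p low by (intro nn_integral_mono) (auto simp: indicator_def)
      also have "\<dots> = ?G"
        using wpos by (subst nn_integral_density) (auto simp: mass mult.assoc[symmetric] g_def)
      finally have 1: "?k * ?L ?B \<le> ?G" .
      have Ap: "?W ?B * ennpowr (?S ?B) (p - 1) \<le> ennreal A * ennpowr (?L ?B) p"
        unfolding emeasure_weighted_ball[OF wm] emeasure_weighted_ball[OF \<sigma>m] unfolding \<sigma>_def
        by (rule Muckenhoupt_weightD(4)[OF w \<rho>])
      obtain lb where lb: "?L ?B = ennreal lb" "0 < lb" using L by (cases "?L ?B") auto
      obtain wb where wb: "?W ?B = ennreal wb" "0 < wb" using W by (cases "?W ?B") auto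
      obtain sb where sb: "?S ?B = ennreal sb" "0 < sb" using S by (cases "?S ?B") auto
      have "wb * sb powr (p - 1) \<le> A * lb powr p"
        using Ap lb wb sb Apos by (simp add: ennpowr_ennreal ennreal_mult[symmetric])
      also have "lb powr p = lb * lb powr (p - 1)" using lb by (simp add: powr_mult_base)
      finally have Ap': "(sb / lb) powr (p - 1) \<le> A * (lb / wb)"
        using lb wb sb by (simp add: powr_divide field_simps)
      have "?F / ?L ?B = (?F / ?S ?B) * ennreal (sb / lb)"
        using ennreal_times_divide[of "?F / ?S ?B" "?S ?B" "?L ?B"] ennreal_mult_divide_cancel[OF S, of ?F] lb sb
        by (simp add: divide_ennreal mult.commute[of _ "ennreal sb"] del: emeasure_completion)
      then have "ennpowr (?F / ?L ?B) (p - 1) = ?k * ennreal ((sb / lb) powr (p - 1))"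
        using lb sb by (simp add: ennpowr_mult ennpowr_ennreal)
      also have "\<dots> \<le> ?k * ennreal (A * (lb / wb))"
        using Ap' by (intro mult_left_mono ennreal_leI) auto
      also have "ennreal (A * (lb / wb)) = ennreal A * (?L ?B / ?W ?B)"
        using lb wb Apos by (simp add: divide_ennreal ennreal_mult''[symmetric] del: emeasure_completion)
      also have "?k * (ennreal A * (?L ?B / ?W ?B)) =
          ennreal A * ((?k * ?L ?B) / ?W ?B)"
        by (simp only: divide_ennreal_def mult_ac)
      also have "\<dots> \<le> ennreal A * (?G / ?W ?B)"
        by (intro mult_left_mono divide_right_mono_ennreal 1) auto
      also have "\<dots> \<le> ?W' x"
        by (intro mult_left_mono maximal_upper \<rho> x) auto
      finally show "?F / ?L ?B \<le> ennpowr (?W' x) (1 / (p - 1))"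
        using p by (intro ennpowr_le_cancel) auto
    qed
    then have "ennpowr (maximal lebesgue f x) (p - 1) \<le> ennpowr (ennpowr (?W' x) (1 / (p - 1))) (p - 1)"
      using p by (intro ennpowr_mono) auto
    then show ?thesis using p by simp
  qed
  have point': "ennpowr (maximal lebesgue f x) p \<le> ennreal (A powr p') * ennpowr (maximal (weighted w) g x) p'" for x
  proof -
    have "ennpowr (ennpowr (maximal lebesgue f x) (p - 1)) p' \<le> ennpowr (?W' x) p'"
      using p' by (intro ennpowr_mono point) auto
    moreover have "(p - 1) * p' = p" using p by (simp add: p'_def)
    ultimately show ?thesis using Apos by (simp add: ennpowr_mult ennpowr_ennreal)
  qed
  have g_eq: "ennpowr (g x) p' * w x = ennpowr (k x) p * \<sigma> x" for x
  proof -
    have "g x = ennpowr (k x) (p - 1) * ennreal (1 / w x)"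
      using wpos[of x] by (simp add: g_def divide_ennreal[symmetric] ennreal_times_divide)
    moreover have "(p - 1) * p' = p" using p by (simp add: p'_def)
    moreover have "(1 / w x) powr p' * w x = w x powr (1 - p')"
      using wpos[of x] by (simp add: powr_divide powr_diff)
    moreover have "1 - p' = - 1 / (p - 1)" using p by (simp add: p'_def field_simps)
    ultimately show ?thesis
      using wpos[of x] by (simp add: ennpowr_mult ennpowr_ennreal mult.assoc \<sigma>_def ennreal_mult'[symmetric] del: divide_minus_left)
  qed
  have f_eq: "ennpowr (f x / \<sigma> x) p * \<sigma> x = ennpowr (f x) p * w x" for x
  proof -
    have "f x / \<sigma> x = f x * ennreal (1 / \<sigma> x)"
      using \<sigma>pos[of x] by (simp add: divide_ennreal[symmetric] ennreal_times_divide)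
    moreover have "(1 / \<sigma> x) powr p * \<sigma> x = w x"
    proof -
      have "(1 / \<sigma> x) powr p * \<sigma> x = \<sigma> x powr (1 - p)"
        using \<sigma>pos[of x] by (simp add: powr_divide powr_diff)
      also have "- 1 / (p - 1) * (1 - p) = 1" using p by (simp add: divide_simps)
      then have "\<sigma> x powr (1 - p) = w x" unfolding \<sigma>_def powr_powr using wpos[of x] by simp
      finally show ?thesis .
    qed
    ultimately show ?thesis
      using \<sigma>pos[of x] by (simp add: ennpowr_mult ennpowr_ennreal mult.assoc ennreal_mult'[symmetric])
  qed
  have nn: "0 \<le> strong_type_constant p" "0 \<le> strong_type_constant p'" "0 \<le> D" "0 \<le> D'"
    using p p' Apos strong_type_constant_nonneg by (auto simp: D_def D'_def)
  have "(\<integral>\<^sup>+x. ennpowr (maximal lebesgue f x) p * w x \<partial>lebesgue) \<le>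
    (\<integral>\<^sup>+x. ennreal (A powr p') * (ennpowr (maximal (weighted w) g x) p' * w x) \<partial>lebesgue)"
    unfolding mult.assoc[symmetric] by (intro nn_integral_mono mult_right_mono point') auto
  also have "\<dots> = ennreal (A powr p') * (\<integral>\<^sup>+x. ennpowr (maximal (weighted w) g x) p' * w x \<partial>lebesgue)"
    by (rule nn_integral_cmult) measurable
  also have "\<dots> \<le> ennreal (A powr p') * (ennreal D * ennreal (strong_type_constant p') *
       (\<integral>\<^sup>+x. ennpowr (g x) p' * w x \<partial>lebesgue))"
    unfolding D_def by (intro mult_left_mono weighted_maximal_bound p w gm p') auto
  also have "\<dots> = ennreal (A powr p') * (ennreal D * ennreal (strong_type_constant p') *
       (\<integral>\<^sup>+x. ennpowr (k x) p * \<sigma> x \<partial>lebesgue))"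
    unfolding g_eq ..
  also have "\<dots> \<le> ennreal (A powr p') * (ennreal D * ennreal (strong_type_constant p') *
       (ennreal D' * ennreal (strong_type_constant p) * (\<integral>\<^sup>+x. ennpowr (f x / \<sigma> x) p * \<sigma> x \<partial>lebesgue)))"
    unfolding k_def D'_def p'_def[symmetric] by (intro mult_left_mono weighted_maximal_bound p p' \<sigma>) auto
  also have "\<dots> = ennreal (A powr p' * D * strong_type_constant p' * D' * strong_type_constant p) *
       (\<integral>\<^sup>+x. ennpowr (f x) p * w x \<partial>lebesgue)"
    unfolding f_eq using nn by (simp add: ennreal_mult mult_ac)
  finally show ?thesis by (simp add: p'_def)
qed

section \<open>Sequences of functions\<close>

lemma borel_measurable_nn_integral_count_space [measurable (raw)]:
  fixes f :: "'i \<Rightarrow> 'a \<Rightarrow> ennreal"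
  assumes I: "countable I" and [measurable]: "\<And>i. i \<in> I \<Longrightarrow> f i \<in> borel_measurable M"
  shows "(\<lambda>x. \<integral>\<^sup>+i. f i x \<partial>count_space I) \<in> borel_measurable M"
proof (cases "finite I")
  case True
  then show ?thesis by (simp add: nn_integral_count_space_finite)
next
  case False
  then have [simp]: "I \<noteq> {}" by auto
  note bij = bij_betw_from_nat_into[OF I False]
  have "(\<integral>\<^sup>+i. g i \<partial>count_space I) = (\<Sum>n. g (from_nat_into I n))" for g :: "'i \<Rightarrow> ennreal"
    by (simp add: nn_integral_bij_count_space[symmetric, OF bij] nn_integral_count_space_nat)
  then show ?thesis by (simp add: from_nat_into)
qed

text \<open>The sum is an integral with respect to counting measure, so that it can be interchanged with integrals over space.\<close>
definition lr_norm :: "real \<Rightarrow> ('i \<Rightarrow> ennreal) \<Rightarrow> ennreal" where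
  "lr_norm r a = ennpowr (\<integral>\<^sup>+j. ennpowr (a j) r \<partial>count_space UNIV) (1 / r)"

lemma ennpowr_lr_norm: "0 < r \<Longrightarrow> ennpowr (lr_norm r a) r = (\<integral>\<^sup>+j. ennpowr (a j) r \<partial>count_space UNIV)"
  by (simp add: lr_norm_def)

lemma lr_norm_measurable [measurable (raw)]:
  fixes F :: "'i::countable \<Rightarrow> 'a \<Rightarrow> ennreal"
  assumes [measurable]: "\<And>j. F j \<in> borel_measurable M"
  shows "(\<lambda>x. lr_norm r (\<lambda>j. F j x)) \<in> borel_measurable M"
  unfolding lr_norm_def by measurable

lemma lr_norm_mono: "0 < r \<Longrightarrow> (\<And>j. a j \<le> b j) \<Longrightarrow> lr_norm r a \<le> lr_norm r b"
  unfolding lr_norm_def by (intro ennpowr_mono nn_integral_mono) auto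

lemma lr_norm_cmult: "0 < r \<Longrightarrow> lr_norm r (\<lambda>j. c * a j) = c * lr_norm r a"
  unfolding lr_norm_def by (simp add: ennpowr_mult nn_integral_cmult)

lemma lr_norm_multc: "0 < r \<Longrightarrow> lr_norm r (\<lambda>j. a j * c) = lr_norm r a * c"
  unfolding lr_norm_def by (simp add: ennpowr_mult nn_integral_multc)

lemma SUP_emeasure_balls:
  fixes E :: "'a::euclidean_space set"
  assumes E: "E \<in> sets lebesgue" and \<nu>: "sets \<nu> = sets lebesgue"
  shows "emeasure \<nu> E = (SUP N::nat. emeasure \<nu> (E \<inter> ball 0 (real N)))"
proof -
  have "E = (\<Union>N::nat. E \<inter> ball 0 (real N))"
    by (auto intro: reals_Archimedean2)
  moreover have "incseq (\<lambda>N::nat. E \<inter> ball 0 (real N))"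
    by (auto simp: incseq_def)
  ultimately show ?thesis
    using SUP_emeasure_incseq[of "\<lambda>N::nat. E \<inter> ball 0 (real N)" \<nu>] assms by (auto simp: image_subset_iff)
qed

section \<open>The vector-valued operator at large exponents\<close>

text \<open>Duality in the exponent \<open>s\<close>. For a bounded piece \<open>E\<close> of the superlevel set and \<open>v = 1\<^sub>E w\<close>, the Fefferman-Stein
inequality and summation over \<open>j\<close> bound \<open>l\<^sup>r w(E)\<close> by a multiple of \<open>\<integral> G\<^sup>r M v\<close>, where \<open>G\<close> is the \<open>\<ell>\<^sup>r\<close>-norm of the
\<open>F\<^sub>j\<close>. By Hoelder's inequality and Muckenhoupt's theorem for the dual weight, the \<open>s\<close>-th power of this integral is at
most a multiple of \<open>(\<integral> G\<^sup>r\<^sup>s w) w(E)\<^sup>s\<^sup>-\<^sup>1\<close>. The finite factor \<open>w(E)\<^sup>s\<^sup>-\<^sup>1\<close> is then cancelled, which is why \<open>E\<close> is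
bounded at first.\<close>
lemma vector_maximal_large_exponent:
  fixes r s A :: real
  assumes r: "1 < r" and s: "1 < s" and A: "0 < A"
  shows "\<exists>C\<ge>0. \<forall>(w :: 'a::euclidean_space \<Rightarrow> real) (F :: 'i::countable \<Rightarrow> 'a \<Rightarrow> ennreal) l.
       Muckenhoupt_weight s A w \<longrightarrow> (\<forall>j. F j \<in> borel_measurable lebesgue) \<longrightarrow> 0 < l \<longrightarrow>
       ennreal (l powr (r * s)) * emeasure (weighted w) {x. ennreal l < lr_norm r (\<lambda>j. maximal lebesgue (F j) x)} \<le>
       ennreal C * (\<integral>\<^sup>+x. ennpowr (lr_norm r (\<lambda>j. F j x)) (r * s) * w x \<partial>lebesgue)"
proof -
  define s' where "s' = s / (s - 1)"
  have s': "1 < s'" using s by (simp add: s'_def)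
  define A' where "A' = A powr (1 / (s - 1))"
  define c1 where "c1 = 5 ^ DIM('a) * strong_type_constant r"
  define c2 where "c2 = A' powr (s' / (s' - 1)) * (A' * (5 ^ DIM('a)) powr s') * strong_type_constant (s' / (s' - 1)) *
      (A' powr (1 / (s' - 1)) * (5 ^ DIM('a)) powr (s' / (s' - 1))) * strong_type_constant s'"
  note stn = strong_type_constant_nonneg
  have c1: "0 \<le> c1" using stn[OF r] by (simp add: c1_def)
  have "1 < s' / (s' - 1)" using s' by simp
  then have c2: "0 \<le> c2" using stn s' by (simp add: c2_def A'_def)
  show ?thesis
  proof (intro exI[of _ "c1 powr s * c2 powr (s - 1)"] conjI allI impI)
    show "0 \<le> c1 powr s * c2 powr (s - 1)" by simp
    fix w :: "'a \<Rightarrow> real" and F :: "'i \<Rightarrow> 'a \<Rightarrow> ennreal" and l :: real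
    assume w: "Muckenhoupt_weight s A w" and F': "\<forall>j. F j \<in> borel_measurable lebesgue" and l: "0 < l"
    then have F [measurable]: "F j \<in> borel_measurable lebesgue" for j by blast
    note wm [measurable] = Muckenhoupt_weightD(1)[OF w]
    have wpos: "0 < w x" for x using w by (rule Muckenhoupt_weightD)
    define \<sigma> where "\<sigma> = (\<lambda>x. w x powr (- 1 / (s - 1)))"
    have \<sigma>: "Muckenhoupt_weight s' A' \<sigma>"
      unfolding \<sigma>_def s'_def A'_def by (rule Muckenhoupt_weight_dual[OF s w])
    note \<sigma>m [measurable] = Muckenhoupt_weightD(1)[OF \<sigma>]
    let ?M = "\<lambda>x. lr_norm r (\<lambda>j. maximal lebesgue (F j) x)"
    let ?G = "\<lambda>x. lr_norm r (\<lambda>j. F j x)"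
    let ?W = "emeasure (weighted w)"
    let ?I = "\<integral>\<^sup>+x. ennpowr (?G x) (r * s) * w x \<partial>lebesgue"
    have Mm: "?M \<in> borel_measurable lebesgue" by measurable
    have level: "{x. ennreal l < ?M x} \<in> sets lebesgue"
      by (rule superlevel_sets_lebesgue[OF Mm])
    have "ennreal (l powr (r * s)) * ?W ({x. ennreal l < ?M x} \<inter> ball 0 (real N)) \<le>
        ennreal (c1 powr s * c2 powr (s - 1)) * ?I" for N :: nat
    proof -
      define E where "E = {x. ennreal l < ?M x} \<inter> ball 0 (real N)"
      have E [measurable]: "E \<in> sets lebesgue" unfolding E_def using level by auto
      have "?W E \<le> ?W (ball 0 (real (Suc N)))"
        unfolding E_def by (intro emeasure_mono) auto
      also have "\<dots> < top"
        using finite_positive_on_balls_weighted[OF s w] unfolding finite_positive_on_balls_def by simp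
      finally have fin: "?W E < top" .
      define v where "v = (\<lambda>x. ennreal (w x) * indicator E x)"
      have v [measurable]: "v \<in> borel_measurable lebesgue" unfolding v_def by measurable
      have WE: "?W E = (\<integral>\<^sup>+x. v x \<partial>lebesgue)"
        unfolding v_def by (subst emeasure_density) auto
      let ?J = "\<integral>\<^sup>+x. ennpowr (?G x) r * maximal lebesgue v x \<partial>lebesgue"
      let ?V = "\<integral>\<^sup>+x. ennpowr (maximal lebesgue v x) s' * \<sigma> x \<partial>lebesgue"
      have "ennreal (l powr r) * ?W E = (\<integral>\<^sup>+x. ennreal (l powr r) * v x \<partial>lebesgue)"
        unfolding WE by (simp add: nn_integral_cmult)
      also have "\<dots> \<le> (\<integral>\<^sup>+x. (\<integral>\<^sup>+j. ennpowr (maximal lebesgue (F j) x) r * v x \<partial>count_space UNIV) \<partial>lebesgue)"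
      proof (intro nn_integral_mono)
        fix x
        show "ennreal (l powr r) * v x \<le> (\<integral>\<^sup>+j. ennpowr (maximal lebesgue (F j) x) r * v x \<partial>count_space UNIV)"
        proof (cases "x \<in> E")
          case True
          then have "ennpowr (ennreal l) r \<le> ennpowr (?M x) r"
            using r by (intro ennpowr_mono) (auto simp: E_def)
          then have "ennreal (l powr r) \<le> (\<integral>\<^sup>+j. ennpowr (maximal lebesgue (F j) x) r \<partial>count_space UNIV)"
            using r l by (simp add: ennpowr_lr_norm ennpowr_ennreal)
          then show ?thesis by (simp add: nn_integral_multc mult_right_mono)
        qed (simp add: v_def)
      qed
      also have "\<dots> = (\<integral>\<^sup>+j. (\<integral>\<^sup>+x. ennpowr (maximal lebesgue (F j) x) r * v x \<partial>lebesgue) \<partial>count_space UNIV)"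
        by (rule nn_integral_count_space_nn_integral) auto
      also have "\<dots> \<le> (\<integral>\<^sup>+j. ennreal c1 * (\<integral>\<^sup>+x. ennpowr (F j x) r * maximal lebesgue v x \<partial>lebesgue) \<partial>count_space UNIV)"
        using Fefferman_Stein_weighted[OF F v r] stn[OF r] by (intro nn_integral_mono) (simp add: c1_def ennreal_mult)
      also have "\<dots> = ennreal c1 * (\<integral>\<^sup>+j. (\<integral>\<^sup>+x. ennpowr (F j x) r * maximal lebesgue v x \<partial>lebesgue) \<partial>count_space UNIV)"
        by (rule nn_integral_cmult) simp
      also have "\<dots> = ennreal c1 * (\<integral>\<^sup>+x. (\<integral>\<^sup>+j. ennpowr (F j x) r * maximal lebesgue v x \<partial>count_space UNIV) \<partial>lebesgue)"
        by (subst nn_integral_count_space_nn_integral) auto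
      also have "\<dots> = ennreal c1 * ?J"
        using r by (simp add: nn_integral_multc ennpowr_lr_norm)
      finally have 1: "ennreal (l powr r) * ?W E \<le> ennreal c1 * ?J" .
      have vs: "ennpowr (v x) s' * \<sigma> x = v x" for x
      proof (cases "x \<in> E")
        case True
        have "w x powr s' * \<sigma> x = w x powr (s' + - 1 / (s - 1))"
          unfolding \<sigma>_def by (simp only: powr_add)
        also have "s' + - 1 / (s - 1) = 1" using s by (simp add: s'_def divide_simps)
        finally show ?thesis
          using True wpos[of x] by (simp add: v_def ennpowr_ennreal ennreal_mult'[symmetric])
      qed (simp add: v_def)
      have "?V \<le> ennreal c2 * (\<integral>\<^sup>+x. ennpowr (v x) s' * \<sigma> x \<partial>lebesgue)"
        unfolding c2_def by (rule Muckenhoupt_maximal_theorem[OF s' \<sigma> v])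
      then have 2: "?V \<le> ennreal c2 * ?W E"
        unfolding vs WE .
      have "ennpowr ?J s \<le>
         (\<integral>\<^sup>+x. ennpowr (ennpowr (?G x) r) s * w x \<partial>lebesgue) *
         ennpowr (\<integral>\<^sup>+x. ennpowr (maximal lebesgue v x) (s / (s - 1)) * ennreal (w x powr (- 1 / (s - 1))) \<partial>lebesgue) (s - 1)"
        by (intro weighted_Hoelder_inequality s wpos) measurable
      also have "\<dots> = ?I * ennpowr ?V (s - 1)"
        by (simp add: s'_def \<sigma>_def)
      also have "\<dots> \<le> ?I * ennpowr (ennreal c2 * ?W E) (s - 1)"
        using s by (intro mult_left_mono ennpowr_mono 2) auto
      finally have 3: "ennpowr ?J s \<le> ?I * ennpowr (ennreal c2 * ?W E) (s - 1)" .
      have "ennpowr (ennreal (l powr r) * ?W E) s \<le> ennpowr (ennreal c1 * ?J) s"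
        using s by (intro ennpowr_mono 1) auto
      also have "\<dots> = ennpowr (ennreal c1) s * ennpowr ?J s"
        by (rule ennpowr_mult)
      also have "\<dots> \<le> ennpowr (ennreal c1) s * (?I * ennpowr (ennreal c2 * ?W E) (s - 1))"
        by (intro mult_left_mono 3) auto
      finally have 4: "ennreal (l powr (r * s)) * ennpowr (?W E) s \<le>
          ennreal (c1 powr s * c2 powr (s - 1)) * ?I * ennpowr (?W E) (s - 1)"
        using c1 c2 by (simp add: ennpowr_mult ennpowr_ennreal powr_powr ennreal_mult mult_ac)
      have "ennpowr (?W E) s = ?W E * ennpowr (?W E) (s - 1)"
        using ennpowr_add[of "?W E" 1 "s - 1"] by simp
      with 4 have 5: "ennpowr (?W E) (s - 1) * (ennreal (l powr (r * s)) * ?W E) \<le>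
          ennpowr (?W E) (s - 1) * (ennreal (c1 powr s * c2 powr (s - 1)) * ?I)"
        by (simp add: mult_ac)
      show ?thesis
      proof (cases "?W E = 0")
        case True
        then show ?thesis by (simp add: E_def)
      next
        case False
        then show ?thesis
          using 5 fin by (subst (asm) ennreal_mult_le_mult_iff) (auto simp: E_def)
      qed
    qed
    then have "(SUP N::nat. ennreal (l powr (r * s)) * ?W ({x. ennreal l < ?M x} \<inter> ball 0 (real N)))
      \<le> ennreal (c1 powr s * c2 powr (s - 1)) * ?I"
      by (intro SUP_least) auto
    then show "ennreal (l powr (r * s)) * ?W {x. ennreal l < ?M x} \<le> ennreal (c1 powr s * c2 powr (s - 1)) * ?I"
      using SUP_emeasure_balls[OF level, of "weighted w"] by (simp add: SUP_mult_left_ennreal)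
  qed
qed

lemma nn_integral_count_space_eq_SUP:
  fixes f :: "'i::countable \<Rightarrow> ennreal"
  shows "(\<integral>\<^sup>+i. f i \<partial>count_space UNIV) = (SUP J\<in>{J. finite J}. \<Sum>i\<in>J. f i)"
proof (rule antisym)
  let ?I = "\<integral>\<^sup>+i. f i \<partial>count_space UNIV" and ?S = "SUP J\<in>{J. finite J}. \<Sum>i\<in>J. f i"
  let ?J = "\<lambda>n::nat. {i::'i. to_nat i < n}"
  have fin: "finite (?J n)" for n
    using finite_imageD[of to_nat "?J n"] by (auto intro: inj_on_subset[OF inj_to_nat] finite_subset[of _ "{..<n}"])
  have sum: "(\<integral>\<^sup>+i. f i * indicator J i \<partial>count_space UNIV) = (\<Sum>i\<in>J. f i)" if "finite J" for J
    using that by (subst nn_integral_count_space_indicator[symmetric]) (auto simp: nn_integral_count_space_finite)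
  have "f i = (SUP n. f i * indicator (?J n) i)" for i
    by (rule antisym) (auto intro!: SUP_least SUP_upper2[where i="Suc (to_nat i)"] simp: indicator_def)
  then have "?I = (\<integral>\<^sup>+i. (SUP n. f i * indicator (?J n) i) \<partial>count_space UNIV)"
    by simp
  also have "\<dots> = (SUP n. \<integral>\<^sup>+i. f i * indicator (?J n) i \<partial>count_space UNIV)"
    by (rule nn_integral_monotone_convergence_SUP) (auto simp: incseq_def le_fun_def indicator_def)
  also have "\<dots> \<le> ?S"
    using fin by (intro SUP_least) (auto simp: sum intro!: SUP_upper)
  finally show "?I \<le> ?S" .
  show "?S \<le> ?I"
    by (intro SUP_least) (auto simp: sum[symmetric] indicator_def intro!: nn_integral_mono)
qed

text \<open>If \<open>S\<close> is the sum of the \<open>a\<^sub>j\<^sup>r\<close> over a finite set of indices, then \<open>S\<close> is the integral of \<open>\<Sum>\<^sub>j a\<^sub>j\<^sup>r\<^sup>-\<^sup>1 f\<^sub>j\<close>, which by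
Hoelder's inequality for sums is at most \<open>S\<^sup>1\<^sup>-\<^sup>1\<^sup>/\<^sup>r\<close> times the \<open>\<ell>\<^sup>r\<close>-norm of the \<open>f\<^sub>j\<close>.\<close>
lemma Minkowski_integral_lr_norm:
  fixes f :: "'i::countable \<Rightarrow> 'a \<Rightarrow> ennreal"
  assumes r: "1 < r" and [measurable]: "\<And>j. f j \<in> borel_measurable M"
  shows "lr_norm r (\<lambda>j. \<integral>\<^sup>+x. f j x \<partial>M) \<le> (\<integral>\<^sup>+x. lr_norm r (\<lambda>j. f j x) \<partial>M)"
proof -
  let ?g = "\<lambda>x. lr_norm r (\<lambda>j. f j x)"
  let ?I = "\<integral>\<^sup>+x. ?g x \<partial>M"
  define a where "a = (\<lambda>j. \<integral>\<^sup>+x. f j x \<partial>M)"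
  have le_g: "f j x \<le> ?g x" for j x
  proof -
    have "ennpowr (f j x) r \<le> ennpowr (?g x) r"
      using r nn_integral_ge_point[OF UNIV_I[of j], of "\<lambda>j. ennpowr (f j x) r"] by (simp add: ennpowr_lr_norm)
    then show ?thesis using r by simp
  qed
  show ?thesis
  proof (cases "?I = top")
    case fin: False
    have sum_le: "(\<Sum>j\<in>J. ennpowr (a j) r) \<le> ennpowr ?I r" if J: "finite J" for J
    proof -
      define S where "S = (\<Sum>j\<in>J. ennpowr (a j) r)"
      let ?s = "\<lambda>x. \<Sum>j\<in>J. ennpowr (a j) (r - 1) * f j x"
      have a_fin: "a j < top" for j
        using nn_integral_mono[of M "f j" ?g] le_g fin unfolding a_def by (auto simp: less_top intro: le_less_trans)
      then have S_fin: "S < top" using J by (simp add: S_def)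
      have point: "(?s x) \<le> ennpowr S (1 - 1 / r) * ?g x" for x
      proof -
        have "(?s x) = (\<integral>\<^sup>+j. f j x * ennpowr (a j) (r - 1) \<partial>count_space J)"
          using J by (simp add: nn_integral_count_space_finite mult.commute)
        then have "ennpowr (?s x) r \<le>
           (\<integral>\<^sup>+j. ennpowr (f j x) r \<partial>count_space J) * ennpowr (\<integral>\<^sup>+j. ennpowr (ennpowr (a j) (r - 1)) (r / (r - 1)) \<partial>count_space J) (r - 1)"
          using Hoelder_inequality_ennreal[OF r, of "\<lambda>j. f j x" "count_space J" "\<lambda>j. ennpowr (a j) (r - 1)"] by simp
        also have "(\<integral>\<^sup>+j. ennpowr (ennpowr (a j) (r - 1)) (r / (r - 1)) \<partial>count_space J) = S"
          using r J by (simp add: nn_integral_count_space_finite S_def)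
        also have "(\<integral>\<^sup>+j. ennpowr (f j x) r \<partial>count_space J) * ennpowr S (r - 1) \<le> ennpowr (?g x) r * ennpowr S (r - 1)"
        proof (intro mult_right_mono)
          show "(\<integral>\<^sup>+j. ennpowr (f j x) r \<partial>count_space J) \<le> ennpowr (?g x) r"
            using r by (subst nn_integral_count_space_indicator)
              (auto simp: ennpowr_lr_norm indicator_def intro!: nn_integral_mono)
        qed simp
        also have "ennpowr (?g x) r * ennpowr S (r - 1) = ennpowr (ennpowr S (1 - 1 / r) * ?g x) r"
        proof -
          have "(1 - 1 / r) * r = r - 1" using r by (simp add: field_simps)
          then show ?thesis by (simp add: ennpowr_mult mult.commute[of "ennpowr (?g x) r"])
        qed
        finally show ?thesis using r by simp
      qed
      have "S = (\<Sum>j\<in>J. ennpowr (a j) (r - 1) * a j)"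
        unfolding S_def using ennpowr_add[of "a _" "r - 1" 1] by (intro sum.cong) auto
      also have "\<dots> = (\<integral>\<^sup>+x. (?s x) \<partial>M)"
        unfolding a_def by (simp add: nn_integral_sum nn_integral_cmult)
      also have "\<dots> \<le> (\<integral>\<^sup>+x. ennpowr S (1 - 1 / r) * ?g x \<partial>M)"
        by (intro nn_integral_mono point)
      also have "\<dots> = ennpowr S (1 - 1 / r) * ?I"
        by (rule nn_integral_cmult) measurable
      finally have "S \<le> ennpowr S (1 - 1 / r) * ?I" .
      moreover have "S = ennpowr S (1 - 1 / r) * ennpowr S (1 / r)"
        using ennpowr_add[of S "1 - 1 / r" "1 / r"] by simp
      ultimately have le: "ennpowr S (1 - 1 / r) * ennpowr S (1 / r) \<le> ennpowr S (1 - 1 / r) * ?I" by simp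
      have "ennpowr S (1 / r) \<le> ?I"
      proof (cases "S = 0")
        case False
        then show ?thesis using le S_fin by (subst (asm) ennreal_mult_le_mult_iff) auto
      qed simp
      then have "ennpowr (ennpowr S (1 / r)) r \<le> ennpowr ?I r"
        using r by (intro ennpowr_mono) auto
      then show ?thesis using r by (simp add: S_def)
    qed
    have "(\<integral>\<^sup>+j. ennpowr (a j) r \<partial>count_space UNIV) \<le> ennpowr ?I r"
      unfolding nn_integral_count_space_eq_SUP by (intro SUP_least sum_le) auto
    then have "ennpowr (\<integral>\<^sup>+j. ennpowr (a j) r \<partial>count_space UNIV) (1 / r) \<le> ennpowr (ennpowr ?I r) (1 / r)"
      using r by (intro ennpowr_mono) auto
    then show ?thesis using r by (simp add: lr_norm_def a_def)
  qed simp
qed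

section \<open>Calderon-Zygmund decomposition into balls\<close>

text \<open>One-sided Lebesgue differentiation. If \<open>g > l + \<delta>\<close> held on a set \<open>T\<close> of positive finite measure, an open set around
\<open>T\<close> with only slightly larger measure would contain disjoint balls centred in \<open>T\<close> that cover almost all of \<open>T\<close>, and
adding the averages over these balls would give a contradiction.\<close>
lemma AE_le_of_averages_le:
  fixes g :: "'a::euclidean_space \<Rightarrow> ennreal" and l :: real
  assumes g [measurable]: "g \<in> borel_measurable lebesgue" and S [measurable]: "S \<in> sets lebesgue" and l: "0 \<le> l"
    and avg: "\<And>x \<rho>. x \<in> S \<Longrightarrow> 0 < \<rho> \<Longrightarrow> (\<integral>\<^sup>+y\<in>ball x \<rho>. g y \<partial>lebesgue) \<le> ennreal l * emeasure lebesgue (ball x \<rho>)"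
  shows "AE x in lebesgue. x \<in> S \<longrightarrow> g x \<le> ennreal l"
proof -
  have null: "emeasure lebesgue (S \<inter> {x. ennreal (l + \<delta>) < g x} \<inter> ball 0 R) = 0" if \<delta>: "0 < \<delta>" for \<delta> R
  proof -
    define T where "T = S \<inter> {x. ennreal (l + \<delta>) < g x} \<inter> ball 0 R"
    have T [measurable]: "T \<in> sets lebesgue"
      unfolding T_def using superlevel_sets_lebesgue[OF g] by auto
    have "emeasure lebesgue T \<le> emeasure lebesgue (ball (0::'a) R)"
      unfolding T_def by (intro emeasure_mono) auto
    also have "\<dots> < top" using emeasure_lborel_ball_finite[of "0::'a" R] by simp
    finally have "emeasure lebesgue T < top" .
    then obtain t where t: "emeasure lebesgue T = ennreal t" "0 \<le> t" by (cases "emeasure lebesgue T") auto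
    have bound: "\<delta> * t \<le> l * e" if e: "0 < e" for e
    proof -
      obtain U where U: "open U" "T \<subseteq> U" "U - T \<in> lmeasurable" "emeasure lebesgue (U - T) < ennreal e"
        by (rule sets_lebesgue_outer_open[OF T e])
      have [measurable]: "U \<in> sets lebesgue" using U by auto
      let ?B = "\<lambda>i. ball (fst i) (snd i)"
      define K where "K = {(x, \<rho>). x \<in> T \<and> 0 < \<rho> \<and> ball x \<rho> \<subseteq> U}"
      have "\<exists>i. i \<in> K \<and> x \<in> ?B i \<and> snd i < d" if xT: "x \<in> T" and d: "0 < d" for x d
      proof -
        obtain \<rho> where \<rho>: "0 < \<rho>" "ball x \<rho> \<subseteq> U" using openE[OF U(1) subsetD[OF U(2) xT]] by blast
        have "ball x (min \<rho> (d/2)) \<subseteq> U"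
          using \<rho> subset_ball[of "min \<rho> (d/2)" \<rho> x] by simp
        then have "(x, min \<rho> (d/2)) \<in> K" using \<rho> xT d by (simp add: K_def)
        moreover have "x \<in> ball x (min \<rho> (d/2))" "min \<rho> (d/2) < d" using \<rho> d by auto
        ultimately show ?thesis by (metis fst_conv snd_conv)
      qed
      then obtain Cs where Cs: "countable Cs" "Cs \<subseteq> K"
        "pairwise (\<lambda>i j. disjnt (?B i) (?B j)) Cs"
        "negligible (T - (\<Union>i\<in>Cs. ?B i))"
        by (rule Vitali_covering_theorem_balls[of T K fst snd])
      let ?V = "\<Union>i\<in>Cs. ?B i"
      have [measurable]: "?V \<in> sets lebesgue" using Cs(1) by (intro sets.countable_UN') auto
      have ae: "AE x in lebesgue. x \<in> T \<longrightarrow> x \<in> ?V"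
        using AE_not_in[OF Cs(4)[unfolded negligible_iff_null_sets]] by (rule eventually_mono) blast
      have "ennreal (l + \<delta>) * ennreal t = (\<integral>\<^sup>+x\<in>T. ennreal (l + \<delta>) \<partial>lebesgue)"
        unfolding t(1)[symmetric] by (rule nn_integral_cmult_indicator[OF T, symmetric])
      also have "\<dots> \<le> (\<integral>\<^sup>+x\<in>?V. g x \<partial>lebesgue)"
      proof (rule nn_integral_mono_AE, rule eventually_mono[OF ae])
        fix x assume V: "x \<in> T \<longrightarrow> x \<in> ?V"
        show "ennreal (l + \<delta>) * indicator T x \<le> g x * indicator ?V x"
        proof (cases "x \<in> T")
          case True
          then have "ennreal (l + \<delta>) \<le> g x" by (auto simp: T_def intro: less_imp_le)
          with True V show ?thesis by (simp only: indicator_simps(1) mult_1_right)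
        qed simp
      qed
      also have "\<dots> \<le> (\<integral>\<^sup>+i. (\<integral>\<^sup>+x\<in>?B i. g x \<partial>lebesgue) \<partial>count_space Cs)"
        by (intro nn_integral_UN_le Cs) auto
      also have "\<dots> \<le> (\<integral>\<^sup>+i. ennreal l * (\<integral>\<^sup>+x\<in>?B i. 1 \<partial>lebesgue) \<partial>count_space Cs)"
      proof (intro nn_integral_mono)
        fix i assume "i \<in> space (count_space Cs)"
        then have "fst i \<in> S" "0 < snd i" using Cs(2) by (auto simp: K_def T_def)
        then show "(\<integral>\<^sup>+x\<in>?B i. g x \<partial>lebesgue) \<le> ennreal l * (\<integral>\<^sup>+x\<in>?B i. 1 \<partial>lebesgue)"
          using avg[of "fst i" "snd i"] by (simp del: emeasure_completion)
      qed
      also have "\<dots> = ennreal l * (\<integral>\<^sup>+i. (\<integral>\<^sup>+x\<in>?B i. 1 \<partial>lebesgue) \<partial>count_space Cs)"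
        by (rule nn_integral_cmult) simp
      also have "\<dots> \<le> ennreal l * (\<integral>\<^sup>+x\<in>?V. 1 \<partial>lebesgue)"
        by (intro mult_left_mono nn_integral_UN_disjoint_le Cs) auto
      also have "\<dots> = ennreal l * emeasure lebesgue ?V" by simp
      also have "\<dots> \<le> ennreal l * emeasure lebesgue (T \<union> (U - T))"
      proof (intro mult_left_mono emeasure_mono)
        have "?B i \<subseteq> U" if "i \<in> Cs" for i
          using subsetD[OF Cs(2) that] by (cases i) (simp add: K_def)
        then show "?V \<subseteq> T \<union> (U - T)" by blast
      qed auto
      also have "\<dots> \<le> ennreal l * (emeasure lebesgue T + emeasure lebesgue (U - T))"
        by (intro mult_left_mono emeasure_subadditive) auto
      also have "\<dots> \<le> ennreal l * (ennreal t + ennreal e)"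
        using U t by (intro mult_left_mono add_mono) (auto intro: less_imp_le)
      finally have "(l + \<delta>) * t \<le> l * (t + e)"
        using l \<delta> t e by (simp add: ennreal_mult'[symmetric] ennreal_plus[symmetric] ennreal_le_iff del: ennreal_plus)
      then show ?thesis by (simp add: algebra_simps)
    qed
    have "t = 0"
    proof (rule ccontr)
      assume "t \<noteq> 0"
      then have t0: "0 < \<delta> * t" using t \<delta> by simp
      have "\<delta> * t \<le> l * (\<delta> * t / (2 * (l + 1)))" using t0 l by (intro bound) simp
      also have "\<dots> = (\<delta> * t) * (l / (2 * (l + 1)))" by simp
      also have "\<dots> < (\<delta> * t) * 1" using t0 l by (intro mult_strict_left_mono) auto
      finally show False by simp
    qed
    then show ?thesis using t by (simp add: T_def)
  qed
  let ?N = "\<lambda>(m::nat, k::nat). S \<inter> {x. ennreal (l + 1 / real (Suc m)) < g x} \<inter> ball 0 (real k)"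
  have "?N i \<in> null_sets lebesgue" for i
  proof -
    obtain m k where i: "i = (m, k)" by (cases i)
    have "?N i \<in> sets lebesgue" unfolding i using superlevel_sets_lebesgue[OF g] by simp
    moreover have "emeasure lebesgue (?N i) = 0" unfolding i using null[of "1 / real (Suc m)" "real k"] by simp
    ultimately show ?thesis by (rule null_setsI[rotated])
  qed
  then have "(\<Union>i. ?N i) \<in> null_sets lebesgue" by (intro null_sets_UN) auto
  then show ?thesis
  proof (rule AE_I')
    show "{x \<in> space lebesgue. \<not> (x \<in> S \<longrightarrow> g x \<le> ennreal l)} \<subseteq> (\<Union>i. ?N i)"
    proof
      fix x assume "x \<in> {x \<in> space lebesgue. \<not> (x \<in> S \<longrightarrow> g x \<le> ennreal l)}"
      then have x: "x \<in> S" "ennreal l < g x" by auto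
      then obtain b where b: "ennreal l < ennreal b" "ennreal b < g x" "0 \<le> b"
      proof -
        obtain z where z: "ennreal l < z" "z < g x" using dense[OF x(2)] by blast
        then have "z < top" by (auto simp: less_top[symmetric])
        then obtain b where "z = ennreal b" "0 \<le> b" by (cases z) auto
        with z that show ?thesis by blast
      qed
      then have "0 < b - l" using l by (simp add: ennreal_less_iff)
      then obtain m where m: "1 / real (Suc m) < b - l" by (rule nat_approx_posE)
      obtain k where k: "norm x < real k" using reals_Archimedean2 by blast
      have "ennreal (l + 1 / real (Suc m)) \<le> ennreal b" using m by (intro ennreal_leI) simp
      then have "ennreal (l + 1 / real (Suc m)) < g x" using b(2) by (rule le_less_trans)
      with x k have "x \<in> ?N (m, k)" by simp
      then show "x \<in> (\<Union>i. ?N i)" by blast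
    qed
  qed
qed

text \<open>For a ball on which \<open>g\<close> has average greater than \<open>l\<close>, the radius is multiplied by \<open>5\<close> for as long as the average
stays above \<open>l\<close>. The process stops because \<open>g\<close> is integrable. The last such ball has an enlargement with average at
most \<open>l\<close>, and Vitali's lemma selects disjoint balls whose fivefold enlargements cover all the centres. At the remaining points no
centred ball has average greater than \<open>l\<close>.\<close>
lemma Calderon_Zygmund_balls:
  fixes g :: "'a::euclidean_space \<Rightarrow> ennreal" and l :: real
  assumes g [measurable]: "g \<in> borel_measurable lebesgue" and fin: "(\<integral>\<^sup>+x. g x \<partial>lebesgue) < top" and l: "0 < l"
  obtains Q :: "('a \<times> real) set" where "countable Q"
    "\<forall>(c, \<rho>)\<in>Q. 0 < \<rho> \<and>
       ennreal l * emeasure lebesgue (ball c \<rho>) \<le> (\<integral>\<^sup>+y\<in>ball c \<rho>. g y \<partial>lebesgue) \<and>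
       (\<integral>\<^sup>+y\<in>ball c (5 * \<rho>). g y \<partial>lebesgue) \<le> ennreal l * emeasure lebesgue (ball c (5 * \<rho>))"
    "pairwise (\<lambda>i j. disjnt (ball (fst i) (snd i)) (ball (fst j) (snd j))) Q"
    "AE x in lebesgue. x \<notin> (\<Union>(c, \<rho>)\<in>Q. ball c (5 * \<rho>)) \<longrightarrow> g x \<le> ennreal l"
proof -
  let ?g = "\<lambda>c \<rho>. \<integral>\<^sup>+y\<in>ball c \<rho>. g y \<partial>lebesgue"
  define bad where "bad = (\<lambda>c \<rho>. 0 < \<rho> \<and> ennreal l * emeasure lebesgue (ball c \<rho>) < ?g c \<rho>)"
  obtain I where I: "(\<integral>\<^sup>+x. g x \<partial>lebesgue) = ennreal I" "0 \<le> I" using fin by (cases "\<integral>\<^sup>+x. g x \<partial>lebesgue") auto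
  define u where "u = unit_ball_vol (real DIM('a))"
  have u: "0 < u" by (simp add: u_def unit_ball_vol_pos)
  define R where "R = max 1 (I / (l * u))"
  have rad: "\<rho> \<le> R" if "bad c \<rho>" for c \<rho>
  proof (rule ccontr)
    assume "\<not> \<rho> \<le> R"
    then have \<rho>: "1 \<le> \<rho>" "I / (l * u) < \<rho>" by (auto simp: R_def)
    have "ennreal l * emeasure lebesgue (ball c \<rho>) < ?g c \<rho>" using that by (simp add: bad_def)
    also have "\<dots> \<le> ennreal I" unfolding I(1)[symmetric] by (intro nn_integral_mono) (auto simp: indicator_def)
    finally have "l * (u * \<rho> ^ DIM('a)) < I"
      using \<rho> l u by (simp add: emeasure_ball u_def[symmetric] ennreal_mult'[symmetric] ennreal_less_iff)
    moreover have "\<rho> \<le> \<rho> ^ DIM('a)" using \<rho> self_le_power[of \<rho> "DIM('a)"] by simp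
    then have "l * u * \<rho> \<le> l * u * \<rho> ^ DIM('a)" using l u by (intro mult_left_mono) auto
    ultimately have "l * u * \<rho> < I" by (simp add: mult.assoc)
    then show False using \<rho> l u by (simp add: field_simps)
  qed
  let ?B = "\<lambda>i. ball (fst i) (snd i)"
  define K where "K = {(c, \<rho>). bad c \<rho> \<and> \<not> bad c (5 * \<rho>)}"
  define S where "S = {c. \<exists>\<rho>. bad c \<rho>}"
  have "S \<subseteq> (\<Union>i\<in>K. ?B i)"
  proof
    fix c assume "c \<in> S"
    then obtain \<rho> where \<rho>: "bad c \<rho>" by (auto simp: S_def)
    then have pos: "0 < \<rho>" by (simp add: bad_def)
    have "\<exists>k. bad c (5 ^ k * \<rho>) \<and> \<not> bad c (5 * (5 ^ k * \<rho>))"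
    proof (rule ccontr)
      assume no: "\<not> ?thesis"
      have all: "bad c (5 ^ k * \<rho>)" for k
      proof (induction k)
        case (Suc k)
        then show ?case using no by (auto simp: mult.assoc)
      qed (use \<rho> in simp)
      obtain k where "R / \<rho> < 5 ^ k" using real_arch_pow[of 5 "R / \<rho>"] by auto
      then show False using rad[OF all[of k]] pos by (simp add: field_simps)
    qed
    then obtain k where k: "bad c (5 ^ k * \<rho>)" "\<not> bad c (5 * (5 ^ k * \<rho>))" by blast
    then have "(c, 5 ^ k * \<rho>) \<in> K" by (simp add: K_def)
    moreover have "c \<in> ball c (5 ^ k * \<rho>)" using pos by simp
    ultimately show "c \<in> (\<Union>i\<in>K. ?B i)" by force
  qed
  moreover have "0 < snd i \<and> snd i \<le> R" if "i \<in> K" for i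
    using that rad by (auto simp: K_def bad_def)
  ultimately obtain Q where Q: "countable Q" "Q \<subseteq> K"
    "pairwise (\<lambda>i j. disjnt (?B i) (?B j)) Q"
    "S \<subseteq> (\<Union>i\<in>Q. ball (fst i) (5 * snd i))"
    by (rule Vitali_covering_lemma_balls)
  show ?thesis
  proof (rule that[OF Q(1) _ Q(3)])
    show "\<forall>(c, \<rho>)\<in>Q. 0 < \<rho> \<and>
       ennreal l * emeasure lebesgue (ball c \<rho>) \<le> ?g c \<rho> \<and>
       ?g c (5 * \<rho>) \<le> ennreal l * emeasure lebesgue (ball c (5 * \<rho>))"
    proof (safe)
      fix c \<rho> assume "(c, \<rho>) \<in> Q"
      then have "bad c \<rho>" "\<not> bad c (5 * \<rho>)" using Q(2) by (auto simp: K_def)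
      then show "0 < \<rho>" "ennreal l * emeasure lebesgue (ball c \<rho>) \<le> ?g c \<rho>"
        "?g c (5 * \<rho>) \<le> ennreal l * emeasure lebesgue (ball c (5 * \<rho>))"
        by (auto simp: bad_def not_less simp del: emeasure_completion)
    qed
  next
    let ?U = "\<Union>(c, \<rho>)\<in>Q. ball c (5 * \<rho>)"
    have "open ?U" by (intro open_UN) auto
    then have "?U \<in> sets lebesgue"
      by (intro sets_completionI_sets) (simp add: borel_open)
    then have "space lebesgue - ?U \<in> sets lebesgue" by (rule sets.compl_sets)
    then have "- ?U \<in> sets lebesgue" by (simp only: Compl_eq_Diff_UNIV space_completion space_lborel space_borel)
    moreover have "(\<integral>\<^sup>+y\<in>ball x \<rho>. g y \<partial>lebesgue) \<le> ennreal l * emeasure lebesgue (ball x \<rho>)"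
      if "x \<in> - ?U" "0 < \<rho>" for x \<rho>
    proof -
      have "x \<notin> (\<Union>i\<in>Q. ball (fst i) (5 * snd i))" using that(1) by (simp add: case_prod_beta)
      then have "x \<notin> S" using Q(4) by blast
      then have "\<not> bad x \<rho>" unfolding S_def by blast
      then show ?thesis using that(2) by (simp only: bad_def not_less simp_thms)
    qed
    ultimately have "AE x in lebesgue. x \<in> - ?U \<longrightarrow> g x \<le> ennreal l"
      using l by (intro AE_le_of_averages_le) auto
    then show "AE x in lebesgue. x \<notin> ?U \<longrightarrow> g x \<le> ennreal l" by simp
  qed
qed

text \<open>A ball on which \<open>g\<close> has average at least \<open>l\<close> is charged to the part of \<open>g\<close> above \<open>l/2\<close> inside that ball. For
disjoint balls these charges add up to a single integral.\<close>
lemma Muckenhoupt_weight_large_average: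
  fixes w :: "'a::euclidean_space \<Rightarrow> real"
  assumes q: "1 < q" and w: "Muckenhoupt_weight q A w" and g [measurable]: "g \<in> borel_measurable lebesgue"
    and \<rho>: "0 < \<rho>" and l: "0 < l"
    and avg: "ennreal l * emeasure lebesgue (ball c \<rho>) \<le> (\<integral>\<^sup>+y\<in>ball c \<rho>. g y \<partial>lebesgue)"
  shows "ennreal (l powr q) * emeasure (weighted w) (ball c \<rho>) \<le>
    ennreal (A * 2 powr q) * (\<integral>\<^sup>+x\<in>ball c \<rho>. ennpowr (g x) q * indicator {x. ennreal (l/2) < g x} x * w x \<partial>lebesgue)"
proof -
  let ?B = "ball c \<rho>" and ?L = "emeasure lebesgue (ball c \<rho>)" and ?W = "emeasure (weighted w) (ball c \<rho>)"
  let ?h = "\<lambda>x. g x * indicator {x. ennreal (l/2) < g x} x"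
  have [measurable]: "{x. ennreal (l/2) < g x} \<in> sets lebesgue" by (rule superlevel_sets_lebesgue[OF g])
  have L: "0 < ?L" "?L < top" using \<rho> by (intro emeasure_lebesgue_ball; simp)+
  have "ennreal (l/2) * ?L \<le> (\<integral>\<^sup>+y\<in>?B. ?h y \<partial>lebesgue)"
    by (intro average_truncation l L avg) auto
  then have "ennpowr (ennreal (l/2) * ?L) q * ?W \<le> ennpowr (\<integral>\<^sup>+y\<in>?B. ?h y \<partial>lebesgue) q * ?W"
    using q by (intro mult_right_mono ennpowr_mono) auto
  also have "\<dots> \<le> ennreal A * ennpowr ?L q * (\<integral>\<^sup>+x\<in>?B. ennpowr (?h x) q * w x \<partial>lebesgue)"
    by (intro Muckenhoupt_weight_average q w \<rho>) measurable
  also have "(\<integral>\<^sup>+x\<in>?B. ennpowr (?h x) q * w x \<partial>lebesgue) =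
     (\<integral>\<^sup>+x\<in>?B. ennpowr (g x) q * indicator {x. ennreal (l/2) < g x} x * w x \<partial>lebesgue)" (is "_ = ?P")
    by (intro nn_integral_cong) (simp add: indicator_def)
  finally have "ennpowr ?L q * (ennreal ((l/2) powr q) * ?W) \<le> ennpowr ?L q * (ennreal A * ?P)"
    using l by (simp add: ennpowr_mult ennpowr_ennreal mult_ac del: emeasure_completion)
  then have "ennreal ((l/2) powr q) * ?W \<le> ennreal A * ?P"
    using L by (subst (asm) ennreal_mult_le_mult_iff) (auto simp del: emeasure_completion)
  then have "ennreal (2 powr q) * (ennreal ((l/2) powr q) * ?W) \<le> ennreal (2 powr q) * (ennreal A * ?P)"
    by (rule mult_left_mono) simp
  moreover have "l powr q = 2 powr q * (l/2) powr q" using l by (simp add: powr_mult[symmetric])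
  ultimately show ?thesis
    using Muckenhoupt_weightD(3)[OF w] by (simp add: ennreal_mult mult_ac)
qed

section \<open>The level inequality\<close>

text \<open>The integrand on the right of the level inequality, as a function of \<open>t = g(x)\<close>: values up to the level enter with
the large exponent \<open>e\<close>, values above half the level with the small exponent \<open>q\<close>.\<close>
definition level_profile :: "real \<Rightarrow> real \<Rightarrow> real \<Rightarrow> ennreal \<Rightarrow> ennreal" where
  "level_profile q e l t = ennreal (l powr - q) * (ennpowr t q * indicator {ennreal (l/2)<..} t) +
     ennreal (l powr - e) * (ennpowr t e * indicator {..ennreal l} t)"

abbreviation level_estimate ::
    "real \<Rightarrow> real \<Rightarrow> real \<Rightarrow> real \<Rightarrow> ('a::euclidean_space \<Rightarrow> real) \<Rightarrow> ('i \<Rightarrow> 'a \<Rightarrow> ennreal) \<Rightarrow> real \<Rightarrow> bool" where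
  "level_estimate C q r s w f l \<equiv>
     emeasure (weighted w) {x. ennreal (5 ^ DIM('a) * l) < lr_norm r (\<lambda>j. maximal lebesgue (f j) x)} \<le>
     ennreal C * (\<integral>\<^sup>+x. level_profile q (r * s) l (lr_norm r (\<lambda>j. f j x)) * w x \<partial>lebesgue)"

lemma level_profile_measurable [measurable]: "level_profile q e l \<in> borel_measurable borel"
  unfolding level_profile_def by measurable

text \<open>The Calderon-Zygmund argument. The mass of each \<open>f\<^sub>j\<close> on an enlarged selected ball is moved onto the ball itself, which
produces functions \<open>F\<^sub>j\<close> that agree with \<open>f\<^sub>j\<close> outside the enlarged balls. Enlarged balls may overlap: counting their
mass several times only makes \<open>F\<^sub>j\<close> larger.\<close>
lemma level_inequality_integrable:
  fixes r s q A A' :: real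
  assumes r: "1 < r" and s: "1 < s" and q: "1 < q" and A': "0 < A'" and A: "0 < A"
  shows "\<exists>C\<ge>0. \<forall>(w :: 'a::euclidean_space \<Rightarrow> real) (f :: 'i::countable \<Rightarrow> 'a \<Rightarrow> ennreal) l.
       Muckenhoupt_weight q A w \<longrightarrow> Muckenhoupt_weight s A' w \<longrightarrow> (\<forall>j. f j \<in> borel_measurable lebesgue) \<longrightarrow> 0 < l \<longrightarrow>
       (\<integral>\<^sup>+x. lr_norm r (\<lambda>j. f j x) \<partial>lebesgue) < top \<longrightarrow>
       level_estimate C q r s w f l"
proof -
  obtain CV :: real where CV: "0 \<le> CV"
    "\<forall>(w :: 'a \<Rightarrow> real) (F :: 'i \<Rightarrow> 'a \<Rightarrow> ennreal) l.
       Muckenhoupt_weight s A' w \<longrightarrow> (\<forall>j. F j \<in> borel_measurable lebesgue) \<longrightarrow> 0 < l \<longrightarrow>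
       ennreal (l powr (r * s)) * emeasure (weighted w) {x. ennreal l < lr_norm r (\<lambda>j. maximal lebesgue (F j) x)} \<le>
       ennreal CV * (\<integral>\<^sup>+x. ennpowr (lr_norm r (\<lambda>j. F j x)) (r * s) * w x \<partial>lebesgue)"
    using vector_maximal_large_exponent[OF r s A', where 'a='a and 'i='i] by blast
  define K where "K = (5 ^ DIM('a) :: real)"
  have K: "1 \<le> K" by (simp add: K_def)
  define D where "D = A * (10 ^ DIM('a)) powr q"
  define CA where "CA = A * 2 powr q"
  define C where "C = D * CA + CV * (1 + K powr (r * s) * CA)"
  have rs: "0 < r * s" using r s by simp
  have D: "0 \<le> D" and CA: "0 \<le> CA" using A by (simp_all add: D_def CA_def)
  have C: "D * CA + CV * (K powr (r * s) * CA) \<le> C" "CV \<le> C" "0 \<le> C"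
    using CV(1) D CA by (auto simp: C_def algebra_simps intro!: add_nonneg_nonneg mult_nonneg_nonneg)
  show ?thesis
  proof (intro exI[of _ C] conjI allI impI)
    show "0 \<le> C" by (rule C)
    fix w :: "'a \<Rightarrow> real" and f :: "'i \<Rightarrow> 'a \<Rightarrow> ennreal" and l :: real
    assume wq: "Muckenhoupt_weight q A w" and ws: "Muckenhoupt_weight s A' w"
      and f': "\<forall>j. f j \<in> borel_measurable lebesgue" and l: "0 < l"
      and fin: "(\<integral>\<^sup>+x. lr_norm r (\<lambda>j. f j x) \<partial>lebesgue) < top"
    have f [measurable]: "f j \<in> borel_measurable lebesgue" for j using f' by blast
    note wm [measurable] = Muckenhoupt_weightD(1)[OF wq]
    define g where "g = (\<lambda>x. lr_norm r (\<lambda>j. f j x))"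
    have g [measurable]: "g \<in> borel_measurable lebesgue" unfolding g_def by measurable
    let ?W = "emeasure (weighted w)" and ?L = "emeasure lebesgue"
    let ?hi = "\<lambda>x. ennpowr (g x) q * indicator {x. ennreal (l/2) < g x} x :: ennreal"
    let ?lo = "\<lambda>x. ennpowr (g x) (r * s) * indicator {x. g x \<le> ennreal l} x :: ennreal"
    have [measurable]: "{x. ennreal m < g x} \<in> sets lebesgue" for m by (rule superlevel_sets_lebesgue[OF g])
    have "{x. g x \<le> ennreal l} = space lebesgue - {x. ennreal l < g x}" by auto
    also have "\<dots> \<in> sets lebesgue" by measurable
    finally have [measurable]: "{x. g x \<le> ennreal l} \<in> sets lebesgue" .
    define Hi where "Hi = (\<integral>\<^sup>+x. ?hi x * w x \<partial>lebesgue)"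
    define Lo where "Lo = (\<integral>\<^sup>+x. ?lo x * w x \<partial>lebesgue)"
    have fin': "(\<integral>\<^sup>+x. g x \<partial>lebesgue) < top" using fin by (simp add: g_def)
    obtain Q :: "('a \<times> real) set" where Q: "countable Q"
      and balls: "\<forall>(c, \<rho>)\<in>Q. 0 < \<rho> \<and>
       ennreal l * ?L (ball c \<rho>) \<le> (\<integral>\<^sup>+y\<in>ball c \<rho>. g y \<partial>lebesgue) \<and>
       (\<integral>\<^sup>+y\<in>ball c (5 * \<rho>). g y \<partial>lebesgue) \<le> ennreal l * ?L (ball c (5 * \<rho>))"
      and disj: "pairwise (\<lambda>i j. disjnt (ball (fst i) (snd i)) (ball (fst j) (snd j))) Q"
      and ae: "AE x in lebesgue. x \<notin> (\<Union>(c, \<rho>)\<in>Q. ball c (5 * \<rho>)) \<longrightarrow> g x \<le> ennreal l"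
      by (rule Calderon_Zygmund_balls[OF g fin' l])
    have pos: "0 < \<rho>"
      and large: "ennreal l * ?L (ball c \<rho>) \<le> (\<integral>\<^sup>+y\<in>ball c \<rho>. g y \<partial>lebesgue)"
      and small: "(\<integral>\<^sup>+y\<in>ball c (5 * \<rho>). g y \<partial>lebesgue) \<le> ennreal l * ?L (ball c (5 * \<rho>))"
      if "(c, \<rho>) \<in> Q" for c \<rho>
      using bspec[OF balls that] by simp_all
    define B where "B = (\<lambda>i::'a \<times> real. ball (fst i) (snd i))"
    define B5 where "B5 = (\<lambda>i::'a \<times> real. ball (fst i) (5 * snd i))"
    define B10 where "B10 = (\<lambda>i::'a \<times> real. ball (fst i) (10 * snd i))"
    have Bm [measurable]: "B i \<in> sets lebesgue" "B5 i \<in> sets lebesgue" "B10 i \<in> sets lebesgue" for i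
      by (simp_all add: B_def B5_def B10_def)
    let ?b = "\<lambda>j i. \<integral>\<^sup>+y\<in>B5 i. f j y \<partial>lebesgue"
    have posi: "0 < snd i" if "i \<in> Q" for i using pos[of "fst i" "snd i"] that by simp
    have BL: "0 < ?L (B i)" "?L (B i) < top" if "i \<in> Q" for i
      unfolding B_def using posi[OF that] by (intro emeasure_lebesgue_ball; simp)+
    have sub5: "B i \<subseteq> B5 i" if "i \<in> Q" for i
      unfolding B_def B5_def using posi[OF that] by (intro subset_ball) simp
    have disjB: "pairwise (\<lambda>i j. disjnt (B i) (B j)) Q" using disj by (simp add: B_def)
    define \<Omega> where "\<Omega> = (\<Union>i\<in>Q. B5 i)"
    define \<Omega>' where "\<Omega>' = (\<Union>i\<in>Q. B10 i)"
    have \<Omega>m [measurable]: "\<Omega> \<in> sets lebesgue" "\<Omega>' \<in> sets lebesgue"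
      unfolding \<Omega>_def \<Omega>'_def using Q by (auto intro: sets.countable_UN')
    have ae': "AE x in lebesgue. x \<notin> \<Omega> \<longrightarrow> g x \<le> ennreal l"
      using ae by (simp add: \<Omega>_def B5_def case_prod_beta)
    let ?S = "\<integral>\<^sup>+i. ?W (B i) \<partial>count_space Q"
    have mass: "ennreal (l powr q) * ?S \<le> ennreal CA * Hi"
    proof -
      have "ennreal (l powr q) * ?S = (\<integral>\<^sup>+i. ennreal (l powr q) * ?W (B i) \<partial>count_space Q)"
        by (simp add: nn_integral_cmult)
      also have "\<dots> \<le> (\<integral>\<^sup>+i. ennreal CA * (\<integral>\<^sup>+x\<in>B i. ?hi x * w x \<partial>lebesgue) \<partial>count_space Q)"
      proof (intro nn_integral_mono)
        fix i assume "i \<in> space (count_space Q)"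
        then have i: "i \<in> Q" "(fst i, snd i) \<in> Q" by simp_all
        show "ennreal (l powr q) * ?W (B i) \<le> ennreal CA * (\<integral>\<^sup>+x\<in>B i. ?hi x * w x \<partial>lebesgue)"
          unfolding CA_def B_def by (rule Muckenhoupt_weight_large_average[OF q wq g posi[OF i(1)] l large[OF i(2)]])
      qed
      also have "\<dots> = ennreal CA * (\<integral>\<^sup>+i. (\<integral>\<^sup>+x\<in>B i. ?hi x * w x \<partial>lebesgue) \<partial>count_space Q)"
        by (rule nn_integral_cmult) simp
      also have "\<dots> \<le> ennreal CA * (\<integral>\<^sup>+x\<in>(\<Union>i\<in>Q. B i). ?hi x * w x \<partial>lebesgue)"
        by (intro mult_left_mono nn_integral_UN_disjoint_le Q disjB) auto
      also have "\<dots> \<le> ennreal CA * Hi"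
        unfolding Hi_def by (intro mult_left_mono nn_integral_mono) (auto simp: indicator_def)
      finally show ?thesis .
    qed
    have W\<Omega>': "?W \<Omega>' \<le> ennreal D * ?S"
    proof -
      have "?W \<Omega>' \<le> (\<integral>\<^sup>+i. ?W (B10 i) \<partial>count_space Q)"
        unfolding \<Omega>'_def by (intro emeasure_UN_le Q) simp
      also have "\<dots> \<le> (\<integral>\<^sup>+i. ennreal D * ?W (B i) \<partial>count_space Q)"
        unfolding D_def B_def B10_def using posi by (intro nn_integral_mono Muckenhoupt_weight_doubling q wq) auto
      also have "\<dots> = ennreal D * ?S" by (rule nn_integral_cmult) simp
      finally show ?thesis .
    qed
    define m where "m = (\<lambda>j i. ?b j i / ?L (B i))"
    define F where "F = (\<lambda>j x. f j x * indicator (- \<Omega>) x + (\<integral>\<^sup>+i. m j i * indicator (B i) x \<partial>count_space Q))"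
    have Fm [measurable]: "F j \<in> borel_measurable lebesgue" for j
      unfolding F_def using Q by measurable
    have F_out: "F j x = f j x" if "x \<notin> \<Omega>" for j x
    proof -
      have "(\<integral>\<^sup>+i. m j i * indicator (B i) x \<partial>count_space Q) = (\<integral>\<^sup>+i. 0 \<partial>count_space Q)"
        using that sub5 by (intro nn_integral_cong) (auto simp: \<Omega>_def indicator_def)
      then show ?thesis using that by (simp add: F_def)
    qed
    have F_in: "F j x = m j i" if i: "i \<in> Q" "x \<in> B i" for j x i
    proof -
      have "(\<integral>\<^sup>+k. m j k * indicator (B k) x \<partial>count_space Q) = (\<integral>\<^sup>+k. m j i * indicator {i} k \<partial>count_space Q)"
        using i disjB by (intro nn_integral_cong) (auto simp: indicator_def pairwise_def disjnt_iff)
      also have "\<dots> = m j i" using i by (simp add: nn_integral_cmult)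
      finally have "(\<integral>\<^sup>+k. m j k * indicator (B k) x \<partial>count_space Q) = m j i" .
      moreover have "x \<in> \<Omega>" using i sub5[OF i(1)] unfolding \<Omega>_def by blast
      ultimately show ?thesis by (simp add: F_def)
    qed
    have F_mid: "F j x = 0" if "x \<in> \<Omega>" "x \<notin> (\<Union>i\<in>Q. B i)" for j x
    proof -
      have "(\<integral>\<^sup>+i. m j i * indicator (B i) x \<partial>count_space Q) = (\<integral>\<^sup>+i. 0 \<partial>count_space Q)"
        using that by (intro nn_integral_cong) (auto simp: indicator_def)
      then show ?thesis using that by (simp add: F_def)
    qed
    let ?G = "\<lambda>x. lr_norm r (\<lambda>j. F j x)"
    let ?GI = "\<integral>\<^sup>+x. ennpowr (?G x) (r * s) * w x \<partial>lebesgue"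
    have m_le: "lr_norm r (\<lambda>j. m j i) \<le> ennreal (K * l)" if i: "i \<in> Q" for i
    proof -
      have "lr_norm r (\<lambda>j. ?b j i) \<le> (\<integral>\<^sup>+y. lr_norm r (\<lambda>j. f j y * indicator (B5 i) y) \<partial>lebesgue)"
        by (rule Minkowski_integral_lr_norm[OF r]) measurable
      also have "\<dots> = (\<integral>\<^sup>+y\<in>B5 i. g y \<partial>lebesgue)"
        using r by (simp add: g_def lr_norm_multc)
      also have "\<dots> \<le> ennreal l * ?L (B5 i)"
        using small[of "fst i" "snd i"] i by (simp add: B5_def)
      also have "\<dots> = ennreal (K * l) * ?L (B i)"
        using l K emeasure_ball_scale[OF posi[OF i], of 5 "fst i"] unfolding B_def B5_def K_def
        by (simp add: ennreal_mult mult_ac del: emeasure_completion)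
      finally have "lr_norm r (\<lambda>j. ?b j i) / ?L (B i) \<le> ennreal (K * l) * ?L (B i) / ?L (B i)"
        by (rule divide_right_mono_ennreal)
      also have "\<dots> = ennreal (K * l)"
        using ennreal_mult_divide_cancel[OF BL[OF i], of "ennreal (K * l)"]
        by (simp add: ennreal_times_divide mult.commute del: emeasure_completion)
      also have "lr_norm r (\<lambda>j. ?b j i) / ?L (B i) = lr_norm r (\<lambda>j. m j i)"
        using r lr_norm_cmult[of r "inverse (?L (B i))" "\<lambda>j. ?b j i"]
        by (simp only: m_def divide_ennreal_def mult.commute)
      finally show ?thesis .
    qed
    have G_int: "?GI \<le> Lo + ennreal ((K * l) powr (r * s)) * ?S"
    proof -
      have "AE x in lebesgue. ennpowr (?G x) (r * s) * w x \<le>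
         ?lo x * w x + (\<integral>\<^sup>+i. ennreal ((K * l) powr (r * s)) * (ennreal (w x) * indicator (B i) x) \<partial>count_space Q)"
        (is "AE x in _. _ \<le> _ + ?R x")
        using ae'
      proof (rule eventually_mono)
        fix x assume x: "x \<notin> \<Omega> \<longrightarrow> g x \<le> ennreal l"
        consider "x \<notin> \<Omega>" | i where "i \<in> Q" "x \<in> B i" | "x \<in> \<Omega>" "x \<notin> (\<Union>i\<in>Q. B i)" by blast
        then show "ennpowr (?G x) (r * s) * w x \<le> ?lo x * w x + ?R x"
        proof cases
          case 1
          then have "?G x = g x" by (simp add: F_out g_def)
          then show ?thesis using 1 x by (simp add: indicator_def)
        next
          case (2 i)
          then have "?G x \<le> ennreal (K * l)" using m_le by (simp add: F_in)
          then have "ennpowr (?G x) (r * s) \<le> ennpowr (ennreal (K * l)) (r * s)" using rs by (intro ennpowr_mono) auto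
          also have "\<dots> = ennreal ((K * l) powr (r * s))" using K l by (simp add: ennpowr_ennreal)
          finally have "ennpowr (?G x) (r * s) * w x \<le> ennreal ((K * l) powr (r * s)) * (ennreal (w x) * indicator (B i) x)"
            using 2 by (simp add: mult_right_mono)
          also have "\<dots> \<le> ?R x" by (rule nn_integral_ge_point[OF 2(1)])
          finally show ?thesis by (simp add: add_increasing)
        next
          case 3
          then have "?G x = 0" by (simp add: F_mid lr_norm_def)
          then show ?thesis by simp
        qed
      qed
      then have "?GI \<le> (\<integral>\<^sup>+x. ?lo x * w x + ?R x \<partial>lebesgue)"
        by (rule nn_integral_mono_AE)
      also have "\<dots> = Lo + (\<integral>\<^sup>+x. ?R x \<partial>lebesgue)"
        unfolding Lo_def using Q by (intro nn_integral_add) measurable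
      also have "(\<integral>\<^sup>+x. ?R x \<partial>lebesgue) = (\<integral>\<^sup>+i. (\<integral>\<^sup>+x. ennreal ((K * l) powr (r * s)) * (ennreal (w x) * indicator (B i) x) \<partial>lebesgue) \<partial>count_space Q)"
        by (rule nn_integral_count_space_nn_integral[OF Q]) measurable
      also have "\<dots> = (\<integral>\<^sup>+i. ennreal ((K * l) powr (r * s)) * ?W (B i) \<partial>count_space Q)"
        by (intro nn_integral_cong) (simp add: nn_integral_cmult emeasure_density)
      also have "\<dots> = ennreal ((K * l) powr (r * s)) * ?S" by (rule nn_integral_cmult) simp
      finally show ?thesis .
    qed
    \<comment> \<open>A ball through a point far from the selected balls that meets an enlarged ball is much larger than it.\<close>
    have point: "maximal lebesgue (f j) x \<le> ennreal K * maximal lebesgue (F j) x" if x: "x \<notin> \<Omega>'" for j x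
    proof (rule maximal_least)
      fix z :: 'a and R :: real assume R: "0 < R" and xz: "x \<in> ball z R"
      define Q' where "Q' = {i\<in>Q. B5 i \<inter> ball z R \<noteq> {}}"
      have Q': "countable Q'" "Q' \<subseteq> Q" using Q unfolding Q'_def by (auto intro: countable_subset[of _ Q])
      let ?f = "\<integral>\<^sup>+y\<in>ball z R. f j y \<partial>lebesgue" and ?F = "\<integral>\<^sup>+y\<in>ball z (5 * R). F j y \<partial>lebesgue"
      let ?out = "\<integral>\<^sup>+y. f j y * indicator (- \<Omega>) y * indicator (ball z (5 * R)) y \<partial>lebesgue"
      let ?in = "\<integral>\<^sup>+y\<in>(\<Union>i\<in>Q'. B5 i). f j y \<partial>lebesgue"
      let ?m = "\<lambda>i y. m j i * indicator (B i) y * indicator (ball z (5 * R)) y"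
      have contained: "B i \<subseteq> ball z (5 * R)" if i: "i \<in> Q'" for i
      proof
        fix b assume b: "b \<in> B i"
        obtain y where y: "dist (fst i) y < 5 * snd i" "dist z y < R"
          using i by (auto simp: Q'_def B5_def)
        have "\<not> dist (fst i) x < 10 * snd i" using x i by (auto simp: \<Omega>'_def B10_def Q'_def)
        moreover have "dist (fst i) x \<le> dist (fst i) y + dist z y + dist z x"
          using dist_triangle[of "fst i" x y] dist_triangle[of y x z] by (simp add: dist_commute)
        moreover have "dist z x < R" using xz by simp
        moreover have "dist z b \<le> dist z y + dist (fst i) y + dist (fst i) b"
          using dist_triangle[of z b y] dist_triangle[of y b "fst i"] by (simp add: dist_commute)
        moreover have "dist (fst i) b < snd i" using b by (simp add: B_def)
        ultimately have "dist z b < 5 * R" using y R by linarith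
        then show "b \<in> ball z (5 * R)" by simp
      qed
      have "?f \<le>
          (\<integral>\<^sup>+y. f j y * indicator (- \<Omega>) y * indicator (ball z (5 * R)) y + f j y * indicator (\<Union>i\<in>Q'. B5 i) y \<partial>lebesgue)"
      proof (intro nn_integral_mono)
        fix y
        have "y \<in> ball z R \<Longrightarrow> y \<in> ball z (5 * R)" using R by auto
        moreover have "y \<in> (\<Union>i\<in>Q'. B5 i)" if "y \<in> ball z R" "y \<in> \<Omega>"
          using that unfolding \<Omega>_def Q'_def by blast
        ultimately show "f j y * indicator (ball z R) y \<le>
          f j y * indicator (- \<Omega>) y * indicator (ball z (5 * R)) y + f j y * indicator (\<Union>i\<in>Q'. B5 i) y"
          by (auto simp: indicator_def simp del: mem_ball UN_iff)
      qed
      also have "\<dots> = ?out + ?in"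
      proof (rule nn_integral_add)
        have [measurable]: "(\<Union>i\<in>Q'. B5 i) \<in> sets lebesgue" using Q' by (auto intro: sets.countable_UN')
        show "(\<lambda>y. f j y * indicator (\<Union>i\<in>Q'. B5 i) y) \<in> borel_measurable lebesgue" by measurable
      qed measurable
      finally have in_out: "?f \<le>
          ?out + ?in" .
      have "?in \<le> (\<integral>\<^sup>+i. ?b j i \<partial>count_space Q')"
        by (intro nn_integral_UN_le Q') auto
      also have "\<dots> = (\<integral>\<^sup>+i. (\<integral>\<^sup>+y. ?m i y \<partial>lebesgue) \<partial>count_space Q')"
      proof (rule nn_integral_cong)
        fix i assume "i \<in> space (count_space Q')"
        then have i: "i \<in> Q'" "i \<in> Q" using Q' by auto
        have "?b j i = m j i * ?L (B i)"
          unfolding m_def using ennreal_mult_divide_cancel[OF BL[OF i(2)]] by (simp add: mult.commute del: emeasure_completion)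
        also have "\<dots> = (\<integral>\<^sup>+y\<in>B i. m j i \<partial>lebesgue)" by (rule nn_integral_cmult_indicator[symmetric]) simp
        also have "\<dots> = (\<integral>\<^sup>+y. ?m i y \<partial>lebesgue)"
          using contained[OF i(1)] by (intro nn_integral_cong) (auto simp: indicator_def simp del: mem_ball)
        finally show "?b j i = (\<integral>\<^sup>+y. ?m i y \<partial>lebesgue)" .
      qed
      also have "\<dots> \<le> (\<integral>\<^sup>+i. (\<integral>\<^sup>+y. ?m i y \<partial>lebesgue) \<partial>count_space Q)"
        using Q'(2) by (simp add: nn_integral_count_space_indicator) (intro nn_integral_mono, auto simp: indicator_def)
      also have "\<dots> = (\<integral>\<^sup>+y. (\<integral>\<^sup>+i. ?m i y \<partial>count_space Q) \<partial>lebesgue)"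
        by (rule nn_integral_count_space_nn_integral[OF Q, symmetric]) measurable
      finally have inner: "?in \<le>
         (\<integral>\<^sup>+y. (\<integral>\<^sup>+i. ?m i y \<partial>count_space Q) \<partial>lebesgue)" .
      note in_out
      also have "?out + ?in \<le>
        ?out +
         (\<integral>\<^sup>+y. (\<integral>\<^sup>+i. ?m i y \<partial>count_space Q) \<partial>lebesgue)"
        by (intro add_left_mono inner)
      also have "\<dots> = ?F"
        unfolding F_def distrib_right nn_integral_multc[symmetric] using Q
        by (subst nn_integral_add) (auto simp: nn_integral_multc)
      finally have "?f \<le> ?F" .
      then have "?f / ?L (ball z R) \<le> ?F / ?L (ball z R)"
        by (rule divide_right_mono_ennreal)
      also have "\<dots> = ennreal K * (?F / ?L (ball z (5 * R)))"
      proof -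
        have k: "0 < ennreal K" "ennreal K < top" using K by auto
        obtain b where b: "?L (ball z R) = ennreal b" "0 < b"
          using emeasure_lebesgue_ball[OF R, of z] by (cases "?L (ball z R)") auto
        have b5: "?L (ball z (5 * R)) = ennreal (K * b)"
          using emeasure_ball_scale[OF R, of 5 z] b K by (simp add: K_def ennreal_mult del: emeasure_completion)
        have inv: "inverse (ennreal b) = ennreal K * inverse (ennreal (K * b))"
          using b K by (simp add: inverse_ennreal ennreal_mult'[symmetric])
        show ?thesis unfolding b(1) b5 divide_ennreal_def inv by (simp only: mult_ac)
      qed
      also have "\<dots> \<le> ennreal K * maximal lebesgue (F j) x"
        using R xz by (intro mult_left_mono maximal_upper) auto
      finally show "?f / ?L (ball z R) \<le> ennreal K * maximal lebesgue (F j) x" .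
    qed
    let ?MF = "\<lambda>x. lr_norm r (\<lambda>j. maximal lebesgue (F j) x)" and ?Mf = "\<lambda>x. lr_norm r (\<lambda>j. maximal lebesgue (f j) x)"
    have MFm: "{x. ennreal l < ?MF x} \<in> sets lebesgue" by (rule superlevel_sets_lebesgue) measurable
    have incl: "{x. ennreal (K * l) < ?Mf x} \<subseteq> \<Omega>' \<union> {x. ennreal l < ?MF x}"
    proof
      fix x assume x: "x \<in> {x. ennreal (K * l) < ?Mf x}"
      show "x \<in> \<Omega>' \<union> {x. ennreal l < ?MF x}"
      proof (cases "x \<in> \<Omega>'")
        case False
        have "?Mf x \<le> lr_norm r (\<lambda>j. ennreal K * maximal lebesgue (F j) x)"
          using r point[OF False] by (intro lr_norm_mono) auto
        also have "\<dots> = ennreal K * ?MF x" using r by (simp add: lr_norm_cmult)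
        finally have "ennreal (K * l) < ennreal K * ?MF x" using x by (auto intro: less_le_trans)
        then have "ennreal K * ennreal l < ennreal K * ?MF x" using K l by (simp add: ennreal_mult)
        then have "ennreal l < ?MF x" by (meson mult_left_mono not_le zero_le)
        then show ?thesis by simp
      qed simp
    qed
    have "?W {x. ennreal (K * l) < ?Mf x} \<le> ?W (\<Omega>' \<union> {x. ennreal l < ?MF x})"
      using MFm by (intro emeasure_mono incl) auto
    also have "\<dots> \<le> ?W \<Omega>' + ?W {x. ennreal l < ?MF x}"
      using MFm by (intro emeasure_subadditive) auto
    finally have split: "?W {x. ennreal (K * l) < ?Mf x} \<le> ?W \<Omega>' + ?W {x. ennreal l < ?MF x}" .
    have inv: "ennreal (l powr - a) * (ennreal (l powr a) * X) = X" for a X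
      using l by (simp add: mult.assoc[symmetric] ennreal_mult[symmetric] powr_add[symmetric])
    \<comment> \<open>What remains is bookkeeping: the weight of the tenfold balls and the part of the integral of \<open>G\<close> on the balls are both
       multiples of \<open>?S\<close>.\<close>
    have S_le: "?S \<le> ennreal (l powr - q) * (ennreal CA * Hi)"
      using mult_left_mono[OF mass, of "ennreal (l powr - q)"] by (simp add: inv)
    have "?W {x. ennreal l < ?MF x} \<le> ennreal (l powr - (r * s)) * (ennreal CV * ?GI)"
      using mult_left_mono[OF CV(2)[rule_format, OF ws Fm l], of "ennreal (l powr - (r * s))"] by (simp add: inv)
    also have "\<dots> \<le> ennreal (l powr - (r * s)) * (ennreal CV * (Lo + ennreal ((K * l) powr (r * s)) * ?S))"
      by (intro mult_left_mono G_int) auto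
    also have "\<dots> = ennreal CV * (ennreal (l powr - (r * s)) * Lo) + ennreal (CV * K powr (r * s)) * ?S"
    proof -
      have "ennreal ((K * l) powr (r * s)) = ennreal (K powr (r * s)) * ennreal (l powr (r * s))"
        using K l by (simp add: powr_mult ennreal_mult)
      then have "ennreal (l powr - (r * s)) * (ennreal CV * (ennreal ((K * l) powr (r * s)) * ?S)) =
         ennreal CV * ennreal (K powr (r * s)) * (ennreal (l powr - (r * s)) * (ennreal (l powr (r * s)) * ?S))"
        by (simp add: mult_ac)
      also have "\<dots> = ennreal (CV * K powr (r * s)) * ?S" unfolding inv using CV(1) by (simp add: ennreal_mult)
      finally show ?thesis by (simp add: distrib_left mult.left_commute[of "ennreal CV"])
    qed
    finally have W2: "?W {x. ennreal l < ?MF x} \<le> ennreal CV * (ennreal (l powr - (r * s)) * Lo) + ennreal (CV * K powr (r * s)) * ?S" .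
    have "?W {x. ennreal (K * l) < ?Mf x} \<le> ennreal D * ?S + (ennreal CV * (ennreal (l powr - (r * s)) * Lo) + ennreal (CV * K powr (r * s)) * ?S)"
      using split W\<Omega>' W2 by (meson add_mono order.trans)
    also have "\<dots> = ennreal (D + CV * K powr (r * s)) * ?S + ennreal CV * (ennreal (l powr - (r * s)) * Lo)"
      using D CV(1) by (simp add: ennreal_plus distrib_right add_ac)
    also have "\<dots> \<le> ennreal (D + CV * K powr (r * s)) * (ennreal (l powr - q) * (ennreal CA * Hi)) + ennreal C * (ennreal (l powr - (r * s)) * Lo)"
      using C by (intro add_mono mult_left_mono mult_right_mono S_le ennreal_leI) auto
    also have "ennreal (D + CV * K powr (r * s)) * (ennreal (l powr - q) * (ennreal CA * Hi)) =
        ennreal (D * CA + CV * (K powr (r * s) * CA)) * (ennreal (l powr - q) * Hi)"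
    proof -
      have "D * CA + CV * (K powr (r * s) * CA) = (D + CV * K powr (r * s)) * CA" by (simp add: algebra_simps)
      then show ?thesis using D CV(1) CA by (simp add: ennreal_mult mult_ac)
    qed
    also have "\<dots> \<le> ennreal C * (ennreal (l powr - q) * Hi)"
      using C by (intro mult_right_mono ennreal_leI) auto
    finally have "?W {x. ennreal (K * l) < ?Mf x} \<le> ennreal C * (ennreal (l powr - q) * Hi) + ennreal C * (ennreal (l powr - (r * s)) * Lo)"
      by simp
    also have "\<dots> = ennreal C * (ennreal (l powr - q) * Hi + ennreal (l powr - (r * s)) * Lo)"
      by (simp add: distrib_left)
    also have "ennreal (l powr - q) * Hi + ennreal (l powr - (r * s)) * Lo =
       (\<integral>\<^sup>+x. ennreal (l powr - q) * (?hi x * w x) + ennreal (l powr - (r * s)) * (?lo x * w x) \<partial>lebesgue)"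
      unfolding Hi_def Lo_def by (subst nn_integral_add) (auto simp: nn_integral_cmult)
    also have "\<dots> = (\<integral>\<^sup>+x. (ennreal (l powr - q) * ?hi x + ennreal (l powr - (r * s)) * ?lo x) * w x \<partial>lebesgue)"
      by (simp add: distrib_right mult.assoc)
    finally show "level_estimate C q r s w f l"
      by (simp add: K_def g_def level_profile_def indicator_def)
  qed
qed

lemma lr_norm_SUP:
  fixes a :: "nat \<Rightarrow> 'i \<Rightarrow> ennreal"
  assumes r: "0 < r" and inc: "\<And>j. incseq (\<lambda>N. a N j)"
  shows "lr_norm r (\<lambda>j. SUP N. a N j) = (SUP N. lr_norm r (a N))"
proof -
  have "(\<integral>\<^sup>+j. ennpowr (SUP N. a N j) r \<partial>count_space UNIV) = (\<integral>\<^sup>+j. (SUP N. ennpowr (a N j) r) \<partial>count_space UNIV)"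
    using r by (simp add: ennpowr_SUP)
  also have "\<dots> = (SUP N. \<integral>\<^sup>+j. ennpowr (a N j) r \<partial>count_space UNIV)"
    using r inc by (intro nn_integral_monotone_convergence_SUP) (auto simp: incseq_def le_fun_def)
  finally show ?thesis using r by (simp add: lr_norm_def ennpowr_SUP)
qed

text \<open>A fixed ball is contained in all sufficiently large balls around the origin, so its average is reached by the truncations.\<close>
lemma maximal_truncation_SUP:
  fixes f :: "'a::euclidean_space \<Rightarrow> ennreal"
  shows "maximal \<mu> f x = (SUP N::nat. maximal \<mu> (\<lambda>y. f y * indicator (ball 0 (real N)) y) x)"
proof (rule antisym)
  let ?S = "SUP N::nat. maximal \<mu> (\<lambda>y. f y * indicator (ball 0 (real N)) y) x"
  let ?f = "\<lambda>(N::nat) y. f y * indicator (ball 0 (real N)) y"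
  show "maximal \<mu> f x \<le> ?S"
  proof (rule maximal_least)
    fix c :: 'a and \<rho> :: real assume \<rho>: "0 < \<rho>" "x \<in> ball c \<rho>"
    obtain N :: nat where N: "norm c + \<rho> < real N" using reals_Archimedean2 by blast
    have "norm y < real N" if "dist c y < \<rho>" for y
      using that N norm_triangle_ineq2[of y c] by (simp add: dist_norm norm_minus_commute)
    then have "(\<integral>\<^sup>+y\<in>ball c \<rho>. f y \<partial>\<mu>) = (\<integral>\<^sup>+y\<in>ball c \<rho>. f y * indicator (ball 0 (real N)) y \<partial>\<mu>)"
      by (intro nn_integral_cong) (auto simp: indicator_def)
    then have "(\<integral>\<^sup>+y\<in>ball c \<rho>. f y \<partial>\<mu>) / emeasure \<mu> (ball c \<rho>) \<le> maximal \<mu> (?f N) x"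
      using maximal_upper[OF \<rho>, of \<mu> "?f N"] by simp
    then show "(\<integral>\<^sup>+y\<in>ball c \<rho>. f y \<partial>\<mu>) / emeasure \<mu> (ball c \<rho>) \<le> ?S"
      by (rule SUP_upper2[OF UNIV_I])
  qed
  show "?S \<le> maximal \<mu> f x"
    by (intro SUP_least maximal_mono) (auto simp: indicator_def)
qed

text \<open>Integrability of \<open>g\<close> is removed by truncation to balls around the origin. If the right-hand side is finite, the
\<open>A\<^sub>q\<close> condition makes the part of \<open>g\<close> above \<open>l/2\<close> locally integrable, and the rest is bounded.\<close>
lemma level_inequality:
  fixes r s q A A' :: real
  assumes r: "1 < r" and s: "1 < s" and q: "1 < q" and A': "0 < A'" and A: "0 < A"
  shows "\<exists>C>0. \<forall>(w :: 'a::euclidean_space \<Rightarrow> real) (f :: 'i::countable \<Rightarrow> 'a \<Rightarrow> ennreal) l.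
       Muckenhoupt_weight q A w \<longrightarrow> Muckenhoupt_weight s A' w \<longrightarrow> (\<forall>j. f j \<in> borel_measurable lebesgue) \<longrightarrow> 0 < l \<longrightarrow>
       level_estimate C q r s w f l"
proof -
  obtain C0 :: real where C0: "0 \<le> C0"
    "\<forall>(w :: 'a \<Rightarrow> real) (f :: 'i::countable \<Rightarrow> 'a \<Rightarrow> ennreal) l.
       Muckenhoupt_weight q A w \<longrightarrow> Muckenhoupt_weight s A' w \<longrightarrow> (\<forall>j. f j \<in> borel_measurable lebesgue) \<longrightarrow> 0 < l \<longrightarrow>
       (\<integral>\<^sup>+x. lr_norm r (\<lambda>j. f j x) \<partial>lebesgue) < top \<longrightarrow>
       level_estimate C0 q r s w f l"
    using level_inequality_integrable[OF r s q A' A, where 'a='a and 'i='i] by blast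
  show ?thesis
  \<comment> \<open>The constant is made positive so that an infinite right-hand side stays infinite.\<close>
  proof (intro exI[of _ "C0 + 1"] conjI allI impI)
    show "0 < C0 + 1" using C0(1) by simp
    fix w :: "'a \<Rightarrow> real" and f :: "'i \<Rightarrow> 'a \<Rightarrow> ennreal" and l :: real
    assume wq: "Muckenhoupt_weight q A w" and ws: "Muckenhoupt_weight s A' w"
      and f': "\<forall>j. f j \<in> borel_measurable lebesgue" and l: "0 < l"
    have f [measurable]: "f j \<in> borel_measurable lebesgue" for j using f' by blast
    note wm [measurable] = Muckenhoupt_weightD(1)[OF wq]
    have wpos: "0 < w x" for x using wq by (rule Muckenhoupt_weightD)
    define g where "g = (\<lambda>x. lr_norm r (\<lambda>j. f j x))"
    have g [measurable]: "g \<in> borel_measurable lebesgue" unfolding g_def by measurable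
    have hi_sets [measurable]: "{x. ennreal m < g x} \<in> sets lebesgue" for m by (rule superlevel_sets_lebesgue[OF g])
    let ?H = "level_profile q (r * s) l"
    let ?R = "\<integral>\<^sup>+x. ?H (g x) * w x \<partial>lebesgue"
    let ?W = "emeasure (weighted w)" and ?L = "emeasure lebesgue"
    let ?Mf = "\<lambda>x. lr_norm r (\<lambda>j. maximal lebesgue (f j) x)"
    let ?k = "ennreal (5 ^ DIM('a) * l)"
    have "?W {x. ?k < ?Mf x} \<le> ennreal (C0 + 1) * ?R"
    proof (cases "?R = top")
      case True
      then show ?thesis using C0(1) by (simp add: ennreal_mult_top)
    next
      case False
      define fN where "fN = (\<lambda>(N::nat) j x. f j x * indicator (ball 0 (real N)) x)"
      have fNm [measurable]: "fN N j \<in> borel_measurable lebesgue" for N j unfolding fN_def by measurable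
      define gN where "gN = (\<lambda>N x. lr_norm r (\<lambda>j. fN N j x))"
      have gN: "gN N x = g x * indicator (ball 0 (real N)) x" for N x
        using r by (simp add: gN_def fN_def g_def lr_norm_multc)
      have int: "(\<integral>\<^sup>+x. gN N x \<partial>lebesgue) < top" for N
      proof (cases "N = 0")
        case True
        then show ?thesis by (simp add: gN)
      next
        case N: False
        let ?B = "ball (0::'a) (real N)"
        let ?h = "\<lambda>x. g x * indicator {x. ennreal (l/2) < g x} x"
        let ?P = "\<integral>\<^sup>+x\<in>?B. ennpowr (?h x) q * w x \<partial>lebesgue"
        let ?hB = "\<integral>\<^sup>+x\<in>?B. ?h x \<partial>lebesgue"
        have L: "0 < ?L ?B" "?L ?B < top" using N by (intro emeasure_lebesgue_ball; simp)+
        have W: "0 < ?W ?B" "?W ?B < top"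
          using finite_positive_on_balls_weighted[OF q wq] N by (auto simp only: finite_positive_on_balls_def of_nat_0_less_iff)
        have "ennreal (l powr - q) * ?P =
           (\<integral>\<^sup>+x. ennreal (l powr - q) * (ennpowr (?h x) q * w x * indicator ?B x) \<partial>lebesgue)"
          by (rule nn_integral_cmult[symmetric]) measurable
        also have "\<dots> \<le> ?R"
        proof (intro nn_integral_mono)
          fix x
          have "ennreal (l powr - q) * (ennpowr (?h x) q * w x * indicator ?B x) \<le>
              ennreal (l powr - q) * (ennpowr (g x) q * indicator {ennreal (l/2)<..} (g x)) * w x"
            by (auto simp: indicator_def mult.assoc)
          also have "\<dots> \<le> ?H (g x) * w x" unfolding level_profile_def by (intro mult_right_mono) auto
          finally show "ennreal (l powr - q) * (ennpowr (?h x) q * w x * indicator ?B x) \<le> ?H (g x) * w x" .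
        qed
        finally have "?P < top"
          using False l by (auto simp: less_top[symmetric] top_unique ennreal_mult_top)
        then have "ennreal A * ennpowr (?L ?B) q * ?P < top"
          using L by (simp add: ennreal_mult_less_top del: emeasure_completion)
        then have "ennpowr ?hB q * ?W ?B < top"
          using N by (intro le_less_trans[OF Muckenhoupt_weight_average[OF q wq]]) (auto simp del: emeasure_completion)
        then have h: "?hB < top" using W by (auto simp: ennreal_mult_less_top)
        have "(\<integral>\<^sup>+x. gN N x \<partial>lebesgue) \<le> (\<integral>\<^sup>+x. ?h x * indicator ?B x + ennreal (l/2) * indicator ?B x \<partial>lebesgue)"
          unfolding gN by (intro nn_integral_mono) (auto simp: indicator_def)
        also have "\<dots> = ?hB + ennreal (l/2) * ?L ?B"
          by (subst nn_integral_add) (auto simp: nn_integral_cmult simp del: emeasure_completion)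
        also have "\<dots> < top" using h L by (simp add: ennreal_mult_less_top del: emeasure_completion)
        finally show ?thesis .
      qed
      define E where "E = (\<lambda>N. {x. ?k < lr_norm r (\<lambda>j. maximal lebesgue (fN N j) x)})"
      have bound: "?W (E N) \<le> ennreal (C0 + 1) * ?R" for N
      proof -
        have "?W (E N) \<le> ennreal C0 * (\<integral>\<^sup>+x. ?H (gN N x) * w x \<partial>lebesgue)"
          using C0(2)[rule_format, OF wq ws fNm l int[unfolded gN_def]] by (simp add: E_def gN_def)
        also have "\<dots> \<le> ennreal (C0 + 1) * ?R"
        proof (rule mult_mono, goal_cases)
          case 2
          show ?case
          proof (rule nn_integral_mono)
          fix x
          show "?H (gN N x) * w x \<le> ?H (g x) * w x"
            by (cases "x \<in> ball 0 (real N)") (auto simp: gN level_profile_def)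
          qed
        qed (auto intro: ennreal_leI)
        finally show ?thesis .
      qed
      have fN_inc: "incseq (\<lambda>N. maximal lebesgue (fN N j) x)" for j x
        unfolding incseq_def by (intro allI impI maximal_mono) (auto simp: fN_def indicator_def)
      have SUP: "?Mf x = (SUP N. lr_norm r (\<lambda>j. maximal lebesgue (fN N j) x))" for x
        using r fN_inc lr_norm_SUP[of r "\<lambda>N j. maximal lebesgue (fN N j) x"]
        by (simp add: maximal_truncation_SUP[of lebesgue "f _"] fN_def)
      have Em: "E N \<in> sets lebesgue" for N
        unfolding E_def by (rule superlevel_sets_lebesgue) measurable
      have "incseq E"
        unfolding incseq_def E_def using r fN_inc
        by (auto intro!: lr_norm_mono elim!: less_le_trans simp: incseq_def)
      moreover have "{x. ?k < ?Mf x} = (\<Union>N. E N)"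
        unfolding E_def SUP by (auto simp: less_SUP_iff)
      ultimately have "?W {x. ?k < ?Mf x} = (SUP N. ?W (E N))"
        using Em by (subst SUP_emeasure_incseq) (auto simp: image_subset_iff)
      also have "\<dots> \<le> ennreal (C0 + 1) * ?R" by (intro SUP_least bound)
      finally show ?thesis .
    qed
    then show "level_estimate (C0 + 1) q r s w f l"
      by (simp add: g_def)
  qed
qed

text \<open>The power means of \<open>1/w\<close> that occur in the \<open>A\<^sub>q\<close> conditions decrease as \<open>q\<close> increases.\<close>
lemma Muckenhoupt_weight_mono:
  fixes w :: "'a::euclidean_space \<Rightarrow> real"
  assumes q: "1 < q" and qs: "q < s" and w: "Muckenhoupt_weight q A w"
  shows "Muckenhoupt_weight s A w"
  unfolding Muckenhoupt_weight_def
proof (intro conjI allI impI)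
  show wm [measurable]: "w \<in> borel_measurable lebesgue" and "0 < w x" and "0 < A" for x
    using w by (rule Muckenhoupt_weightD)+
  have wpos: "0 < w x" for x using w by (rule Muckenhoupt_weightD)
  fix c :: 'a and \<rho> :: real assume \<rho>: "0 < \<rho>"
  let ?B = "ball c \<rho>" and ?L = "emeasure lebesgue (ball c \<rho>)"
  define t where "t = (s - 1) / (q - 1)"
  have t: "1 < t" "t * (q - 1) = s - 1" using q qs by (auto simp: t_def)
  let ?u = "\<lambda>x. ennreal (w x powr (- 1 / (s - 1)))" and ?v = "\<lambda>x. ennreal (w x powr (- 1 / (q - 1)))"
  let ?U = "\<integral>\<^sup>+x\<in>?B. ?u x \<partial>lebesgue" and ?V = "\<integral>\<^sup>+x\<in>?B. ?v x \<partial>lebesgue" and ?W = "\<integral>\<^sup>+x\<in>?B. w x \<partial>lebesgue"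
  have uv: "ennpowr (?u x) t = ?v x" for x
  proof -
    have "- 1 / (s - 1) * t = - 1 / (q - 1)" using q qs by (simp add: t_def divide_simps)
    then show ?thesis by (simp add: ennpowr_ennreal powr_powr)
  qed
  have "ennpowr ?U t = ennpowr (\<integral>\<^sup>+x. (?u x * indicator ?B x) * indicator ?B x \<partial>lebesgue) t"
    by (intro arg_cong2[where f=ennpowr] nn_integral_cong) (auto simp: indicator_def)
  also have "\<dots> \<le> (\<integral>\<^sup>+x. ennpowr (?u x * indicator ?B x) t \<partial>lebesgue) *
     ennpowr (\<integral>\<^sup>+x. ennpowr (indicator ?B x) (t / (t - 1)) \<partial>lebesgue) (t - 1)"
    by (intro Hoelder_inequality_ennreal t) measurable
  also have "(\<integral>\<^sup>+x. ennpowr (?u x * indicator ?B x) t \<partial>lebesgue) = ?V"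
    unfolding ennpowr_mult uv by (intro nn_integral_cong) (simp add: indicator_def)
  also have "(\<integral>\<^sup>+x. ennpowr (indicator ?B x) (t / (t - 1)) \<partial>lebesgue) = (\<integral>\<^sup>+x. indicator ?B x \<partial>lebesgue)"
    by (intro nn_integral_cong) (simp add: indicator_def)
  also have "\<dots> = ?L" by simp
  finally have "ennpowr (ennpowr ?U t) (q - 1) \<le>
      ennpowr (?V * ennpowr ?L (t - 1)) (q - 1)"
    using q by (intro ennpowr_mono) auto
  moreover have "(t - 1) * (q - 1) = s - q" using t(2) by (simp add: algebra_simps)
  ultimately have "ennpowr ?U (s - 1) \<le>
      ennpowr ?V (q - 1) * ennpowr ?L (s - q)"
    by (simp add: t(2) ennpowr_mult del: emeasure_completion)
  then have "?W * ennpowr ?U (s - 1) \<le>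
      ?W * (ennpowr ?V (q - 1) * ennpowr ?L (s - q))"
    by (rule mult_left_mono) simp
  also have "\<dots> \<le> ennreal A * ennpowr ?L q * ennpowr ?L (s - q)"
    unfolding mult.assoc[symmetric] by (intro mult_right_mono Muckenhoupt_weightD(4)[OF w \<rho>]) simp
  also have "\<dots> = ennreal A * ennpowr ?L s"
    using ennpowr_add[of ?L q "s - q"] by (simp add: mult.assoc)
  finally show "?W * ennpowr ?U (s - 1) \<le> ennreal A * ennpowr ?L s" .
qed

text \<open>The function \<open>e\<close> may fail to be measurable, in which case its integral is a lower integral. This can happen for
\<open>\<phi>(x,g(x))\<close> when \<open>\<phi>(x,\<cdot>)\<close> has jumps.\<close>
lemma nn_integral_scale_le:
  assumes [measurable]: "h \<in> borel_measurable M" and c: "0 < c" and le: "\<And>x. h x \<le> ennreal c * e x"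
  shows "(\<integral>\<^sup>+x. h x \<partial>M) \<le> ennreal c * (\<integral>\<^sup>+x. e x \<partial>M)"
proof -
  have one: "ennreal (1/c) * ennreal c = 1" using c by (simp add: ennreal_mult'[symmetric])
  have "ennreal (1/c) * h x \<le> e x" for x
    using mult_left_mono[OF le, of "ennreal (1/c)" x] by (simp add: mult.assoc[symmetric] one)
  then have "(\<integral>\<^sup>+x. ennreal (1/c) * h x \<partial>M) \<le> (\<integral>\<^sup>+x. e x \<partial>M)"
    by (intro nn_integral_mono)
  then have "ennreal c * (ennreal (1/c) * (\<integral>\<^sup>+x. h x \<partial>M)) \<le> ennreal c * (\<integral>\<^sup>+x. e x \<partial>M)"
    by (intro mult_left_mono) (auto simp: nn_integral_cmult)
  moreover have "ennreal c * (ennreal (1/c) * X) = X" for X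
    unfolding mult.assoc[symmetric] mult.commute[of "ennreal c"] one by simp
  ultimately show ?thesis by simp
qed

section \<open>Summation over dyadic levels\<close>

text \<open>At a finite value \<open>t > 0\<close>, the lower type bounds \<open>\<phi>(x,2\<^sup>k)\<close> for \<open>2\<^sup>k < 2t\<close> and makes the terms with exponent \<open>q < p\<^sub>1\<close> a
geometric series in \<open>2\<^sup>k/(2t)\<close>; the upper type does the same for \<open>2\<^sup>k \<ge> t\<close> and the exponent \<open>e > p\<^sub>2\<close>, with a series in
\<open>t/2\<^sup>k\<close>.\<close>
lemma modular_dyadic_lower:
  fixes \<phi> :: "real ^ 'n \<Rightarrow> real \<Rightarrow> real"
  assumes \<phi>: "Orlicz_function (\<phi> x)" and C: "0 < C1" "0 < C2"
    and lower: "\<And>t s. 0 \<le> t \<Longrightarrow> 0 \<le> s \<Longrightarrow> s \<le> 1 \<Longrightarrow> \<phi> x (s * t) \<le> C1 * s powr p1 * \<phi> x t"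
    and upper: "\<And>t s. 0 \<le> t \<Longrightarrow> 1 \<le> s \<Longrightarrow> \<phi> x (s * t) \<le> C2 * s powr p2 * \<phi> x t"
    and q: "q < p1" and e: "p2 < e"
  shows "(\<integral>\<^sup>+k. level_profile q e (dyadic k) T * ennreal (\<phi> x (dyadic k)) \<partial>count_space UNIV) \<le>
     ennreal (C1 * C2 * 2 powr (p2 - q) / (1 - 2 powr (- (p1 - q))) + C2 / (1 - 2 powr (- (e - p2)))) * MO_extend \<phi> x T"
    (is "_ \<le> ennreal (?a * _ / ?d1 + ?b / ?d2) * _")
proof -
  have d: "0 < ?d1" "0 < ?d2"
    using q e powr_less_mono[of "- (p1 - q)" 0 2] powr_less_mono[of "- (e - p2)" 0 2] by auto
  let ?c1 = "C1 * C2 * 2 powr (p2 - q)"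
  have pos: "0 < ?c1 / ?d1 + C2 / ?d2" using d C by (intro add_pos_pos divide_pos_pos) auto
  show ?thesis
  proof (cases T)
    case top
    then show ?thesis using pos by (simp add: MO_extend_def ennreal_mult_top)
  next
    case (real t)
    show ?thesis
    proof (cases "t = 0")
      case True
      then show ?thesis using real by (simp add: level_profile_def)
    next
      case False
      with real have t: "0 < t" by simp
      have ft: "0 \<le> \<phi> x t" using Orlicz_functionD(4)[OF \<phi>] t by simp
      let ?A = "\<lambda>k. ennreal ((dyadic k / (2 * t)) powr (p1 - q)) * indicator {k. dyadic k \<le> 2 * t} k"
      let ?B = "\<lambda>k. ennreal ((t / dyadic k) powr (e - p2)) * indicator {k. t \<le> dyadic k} k"
      have hi: "ennreal (dyadic k powr - q) * (ennpowr T q * indicator {ennreal (dyadic k / 2)<..} T) *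
          ennreal (\<phi> x (dyadic k)) \<le> ennreal (?c1 * \<phi> x t) * ?A k" for k
      proof (cases "dyadic k < 2 * t")
        case True
        define u where "u = dyadic k / (2 * t)"
        have u: "0 < u" "u \<le> 1" "dyadic k = u * (2 * t)" using True t by (auto simp: u_def)
        have "\<phi> x (dyadic k) \<le> C1 * u powr p1 * \<phi> x (2 * t)"
          unfolding u(3) using u t by (intro lower) auto
        also have "\<dots> \<le> C1 * u powr p1 * (C2 * 2 powr p2 * \<phi> x t)"
          using C t by (intro mult_left_mono upper) auto
        finally have "dyadic k powr - q * t powr q * \<phi> x (dyadic k) \<le>
            dyadic k powr - q * t powr q * (C1 * u powr p1 * (C2 * 2 powr p2 * \<phi> x t))"
          by (intro mult_left_mono) auto
        moreover have "dyadic k powr - q * t powr q * (C1 * u powr p1 * (C2 * 2 powr p2 * \<phi> x t)) =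
           ?c1 * \<phi> x t * u powr (p1 - q)"
        proof -
          have "dyadic k powr - q * t powr q = u powr - q * 2 powr - q"
            unfolding u(3) using u(1) t by (simp add: powr_mult powr_minus)
          moreover have "2 powr (p2 - q) = (2 powr p2 * 2 powr - q :: real)" "u powr (p1 - q) = u powr p1 * u powr - q"
            by (simp_all add: powr_add[symmetric])
          ultimately show ?thesis by (simp only: mult_ac)
        qed
        ultimately have "ennreal (dyadic k powr - q * t powr q * \<phi> x (dyadic k)) \<le> ennreal (?c1 * \<phi> x t * u powr (p1 - q))"
          by (simp only: ennreal_leI)
        then show ?thesis
          using True real t ft C Orlicz_functionD(4)[OF \<phi>, of "dyadic k"]
          by (simp add: ennpowr_ennreal u_def[symmetric] ennreal_less_iff ennreal_mult mult.assoc)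
      next
        case False
        then show ?thesis using real t by (simp add: ennreal_less_iff)
      qed
      have lo: "ennreal (dyadic k powr - e) * (ennpowr T e * indicator {..ennreal (dyadic k)} T) *
          ennreal (\<phi> x (dyadic k)) \<le> ennreal (C2 * \<phi> x t) * ?B k" for k
      proof (cases "t \<le> dyadic k")
        case True
        define v where "v = t / dyadic k"
        have v: "0 < v" "v \<le> 1" "t = v * dyadic k" using True t by (auto simp: v_def)
        have "\<phi> x (dyadic k) = \<phi> x ((1 / v) * t)" using v by simp
        also have "\<dots> \<le> C2 * (1 / v) powr p2 * \<phi> x t" using v t by (intro upper) auto
        finally have "dyadic k powr - e * t powr e * \<phi> x (dyadic k) \<le>
            dyadic k powr - e * t powr e * (C2 * (1 / v) powr p2 * \<phi> x t)"
          by (intro mult_left_mono) auto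
        moreover have "dyadic k powr - e * t powr e * (C2 * (1 / v) powr p2 * \<phi> x t) =
            C2 * \<phi> x t * v powr (e - p2)"
        proof -
          have "dyadic k powr - e * t powr e = v powr e"
            unfolding v_def using t by (simp add: powr_divide powr_minus_divide)
          moreover have "v powr (e - p2) = v powr e * (1 / v) powr p2"
            using v(1) by (simp add: powr_divide powr_diff)
          ultimately show ?thesis by (simp only: mult_ac)
        qed
        ultimately have "ennreal (dyadic k powr - e * t powr e * \<phi> x (dyadic k)) \<le> ennreal (C2 * \<phi> x t * v powr (e - p2))"
          by (simp only: ennreal_leI)
        then show ?thesis
          using True real t ft C Orlicz_functionD(4)[OF \<phi>, of "dyadic k"]
          by (simp add: ennpowr_ennreal v_def[symmetric] ennreal_mult mult.assoc)
      next
        case False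
        then show ?thesis using real t by simp
      qed
      have "(\<integral>\<^sup>+k. level_profile q e (dyadic k) T * ennreal (\<phi> x (dyadic k)) \<partial>count_space UNIV) \<le>
         (\<integral>\<^sup>+k. ennreal (?c1 * \<phi> x t) * ?A k + ennreal (C2 * \<phi> x t) * ?B k \<partial>count_space UNIV)"
        unfolding level_profile_def distrib_right by (intro nn_integral_mono add_mono hi lo)
      also have "\<dots> = ennreal (?c1 * \<phi> x t) * (\<integral>\<^sup>+k. ?A k \<partial>count_space UNIV) + ennreal (C2 * \<phi> x t) * (\<integral>\<^sup>+k. ?B k \<partial>count_space UNIV)"
        by (simp add: nn_integral_add nn_integral_cmult)
      also have "\<dots> \<le> ennreal (?c1 * \<phi> x t) * ennreal (1 / ?d1) + ennreal (C2 * \<phi> x t) * ennreal (1 / ?d2)"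
        using q e t by (intro add_mono mult_left_mono sum_dyadic_powers_below sum_dyadic_powers_above) auto
      also have "\<dots> = ennreal ((?c1 / ?d1 + C2 / ?d2) * \<phi> x t)"
        using d C ft by (simp add: ennreal_mult'[symmetric] ennreal_plus[symmetric] distrib_right del: ennreal_plus)
      also have "\<dots> = ennreal (?c1 / ?d1 + C2 / ?d2) * MO_extend \<phi> x T"
      proof -
        have "MO_extend \<phi> x T = ennreal (\<phi> x t)" using real by (simp add: MO_extend_def)
        then show ?thesis by (simp only: ennreal_mult[OF less_imp_le[OF pos] ft])
      qed
      finally show ?thesis .
    qed
  qed
qed

text \<open>The level inequality is applied at the levels \<open>2\<^sup>k\<close> to the weights \<open>\<phi>(\<cdot>,2\<^sup>k)\<close>. The exponent \<open>s\<close> is chosen above \<open>q\<close>, so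
that these weights also satisfy the \<open>A\<^sub>s\<close> condition, and so large that \<open>r s\<close> exceeds the upper type.\<close>
lemma vector_maximal_modular:
  fixes \<phi> :: "real ^ 'n \<Rightarrow> real \<Rightarrow> real" and r :: real
  assumes r: "1 < r" and \<phi>: "Musielak_Orlicz_function \<phi>"
    and lower: "uniformly_lower_type \<phi> p1" and upper: "uniformly_upper_type \<phi> p2"
    and q: "1 < q" "q < p1" and w: "\<And>t. 0 < t \<Longrightarrow> Muckenhoupt_weight q A (\<lambda>x. \<phi> x t)"
  shows "\<exists>C>0. \<forall>f :: 'i::countable \<Rightarrow> real ^ 'n \<Rightarrow> ennreal. (\<forall>j. f j \<in> borel_measurable lebesgue) \<longrightarrow>
     MO_modular \<phi> (\<lambda>x. lr_norm r (\<lambda>j. maximal lebesgue (f j) x)) \<le> ennreal C * MO_modular \<phi> (\<lambda>x. lr_norm r (\<lambda>j. f j x))"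
proof -
  have O: "Orlicz_function (\<phi> x)" for x using \<phi> by (simp add: Musielak_Orlicz_function_def)
  obtain C1 where "0 < C1" and l: "\<forall>x. \<forall>t\<ge>0. \<forall>s\<in>{0..1}. \<phi> x (s * t) \<le> C1 * s powr p1 * \<phi> x t"
    using lower unfolding uniformly_lower_type_def by blast
  then have C1: "0 < C1" "\<And>x t s. 0 \<le> t \<Longrightarrow> 0 \<le> s \<Longrightarrow> s \<le> 1 \<Longrightarrow> \<phi> x (s * t) \<le> C1 * s powr p1 * \<phi> x t"
    by simp_all
  obtain C2 where "0 < C2" and u: "\<forall>x. \<forall>t\<ge>0. \<forall>s\<ge>1. \<phi> x (s * t) \<le> C2 * s powr p2 * \<phi> x t"
    using upper unfolding uniformly_upper_type_def by blast
  then have C2: "0 < C2" "\<And>x t s. 0 \<le> t \<Longrightarrow> 1 \<le> s \<Longrightarrow> \<phi> x (s * t) \<le> C2 * s powr p2 * \<phi> x t"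
    by simp_all
  have A: "0 < A" using Muckenhoupt_weightD(3)[OF w[of 1]] by simp
  define s where "s = max q (p2 / r) + 1"
  have s: "1 < s" "q < s" "p2 < r * s"
  proof -
    have "p2 / r < s" by (simp add: s_def)
    then show "p2 < r * s" using r by (simp add: field_simps)
  qed (use q in \<open>simp_all add: s_def\<close>)
  define K where "K = (5 ^ DIM(real ^ 'n) :: real)"
  have K: "1 \<le> K" by (simp add: K_def)
  obtain CL where CL: "0 < CL" "\<forall>(w :: real ^ 'n \<Rightarrow> real) (f :: 'i \<Rightarrow> real ^ 'n \<Rightarrow> ennreal) l.
       Muckenhoupt_weight q A w \<longrightarrow> Muckenhoupt_weight s A w \<longrightarrow> (\<forall>j. f j \<in> borel_measurable lebesgue) \<longrightarrow> 0 < l \<longrightarrow>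
       level_estimate CL q r s w f l"
    using level_inequality[OF r s(1) q(1) A A, where 'a="real ^ 'n" and 'i='i] by blast
  define cu where "cu = C2 * (2 * K) powr p2"
  define cl where "cl = C1 * C2 * 2 powr (p2 - q) / (1 - 2 powr (- (p1 - q))) + C2 / (1 - 2 powr (- (r * s - p2)))"
  have cu: "0 < cu" using C2 K by (simp add: cu_def)
  have cl: "0 < cl"
    unfolding cl_def using q s C1(1) C2(1) powr_less_mono[of "- (p1 - q)" 0 2] powr_less_mono[of "- (r * s - p2)" 0 2]
    by (intro add_pos_pos divide_pos_pos mult_pos_pos) auto
  show ?thesis
  proof (intro exI[of _ "cu * CL * cl"] conjI allI impI)
    show "0 < cu * CL * cl" using cu cl CL by simp
    fix f :: "'i \<Rightarrow> real ^ 'n \<Rightarrow> ennreal"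
    assume f': "\<forall>j. f j \<in> borel_measurable lebesgue"
    then have [measurable]: "f j \<in> borel_measurable lebesgue" for j by blast
    have w_meas [measurable]: "(\<lambda>x. \<phi> x (dyadic k)) \<in> borel_measurable lebesgue" for k :: int
      using Muckenhoupt_weightD(1)[OF w] by simp
    define g where "g = (\<lambda>x. lr_norm r (\<lambda>j. f j x))"
    define T where "T = (\<lambda>x. lr_norm r (\<lambda>j. maximal lebesgue (f j) x))"
    have g [measurable]: "g \<in> borel_measurable lebesgue" unfolding g_def by measurable
    have T [measurable]: "T \<in> borel_measurable lebesgue" unfolding T_def by measurable
    have level: "(\<integral>\<^sup>+x. ennreal (\<phi> x (dyadic k)) * indicator {ennreal (K * dyadic k)<..} (T x) \<partial>lebesgue) \<le>
       ennreal CL * (\<integral>\<^sup>+x. level_profile q (r * s) (dyadic k) (g x) * ennreal (\<phi> x (dyadic k)) \<partial>lebesgue)" for k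
    proof -
      have wk: "Muckenhoupt_weight q A (\<lambda>x. \<phi> x (dyadic k))" by (rule w) simp
      have E: "{x. ennreal (K * dyadic k) < T x} \<in> sets lebesgue" by (rule superlevel_sets_lebesgue[OF T])
      have "emeasure (weighted (\<lambda>x. \<phi> x (dyadic k))) {x. ennreal (K * dyadic k) < T x} =
          (\<integral>\<^sup>+x. ennreal (\<phi> x (dyadic k)) * indicator {x. ennreal (K * dyadic k) < T x} x \<partial>lebesgue)"
        by (rule emeasure_density[OF _ E]) measurable
      then have "(\<integral>\<^sup>+x. ennreal (\<phi> x (dyadic k)) * indicator {ennreal (K * dyadic k)<..} (T x) \<partial>lebesgue) =
          emeasure (weighted (\<lambda>x. \<phi> x (dyadic k))) {x. ennreal (K * dyadic k) < T x}"
        by (simp only: indicator_def mem_Collect_eq greaterThan_iff)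
      also have "\<dots> \<le> ennreal CL * (\<integral>\<^sup>+x. level_profile q (r * s) (dyadic k) (g x) * ennreal (\<phi> x (dyadic k)) \<partial>lebesgue)"
        unfolding T_def g_def K_def
        using CL(2)[rule_format, OF wk Muckenhoupt_weight_mono[OF q(1) s(2) wk] f'[rule_format], of "dyadic k"] by simp
      finally show ?thesis .
    qed
    define u where "u = (\<lambda>k x. ennreal (\<phi> x (dyadic k)) * indicator {ennreal (K * dyadic k)<..} (T x))"
    define v where "v = (\<lambda>k x. level_profile q (r * s) (dyadic k) (g x) * ennreal (\<phi> x (dyadic k)))"
    let ?U = "\<lambda>x. \<integral>\<^sup>+k. u k x \<partial>count_space UNIV" and ?V = "\<lambda>x. \<integral>\<^sup>+k. v k x \<partial>count_space UNIV"
    let ?u = "\<lambda>k. \<integral>\<^sup>+x. u k x \<partial>lebesgue" and ?v = "\<lambda>k. \<integral>\<^sup>+x. v k x \<partial>lebesgue"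
    have [measurable]: "u k \<in> borel_measurable lebesgue" "v k \<in> borel_measurable lebesgue" for k
      unfolding u_def v_def
      by (intro borel_measurable_times_ennreal measurable_compose[OF T] measurable_compose[OF g] level_profile_measurable
        measurable_compose[OF w_meas] measurable_ennreal borel_measurable_indicator; simp)+
    have up: "MO_extend \<phi> x (T x) \<le> ennreal cu * ?U x" for x
      unfolding cu_def u_def MO_extend_def by (rule Orlicz_dyadic_upper[OF O C2(1) K C2(2)])
    have low: "?V x \<le> ennreal cl * MO_extend \<phi> x (g x)" for x
      unfolding cl_def v_def by (rule modular_dyadic_lower[OF O C1(1) C2(1) C1(2) C2(2) q(2) s(3)])
    have "MO_modular \<phi> T \<le> (\<integral>\<^sup>+x. ennreal cu * ?U x \<partial>lebesgue)"
      unfolding MO_modular_def by (rule nn_integral_mono) (rule up)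
    also have "\<dots> = ennreal cu * (\<integral>\<^sup>+x. ?U x \<partial>lebesgue)"
      by (rule nn_integral_cmult) measurable
    also have "(\<integral>\<^sup>+x. ?U x \<partial>lebesgue) = (\<integral>\<^sup>+k. ?u k \<partial>count_space UNIV)"
      by (rule nn_integral_count_space_nn_integral) simp_all
    also have "ennreal cu * \<dots> \<le> ennreal cu * (\<integral>\<^sup>+k. ennreal CL * ?v k \<partial>count_space UNIV)"
      unfolding u_def v_def by (rule mult_left_mono, rule nn_integral_mono, rule level) simp
    also have "(\<integral>\<^sup>+k. ennreal CL * ?v k \<partial>count_space UNIV) = ennreal CL * (\<integral>\<^sup>+k. ?v k \<partial>count_space UNIV)"
      by (rule nn_integral_cmult) simp
    also have "(\<integral>\<^sup>+k. ?v k \<partial>count_space UNIV) = (\<integral>\<^sup>+x. ?V x \<partial>lebesgue)"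
      by (rule nn_integral_count_space_nn_integral[symmetric]) simp_all
    also have "ennreal cu * (ennreal CL * \<dots>) \<le> ennreal cu * (ennreal CL * (ennreal cl * MO_modular \<phi> g))"
      unfolding MO_modular_def by (rule mult_left_mono, rule mult_left_mono, rule nn_integral_scale_le[OF _ cl low]) simp_all
    also have "\<dots> = ennreal (cu * CL * cl) * MO_modular \<phi> g"
      using cu CL(1) cl by (simp add: ennreal_mult mult_ac)
    finally show "MO_modular \<phi> (\<lambda>x. lr_norm r (\<lambda>j. maximal lebesgue (f j) x)) \<le> ennreal (cu * CL * cl) * MO_modular \<phi> (\<lambda>x. lr_norm r (\<lambda>j. f j x))"
      by (simp add: T_def g_def)
  qed
qed

section \<open>The vector-valued inequality in Musielak-Orlicz spaces\<close>

lemma Muckenhoupt_class_weight: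
  fixes \<phi> :: "real ^ 'n \<Rightarrow> real \<Rightarrow> real"
  assumes \<phi>: "Musielak_Orlicz_function \<phi>" and q: "1 < q" and mem: "\<phi> \<in> Muckenhoupt_class q"
  shows "\<exists>A. \<forall>t>0. Muckenhoupt_weight q A (\<lambda>x. \<phi> x t)"
proof -
  define S where "S = (SUP t\<in>{0<..}. SUP B\<in>balls.
               1 / ennpowr (emeasure lebesgue B) q * (\<integral>\<^sup>+x\<in>B. ennreal (\<phi> x t) \<partial>lebesgue) *
               ennpowr (\<integral>\<^sup>+y\<in>B. ennreal (\<phi> y t powr (- (q / (q - 1) / q))) \<partial>lebesgue) (q / (q / (q - 1))))"
  have "S < \<infinity>" using mem q by (simp add: Muckenhoupt_class_def S_def Let_def)
  then obtain a where a: "S = ennreal a" "0 \<le> a" by (cases S) auto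
  then have S_le: "S \<le> ennreal (a + 1)" by (auto intro: ennreal_leI)
  have e: "- (q / (q - 1) / q) = - 1 / (q - 1)" "q / (q / (q - 1)) = q - 1" using q by auto
  have "Muckenhoupt_weight q (a + 1) (\<lambda>x. \<phi> x t)" if t: "0 < t" for t
    unfolding Muckenhoupt_weight_def
  proof (intro conjI allI impI)
    show "(\<lambda>x. \<phi> x t) \<in> borel_measurable lebesgue" using \<phi> t by (simp add: Musielak_Orlicz_function_def)
    show "0 < \<phi> x t" for x using \<phi> t by (simp add: Musielak_Orlicz_function_def Orlicz_function_def)
    show "0 < a + 1" using a by simp
    fix c :: "real ^ 'n" and \<rho> :: real assume \<rho>: "0 < \<rho>"
    let ?L = "ennpowr (emeasure lebesgue (ball c \<rho>)) q"
    let ?I = "\<integral>\<^sup>+x\<in>ball c \<rho>. ennreal (\<phi> x t) \<partial>lebesgue"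
    let ?J = "ennpowr (\<integral>\<^sup>+x\<in>ball c \<rho>. ennreal (\<phi> x t powr (- 1 / (q - 1))) \<partial>lebesgue) (q - 1)"
    have L: "0 < ?L" "?L < top"
      using emeasure_lebesgue_ball[OF \<rho>, of c] by (auto simp: zero_less_iff_neq_zero simp del: emeasure_completion)
    have "1 / ?L * ?I * ?J \<le> S"
      unfolding S_def e using t \<rho> by (intro SUP_upper2[where i=t] SUP_upper2[where i="ball c \<rho>"]) (auto simp: balls_def)
    then have "?L * (1 / ?L * ?I * ?J) \<le> ?L * ennreal (a + 1)"
      by (intro mult_left_mono order.trans[OF _ S_le]) auto
    moreover have "?L * (1 / ?L * ?I * ?J) = ?I * ?J"
      using ennreal_mult_divide_cancel[OF L, of 1] by (simp only: mult.assoc[symmetric] mult_1_left)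
    ultimately show "?I * ?J \<le> ennreal (a + 1) * ?L" by (simp only: mult.commute)
  qed
  then show ?thesis by blast
qed

text \<open>The essential supremum bounds \<open>\<phi>(x,t)\<^sup>-\<^sup>1\<close> almost everywhere on the ball and hence every power mean of it, so the class with
index \<open>1\<close> is contained in all others. This is needed when \<open>1\<close> is the only index known to lie below the lower
type, because Lerner's argument requires an exponent greater than \<open>1\<close>.\<close>
lemma Muckenhoupt_class_one_weight:
  fixes \<phi> :: "real ^ 'n \<Rightarrow> real \<Rightarrow> real"
  assumes \<phi>: "Musielak_Orlicz_function \<phi>" and q: "1 < q" and mem: "\<phi> \<in> Muckenhoupt_class 1"
  shows "\<exists>A. \<forall>t>0. Muckenhoupt_weight q A (\<lambda>x. \<phi> x t)"
proof -
  define S where "S = (SUP t\<in>{0<..}. SUP B\<in>balls.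
              1 / emeasure lebesgue B * (\<integral>\<^sup>+x\<in>B. ennreal (\<phi> x t) \<partial>lebesgue) *
              esssup (restrict_space lebesgue B) (\<lambda>y. ennreal (1 / \<phi> y t)))"
  have "S < \<infinity>" using mem by (simp add: Muckenhoupt_class_def S_def)
  then obtain a where a: "S = ennreal a" "0 \<le> a" by (cases S) auto
  then have S_le: "S \<le> ennreal (a + 1)" by (auto intro: ennreal_leI)
  have "Muckenhoupt_weight q (a + 1) (\<lambda>x. \<phi> x t)" if t: "0 < t" for t
    unfolding Muckenhoupt_weight_def
  proof (intro conjI allI impI)
    show m [measurable]: "(\<lambda>x. \<phi> x t) \<in> borel_measurable lebesgue" using \<phi> t by (simp add: Musielak_Orlicz_function_def)
    show "0 < \<phi> x t" for x using \<phi> t by (simp add: Musielak_Orlicz_function_def Orlicz_function_def)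
    then have pos: "0 < \<phi> x t" for x .
    show "0 < a + 1" using a by simp
    fix c :: "real ^ 'n" and \<rho> :: real assume \<rho>: "0 < \<rho>"
    let ?B = "ball c \<rho>"
    let ?L = "emeasure lebesgue ?B"
    let ?I = "\<integral>\<^sup>+x\<in>?B. ennreal (\<phi> x t) \<partial>lebesgue"
    let ?J = "\<integral>\<^sup>+x\<in>?B. ennreal (\<phi> x t powr (- 1 / (q - 1))) \<partial>lebesgue"
    let ?E = "esssup (restrict_space lebesgue ?B) (\<lambda>y. ennreal (1 / \<phi> y t))"
    have L: "0 < ?L" "?L < top" using \<rho> by (intro emeasure_lebesgue_ball; simp)+
    have "1 / ?L * ?I * ?E \<le> S"
      unfolding S_def using t \<rho> by (intro SUP_upper2[where i=t] SUP_upper2[where i="?B"]) (auto simp: balls_def)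
    then have "?L * (1 / ?L * ?I * ?E) \<le> ?L * ennreal (a + 1)"
      by (intro mult_left_mono order.trans[OF _ S_le]) auto
    moreover have "?L * (1 / ?L * ?I * ?E) = ?I * ?E"
      using ennreal_mult_divide_cancel[OF L, of 1] by (simp only: mult.assoc[symmetric] mult_1_left)
    ultimately have IE: "?I * ?E \<le> ?L * ennreal (a + 1)" by simp
    have "AE x in lebesgue. x \<in> ?B \<longrightarrow> ennreal (1 / \<phi> x t) \<le> ?E"
      using esssup_AE[of "\<lambda>y. ennreal (1 / \<phi> y t)" "restrict_space lebesgue ?B"] by (simp add: AE_restrict_space_iff)
    then have "AE x in lebesgue. ennreal (\<phi> x t powr (- 1 / (q - 1))) * indicator ?B x \<le> ennpowr ?E (1 / (q - 1)) * indicator ?B x"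
    proof (rule eventually_mono)
      fix x assume x: "x \<in> ?B \<longrightarrow> ennreal (1 / \<phi> x t) \<le> ?E"
      show "ennreal (\<phi> x t powr (- 1 / (q - 1))) * indicator ?B x \<le> ennpowr ?E (1 / (q - 1)) * indicator ?B x"
      proof (cases "x \<in> ?B")
        case True
        then have "ennpowr (ennreal (1 / \<phi> x t)) (1 / (q - 1)) \<le> ennpowr ?E (1 / (q - 1))"
          using x q by (intro ennpowr_mono) auto
        moreover have "(1 / \<phi> x t) powr (1 / (q - 1)) = \<phi> x t powr (- 1 / (q - 1))"
          using pos[of x] by (simp add: powr_divide powr_minus_divide)
        ultimately show ?thesis using True pos[of x] by (simp add: ennpowr_ennreal less_imp_le)
      qed simp
    qed
    then have "?J \<le> (\<integral>\<^sup>+x\<in>?B. ennpowr ?E (1 / (q - 1)) \<partial>lebesgue)" by (rule nn_integral_mono_AE)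
    also have "\<dots> = ennpowr ?E (1 / (q - 1)) * ?L" by (rule nn_integral_cmult_indicator) simp
    finally have "ennpowr ?J (q - 1) \<le> ennpowr (ennpowr ?E (1 / (q - 1)) * ?L) (q - 1)"
      using q by (intro ennpowr_mono) auto
    then have "?I * ennpowr ?J (q - 1) \<le> ?I * (?E * ennpowr ?L (q - 1))"
      using q by (intro mult_left_mono) (auto simp: ennpowr_mult simp del: emeasure_completion)
    also have "\<dots> \<le> ?L * ennreal (a + 1) * ennpowr ?L (q - 1)"
      unfolding mult.assoc[symmetric] by (intro mult_right_mono IE) simp
    also have "\<dots> = ennreal (a + 1) * ennpowr ?L q"
      using ennpowr_add[of ?L 1 "q - 1"] by (simp add: mult_ac del: emeasure_completion)
    finally show "?I * ennpowr ?J (q - 1) \<le> ennreal (a + 1) * ennpowr ?L q" .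
  qed
  then show ?thesis by blast
qed

lemma Hardy_Littlewood_maximal_eq:
  "Hardy_Littlewood_maximal f x = maximal lebesgue (\<lambda>y. ennreal (norm (f y))) x"
proof (rule antisym)
  show "Hardy_Littlewood_maximal f x \<le> maximal lebesgue (\<lambda>y. ennreal (norm (f y))) x"
    unfolding Hardy_Littlewood_maximal_def
  proof (rule SUP_least)
    fix B assume "B \<in> {B \<in> balls. x \<in> B}"
    then obtain c \<rho> where B: "B = ball c \<rho>" "0 < \<rho>" "x \<in> ball c \<rho>" by (auto simp: balls_def)
    show "1 / emeasure lebesgue B * (\<integral>\<^sup>+y\<in>B. ennreal (norm (f y)) \<partial>lebesgue) \<le> maximal lebesgue (\<lambda>y. ennreal (norm (f y))) x"
      using maximal_upper[OF B(2,3), of lebesgue "\<lambda>y. ennreal (norm (f y))"]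
      by (simp only: B(1) divide_ennreal_def mult_1_left mult.commute)
  qed
  show "maximal lebesgue (\<lambda>y. ennreal (norm (f y))) x \<le> Hardy_Littlewood_maximal f x"
  proof (rule maximal_least)
    fix c \<rho> assume \<rho>: "0 < \<rho>" "x \<in> ball c \<rho>"
    have "1 / emeasure lebesgue (ball c \<rho>) * (\<integral>\<^sup>+y\<in>ball c \<rho>. ennreal (norm (f y)) \<partial>lebesgue) \<le> Hardy_Littlewood_maximal f x"
      unfolding Hardy_Littlewood_maximal_def using \<rho> by (intro SUP_upper) (auto simp: balls_def)
    then show "(\<integral>\<^sup>+y\<in>ball c \<rho>. ennreal (norm (f y)) \<partial>lebesgue) / emeasure lebesgue (ball c \<rho>) \<le> Hardy_Littlewood_maximal f x"
      by (simp only: divide_ennreal_def mult_1_left mult.commute)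
  qed
qed

lemma lr_aggregate_eq_lr_norm:
  assumes "r \<noteq> \<infinity>"
  shows "lr_aggregate r a = lr_norm (enn2real r) a"
proof -
  have "infsum f UNIV = (\<integral>\<^sup>+j. f j \<partial>count_space UNIV)" for f :: "int \<Rightarrow> ennreal"
    unfolding nn_integral_count_space_eq_SUP by (subst nonneg_infsum_complete) auto
  then show ?thesis using assms by (simp add: lr_aggregate_def lr_norm_def)
qed

text \<open>A single function is a family indexed by the unit type, so the vector-valued inequality contains the scalar one.\<close>
lemma lr_norm_unit:
  fixes a :: "unit \<Rightarrow> ennreal"
  assumes "0 < r" shows "lr_norm r a = a ()"
proof -
  have "(\<integral>\<^sup>+j. ennpowr (a j) r \<partial>count_space UNIV) = ennpowr (a ()) r"
    by (subst nn_integral_count_space_finite) (simp_all only: UNIV_unit finite.intros sum.insert sum.empty empty_iff simp_thms add_0_right)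
  then show ?thesis using assms by (simp add: lr_norm_def)
qed

lemma MO_extend_mono:
  assumes "Orlicz_function (\<phi> x)" "s \<le> t"
  shows "MO_extend \<phi> x s \<le> MO_extend \<phi> x t"
  using assms(2) Orlicz_functionD(1)[OF assms(1)]
  by (cases s; cases t) (auto simp: MO_extend_def top_unique intro!: ennreal_leI)

theorem theorem2p10:
  fixes \<phi> :: "real ^ 'n \<Rightarrow> real \<Rightarrow> real"
    and r :: ennreal
    and p_lower p_upper q :: real
  assumes "1 < r"
    and "Musielak_Orlicz_function \<phi>"
    and "uniformly_lower_type \<phi> p_lower"
    and "uniformly_upper_type \<phi> p_upper"
    and "1 < q"
    and "\<phi> \<in> Muckenhoupt_class q"
    and "critical_index \<phi> < ereal p_lower"
    and "p_lower \<le> p_upper"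
  shows "\<exists>C::real. C > 0 \<and>
    (\<forall>f\<in>MO_sequence_space \<phi> r.
       MO_modular \<phi> (\<lambda>x. lr_aggregate r (\<lambda>j. Hardy_Littlewood_maximal (f j) x))
       \<le> ennreal C * MO_modular \<phi> (\<lambda>x. lr_aggregate r (\<lambda>j. ennreal (norm (f j x)))))"
proof -
  let ?lhs = "\<lambda>f x. lr_aggregate r (\<lambda>j. Hardy_Littlewood_maximal (f j) x)"
  let ?rhs = "\<lambda>f x. lr_aggregate r (\<lambda>j. ennreal (norm (f j x)))"
  obtain q0 where q0: "\<phi> \<in> Muckenhoupt_class q0" "q0 < p_lower"
    using assms(7) by (auto simp: critical_index_def INF_less_iff)
  then have "1 \<le> q0" by (simp add: Muckenhoupt_class_def)
  obtain q1 A where q1: "1 < q1" "q1 < p_lower" "\<And>t. 0 < t \<Longrightarrow> Muckenhoupt_weight q1 A (\<lambda>x. \<phi> x t)"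
  proof (cases "q0 = 1")
    case True
    define q1 where "q1 = (1 + p_lower) / 2"
    have "1 < q1" "q1 < p_lower" using q0(2) True by (auto simp: q1_def)
    moreover obtain A where "\<forall>t>0. Muckenhoupt_weight q1 A (\<lambda>x. \<phi> x t)"
      using Muckenhoupt_class_one_weight[OF assms(2) \<open>1 < q1\<close>] q0(1) unfolding True by blast
    ultimately show ?thesis by (intro that[of q1 A]) simp_all
  next
    case False
    then have "1 < q0" using \<open>1 \<le> q0\<close> by simp
    moreover obtain A where "\<forall>t>0. Muckenhoupt_weight q0 A (\<lambda>x. \<phi> x t)"
      using Muckenhoupt_class_weight[OF assms(2) \<open>1 < q0\<close> q0(1)] by blast
    ultimately show ?thesis using q0(2) by (intro that[of q0 A]) simp_all
  qed
  show ?thesis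
  proof (cases "r = \<infinity>")
    case False
    define \<rho> where "\<rho> = enn2real r"
    have \<rho>: "1 < \<rho>" using assms(1) False by (cases r) (auto simp: \<rho>_def)
    obtain C where C: "0 < C" "\<forall>f :: int \<Rightarrow> real ^ 'n \<Rightarrow> ennreal. (\<forall>j. f j \<in> borel_measurable lebesgue) \<longrightarrow>
       MO_modular \<phi> (\<lambda>x. lr_norm \<rho> (\<lambda>j. maximal lebesgue (f j) x)) \<le> ennreal C * MO_modular \<phi> (\<lambda>x. lr_norm \<rho> (\<lambda>j. f j x))"
      using vector_maximal_modular[OF \<rho> assms(2-4) q1, where 'i=int] by blast
    have "MO_modular \<phi> (?lhs f)
       \<le> ennreal C * MO_modular \<phi> (?rhs f)"
      if "f \<in> MO_sequence_space \<phi> r" for f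
    proof -
      have [measurable]: "f j \<in> borel_measurable lebesgue" for j using that by (simp add: MO_sequence_space_def)
      show ?thesis
        using C(2)[rule_format, of "\<lambda>j x. ennreal (norm (f j x))"]
        by (simp add: lr_aggregate_eq_lr_norm[OF False] Hardy_Littlewood_maximal_eq \<rho>_def)
    qed
    then show ?thesis using C(1) by blast
  next
    case True
    obtain C where C: "0 < C" "\<forall>f :: unit \<Rightarrow> real ^ 'n \<Rightarrow> ennreal. (\<forall>j. f j \<in> borel_measurable lebesgue) \<longrightarrow>
       MO_modular \<phi> (\<lambda>x. lr_norm 2 (\<lambda>j. maximal lebesgue (f j) x)) \<le> ennreal C * MO_modular \<phi> (\<lambda>x. lr_norm 2 (\<lambda>j. f j x))"
      using vector_maximal_modular[OF _ assms(2-4) q1, where 'i=unit and r=2] by auto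
    have "MO_modular \<phi> (?lhs f)
       \<le> ennreal C * MO_modular \<phi> (?rhs f)"
      if "f \<in> MO_sequence_space \<phi> r" for f
    proof -
      have [measurable]: "f j \<in> borel_measurable lebesgue" for j using that by (simp add: MO_sequence_space_def)
      define g where "g = (\<lambda>x. SUP j. ennreal (norm (f j x)))"
      have [measurable]: "g \<in> borel_measurable lebesgue" unfolding g_def by measurable
      have "MO_modular \<phi> (?lhs f) \<le> MO_modular \<phi> (maximal lebesgue g)"
        unfolding MO_modular_def
      proof (intro nn_integral_mono MO_extend_mono)
        show "Orlicz_function (\<phi> x)" for x using assms(2) by (simp add: Musielak_Orlicz_function_def)
        show "lr_aggregate r (\<lambda>j. Hardy_Littlewood_maximal (f j) x) \<le> maximal lebesgue g x" for x
          unfolding lr_aggregate_def Hardy_Littlewood_maximal_eq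
          using True by (auto simp: g_def intro!: SUP_least maximal_mono SUP_upper)
      qed
      also have "\<dots> \<le> ennreal C * MO_modular \<phi> g"
        using C(2)[rule_format, of "\<lambda>_. g"] by (simp add: lr_norm_unit)
      finally show ?thesis using True by (simp add: g_def[abs_def] lr_aggregate_def)
    qed
    then show ?thesis using C(1) by blast
  qed
qed

end
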